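(* Consider the fire dynamics with parameter $p_n\in[0,1]$ on a random recursive tree $\mathsf{T}_n$ with $n$ vertices. Let $I_n$ be the total number of fireproof vertices and let $b_{n,1}^\downarrow\ge b_{n,2}^\downarrow\ge\dots\ge0$ be the sizes (numbers of vertices) of the burnt subtrees ranked in non-increasing order, completed by zeros. (i) If $\lim_{n\to\infty}n p_n/\ln n=0$, then $\lim_{n\to\infty}n^{-1}I_n=1$ in probability. (ii) If $\lim_{n\to\infty}n p_n/\ln n=\infty$, then $\lim_{n\to\infty}n^{-1}I_n=0$ in probability. (iii) If $\lim_{n\to\infty}n p_n/\ln n=c\in(0,\infty)$, then the convergence in distribution $$n^{-1}(I_n,b_{n,1}^\downarrow,b_{n,2}^\downarrow,\dots)\longrightarrow(\epsilon_c\wedge1,\;1-(\epsilon_c\wedge1),\;0,\;0,\dots)\quad\text{as } n\to\infty$$ holds for the $\ell^1$ topology, where $\epsilon_c$ is an exponential random variable with rate $c$.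
   Context: Write $[n]=\{1,\dots,n\}$ and $a\wedge b=\min(a,b)$. A tree on the vertex set $[n]$ is called recursive if, when rooted at $1$, the sequence of vertices along any branch from the root to a leaf is increasing. There are $(n-1)!$ such trees; the random recursive tree $\mathsf{T}_n$ is one of them picked uniformly at random. Fire dynamics with parameter $p_n$ on a tree with $n$ vertices: initially every edge is flammable. The edges are considered successively in a uniform random order; an edge which has already burnt is not subject to the dynamics any more and is skipped. Otherwise, independently of everything else, the edge becomes fireproof with probability $1-p_n$ or is set on fire with probability $p_n$; in the latter case the edge burns, sets on fire its flammable neighbouring edges, and the fire propagates instantly, stopped only by fireproof edges (so that the whole connected set of flammable edges containing it burns). The dynamics continue until all edges are either burnt or fireproof. A vertex is called fireproof if all its adjacent edges are fireproof, and burnt otherwise. The fireproof edges with at least one burnt extremity are then discarded; the connected components of the resulting forest are either composed of fireproof vertices (the fireproof subtrees) or of burnt vertices (the burnt subtrees). *)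

theory Defs
  imports "HOL-Probability.Probability" "HOL-Combinatorics.Multiset_Permutations"
begin

section \<open>Trees\<close>

text \<open>A graph is a vertex set together with a set of undirected edges, each edge being a set
  of two vertices.\<close>

definition adj :: "'v set set \<Rightarrow> ('v \<times> 'v) set" where
  "adj E = {(u, v). {u, v} \<in> E}"

definition graph_path :: "'v set set \<Rightarrow> 'v list \<Rightarrow> bool" where
  "graph_path E xs \<longleftrightarrow> xs \<noteq> [] \<and> distinct xs \<and> successively (\<lambda>u v. {u, v} \<in> E) xs"

definition graph_cycle :: "'v set set \<Rightarrow> 'v list \<Rightarrow> bool" where
  "graph_cycle E xs \<longleftrightarrow> 3 \<le> length xs \<and> graph_path E xs \<and> {last xs, hd xs} \<in> E"

definition is_tree :: "'v set \<Rightarrow> 'v set set \<Rightarrow> bool" where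
  "is_tree V E \<longleftrightarrow>
     E \<subseteq> {e. e \<subseteq> V \<and> card e = 2} \<and>
     (\<forall>u\<in>V. \<forall>v\<in>V. (u, v) \<in> (adj E)\<^sup>*) \<and>
     (\<nexists>xs. graph_cycle E xs)"

definition graph_components :: "'v set \<Rightarrow> 'v set set \<Rightarrow> 'v set set" where
  "graph_components V E = (\<lambda>u. (adj E)\<^sup>* `` {u}) ` V"

definition leaf :: "'v set set \<Rightarrow> 'v \<Rightarrow> 'v \<Rightarrow> bool" where
  "leaf E r v \<longleftrightarrow> v \<noteq> r \<and> card {e \<in> E. v \<in> e} = 1"

definition branch :: "'v set set \<Rightarrow> 'v \<Rightarrow> 'v list \<Rightarrow> bool" where
  "branch E r xs \<longleftrightarrow> graph_path E xs \<and> hd xs = r \<and> leaf E r (last xs)"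

definition recursive_trees :: "nat \<Rightarrow> nat set set set" where
  "recursive_trees n =
     {E. is_tree {1..n} E \<and> (\<forall>xs. branch E 1 xs \<longrightarrow> sorted_wrt (<) xs)}"

text \<open>The two facts below ensure that the uniform distribution on the set of recursive trees
  is meaningful.\<close>

lemma finite_recursive_trees: "finite (recursive_trees n)"
proof (rule finite_subset)
  show "recursive_trees n \<subseteq> Pow (Pow {1..n})"
    by (auto simp: recursive_trees_def is_tree_def)
qed auto

lemma recursive_trees_nonempty:
  assumes "n \<ge> 1"
  shows "recursive_trees n \<noteq> {}"
proof -
  define E :: "nat set set" where "E = (\<lambda>v. {1, v}) ` {2..n}"
  have E_iff: "{u, v} \<in> E \<longleftrightarrow> (u = 1 \<and> v \<in> {2..n}) \<or> (v = 1 \<and> u \<in> {2..n})" for u v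
    unfolding E_def image_iff doubleton_eq_iff by blast
  have simple: "E \<subseteq> {e. e \<subseteq> {1..n} \<and> card e = 2}"
    using assms by (auto simp: E_def)
  have centre: "(1, v) \<in> (adj E)\<^sup>* \<and> (v, 1) \<in> (adj E)\<^sup>*" if "v \<in> {1..n}" for v
  proof (cases "v = 1")
    case False
    then have "(1, v) \<in> adj E" "(v, 1) \<in> adj E"
      using that by (auto simp: adj_def E_iff)
    then show ?thesis by (simp add: r_into_rtrancl)
  qed simp
  have conn: "(u, v) \<in> (adj E)\<^sup>*" if "u \<in> {1..n}" "v \<in> {1..n}" for u v
    using centre[OF that(1)] centre[OF that(2)] by (blast intro: rtrancl_trans)
  have acyc: "\<not> graph_cycle E xs" for xs
  proof
    assume c: "graph_cycle E xs"
    then have "length xs \<ge> 3"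
      by (simp add: graph_cycle_def)
    then obtain a b c' ys where xs: "xs = a # b # c' # ys"
      unfolding numeral_3_eq_3 Suc_le_length_iff by blast
    have d: "distinct xs" and ab: "{a, b} \<in> E" and bc: "{b, c'} \<in> E" and la: "{last xs, a} \<in> E"
      using c by (simp_all add: graph_cycle_def graph_path_def xs)
    have "last xs \<in> set (c' # ys)"
      by (simp add: xs)
    moreover have "a \<notin> set (c' # ys)" "b \<notin> set (c' # ys)"
      using d by (simp_all add: xs)
    ultimately have "last xs \<noteq> a" "last xs \<noteq> b"
      by blast+
    moreover have "a \<noteq> b" "a \<noteq> c'"
      using d by (simp_all add: xs)
    ultimately show False
      using ab bc la unfolding E_iff by linarith
  qed
  have incr: "sorted_wrt (<) xs" if b: "branch E 1 xs" for xs
  proof (cases "length xs \<le> 1")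
    case True
    then show ?thesis by (cases xs) auto
  next
    case False
    then have "Suc (Suc 0) \<le> length xs"
      by simp
    then obtain a b ys where xs: "xs = a # b # ys"
      unfolding Suc_le_length_iff by blast
    have a: "a = 1" and d: "distinct xs" and ab: "{a, b} \<in> E"
      using b by (auto simp: branch_def graph_path_def xs)
    have "ys = []"
    proof (cases ys)
      case (Cons c zs)
      then have "{b, c} \<in> E"
        using b by (auto simp: branch_def graph_path_def xs)
      then show ?thesis
        using a d unfolding E_iff by (simp add: xs Cons)
    qed
    then show ?thesis
      using a ab unfolding E_iff by (simp add: xs)
  qed
  have "E \<in> recursive_trees n"
    unfolding recursive_trees_def is_tree_def using simple conn acyc incr by blast
  then show ?thesis by blast
qed

section \<open>Fire dynamics\<close>

text \<open>For a set \<open>A\<close> of flammable edges, the edges that burn when \<open>e\<close> is set on fire.\<close>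

definition cluster :: "'v set set \<Rightarrow> 'v set \<Rightarrow> 'v set set" where
  "cluster A e = {f. (e, f) \<in> {(a, b). a \<in> A \<and> b \<in> A \<and> a \<inter> b \<noteq> {}}\<^sup>*}"

text \<open>A state is a pair \<open>(B, F)\<close> of the currently burnt and the currently fireproof edges; all
  other edges of \<open>E\<close> are flammable. The list contains the edges still to be considered.\<close>

fun fire_dynamics ::
  "real \<Rightarrow> 'v set set \<Rightarrow> 'v set list \<Rightarrow> 'v set set \<times> 'v set set \<Rightarrow> ('v set set \<times> 'v set set) pmf"
where
  "fire_dynamics p E [] (B, F) = return_pmf (B, F)"
| "fire_dynamics p E (e # es) (B, F) =
     (if e \<in> B then fire_dynamics p E es (B, F)
      else bind_pmf (bernoulli_pmf p) (\<lambda>on_fire.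
        if on_fire then fire_dynamics p E es (B \<union> cluster (E - B - F) e, F)
        else fire_dynamics p E es (B, insert e F)))"

definition fire_rrt :: "nat \<Rightarrow> real \<Rightarrow> (nat set set \<times> nat set set) pmf" where
  "fire_rrt n p =
     bind_pmf (pmf_of_set (recursive_trees n)) (\<lambda>E.
     bind_pmf (pmf_of_set (permutations_of_set E)) (\<lambda>es.
     fire_dynamics p E es ({}, {})))"

text \<open>The functions below are applied to a final state, in which every edge is either burnt or
  fireproof, so that \<open>B \<union> F\<close> is the edge set of the tree.\<close>

fun fireproof_vertices :: "'v set \<Rightarrow> 'v set set \<times> 'v set set \<Rightarrow> 'v set" where
  "fireproof_vertices V (B, F) = {v \<in> V. \<forall>e \<in> B \<union> F. v \<in> e \<longrightarrow> e \<in> F}"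

definition burnt_vertices :: "'v set \<Rightarrow> 'v set set \<times> 'v set set \<Rightarrow> 'v set" where
  "burnt_vertices V S = V - fireproof_vertices V S"

fun final_forest :: "'v set \<Rightarrow> 'v set set \<times> 'v set set \<Rightarrow> 'v set set" where
  "final_forest V (B, F) = (B \<union> F) - {e \<in> F. e \<inter> burnt_vertices V (B, F) \<noteq> {}}"

definition burnt_subtrees :: "'v set \<Rightarrow> 'v set set \<times> 'v set set \<Rightarrow> 'v set set" where
  "burnt_subtrees V S = {C \<in> graph_components V (final_forest V S). C \<subseteq> burnt_vertices V S}"

definition num_fireproof :: "nat \<Rightarrow> nat set set \<times> nat set set \<Rightarrow> nat" where
  "num_fireproof n S = card (fireproof_vertices {1..n} S)"

definition burnt_sizes :: "nat \<Rightarrow> nat set set \<times> nat set set \<Rightarrow> nat list" where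
  "burnt_sizes n S =
     rev (sorted_list_of_multiset (image_mset card (mset_set (burnt_subtrees {1..n} S))))"

text \<open>The ranked sizes are indexed from \<open>0\<close>: \<open>ranked_burnt_size n S 0\<close> is the largest one.\<close>

definition ranked_burnt_size :: "nat \<Rightarrow> nat set set \<times> nat set set \<Rightarrow> nat \<Rightarrow> nat" where
  "ranked_burnt_size n S k = (if k < length (burnt_sizes n S) then burnt_sizes n S ! k else 0)"

definition rescaled_sizes :: "nat \<Rightarrow> nat set set \<times> nat set set \<Rightarrow> nat \<Rightarrow> real" where
  "rescaled_sizes n S k =
     (case k of 0 \<Rightarrow> real (num_fireproof n S) | Suc j \<Rightarrow> real (ranked_burnt_size n S j)) / real n"

section \<open>Modes of convergence\<close>

definition l1_space :: "(nat \<Rightarrow> real) set" where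
  "l1_space = {x. (\<lambda>k. \<bar>x k\<bar>) summable_on UNIV}"

definition l1_dist :: "(nat \<Rightarrow> real) \<Rightarrow> (nat \<Rightarrow> real) \<Rightarrow> real" where
  "l1_dist x y = (\<Sum>\<^sub>\<infinity>k. \<bar>x k - y k\<bar>)"

lemma summable_l1_diff:
  assumes "x \<in> l1_space" "y \<in> l1_space"
  shows "(\<lambda>k. \<bar>x k - y k\<bar>) summable_on UNIV"
proof (rule summable_on_comparison_test)
  show "(\<lambda>k. \<bar>x k\<bar> + \<bar>y k\<bar>) summable_on UNIV"
    using assms by (auto simp: l1_space_def intro: summable_on_add)
qed (auto simp: abs_triangle_ineq4)

interpretation l1: Metric_space l1_space l1_dist
proof
  fix x y z :: "nat \<Rightarrow> real"
  show "0 \<le> l1_dist x y"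
    unfolding l1_dist_def by (rule infsum_nonneg) auto
  show "l1_dist x y = l1_dist y x"
    unfolding l1_dist_def by (simp add: abs_minus_commute)
  assume xy: "x \<in> l1_space" "y \<in> l1_space"
  show "l1_dist x y = 0 \<longleftrightarrow> x = y"
  proof
    assume "l1_dist x y = 0"
    then have "\<bar>x k - y k\<bar> = 0" for k
      using nonneg_infsum_le_0D[OF _ summable_l1_diff[OF xy], of k] by (simp add: l1_dist_def)
    then show "x = y" by auto
  qed (simp add: l1_dist_def)
  assume z: "z \<in> l1_space"
  have "l1_dist x z \<le> (\<Sum>\<^sub>\<infinity>k. \<bar>x k - y k\<bar> + \<bar>y k - z k\<bar>)"
    unfolding l1_dist_def using xy z
    by (intro infsum_mono summable_l1_diff summable_on_add) auto
  also have "\<dots> = l1_dist x y + l1_dist y z"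
    unfolding l1_dist_def using xy z by (intro infsum_add summable_l1_diff)
  finally show "l1_dist x z \<le> l1_dist x y + l1_dist y z" .
qed

text \<open>In both notions the \<open>n\<close>-th random element lives on its own probability space \<open>M n\<close>.
  Random elements of a topological space are measurable for its Borel \<open>\<sigma>\<close>-algebra.\<close>

definition converges_in_probability ::
  "(nat \<Rightarrow> 'a measure) \<Rightarrow> (nat \<Rightarrow> 'a \<Rightarrow> real) \<Rightarrow> real \<Rightarrow> bool"
where
  "converges_in_probability M X a \<longleftrightarrow>
     (\<forall>n. X n \<in> borel_measurable (M n)) \<and>
     (\<forall>\<delta>>0. (\<lambda>n. measure (M n) {\<omega> \<in> space (M n). \<bar>X n \<omega> - a\<bar> > \<delta>}) \<longlonglongrightarrow> 0)"

definition borel_of_topology :: "'b topology \<Rightarrow> 'b measure" where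
  "borel_of_topology T = sigma (topspace T) {U. openin T U}"

definition converges_in_distribution ::
  "'b topology \<Rightarrow> (nat \<Rightarrow> 'a measure) \<Rightarrow> (nat \<Rightarrow> 'a \<Rightarrow> 'b) \<Rightarrow> 'c measure \<Rightarrow> ('c \<Rightarrow> 'b) \<Rightarrow> bool"
where
  "converges_in_distribution T M X N Y \<longleftrightarrow>
     (\<forall>n. X n \<in> measurable (M n) (borel_of_topology T)) \<and>
     Y \<in> measurable N (borel_of_topology T) \<and>
     (\<forall>\<Phi>. continuous_map T euclideanreal \<Phi> \<and> bounded (\<Phi> ` topspace T) \<longrightarrow>
        (\<lambda>n. \<integral>\<omega>. \<Phi> (X n \<omega>) \<partial>M n) \<longlonglongrightarrow> (\<integral>\<omega>. \<Phi> (Y \<omega>) \<partial>N))"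

end

theory Submission
  imports Defs "HOL-Real_Asymp.Real_Asymp"
begin

text \<open>Let \<open>U\<^sub>k\<close> be the set of edges not yet considered after \<open>k\<close> steps and \<open>R\<^sub>k\<close> the component
  of the root \<open>1\<close> in \<open>U\<^sub>k\<close>. The first fire that starts in an edge of the root component burns exactly
  this component; every other fire burns only vertices connected to its starting edge in \<open>U\<^sub>k\<close>.

  All estimates are first-moment bounds on connection probabilities: \<open>u\<close> and \<open>v\<close> are connected in
  \<open>U\<^sub>k\<close> iff the \<open>d(u, v)\<close> edges of the path between them are among the last ones, which has
  probability at most \<open>q\<close> to the power \<open>d(u, v)\<close> with \<open>q = 1 - k / (n - 1)\<close>. The average over trees of
  the sum of these powers over all pairs satisfies the linear recursion
  \<open>s(n + 1) = (1 + 2 q / n) s(n) + 1\<close>, and the mean depth a similar one. At \<open>k = t n / ln n\<close> the upper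
  bound \<open>exp(- 2 t) n\<^sup>2\<close> for connected pairs and the lower bound \<open>exp(- t) n\<close> for the root component
  (Jensen's inequality) match, so that \<open>|R\<^sub>k| / n\<close> concentrates at \<open>exp(- t)\<close> and almost all
  connected pairs lie in \<open>R\<^sub>k\<close>; fires outside the root component are therefore negligible.

  The root component catches fire at step \<open>k\<close> with conditional probability about
  \<open>p exp(- t)\<close>. If \<open>n p / ln n\<close> tends to \<open>c\<close>, it has survived up to \<open>t\<close> with probability about
  \<open>exp(- c (1 - exp(- t)))\<close>, hence the number of vertices already separated from the root at that
  fire, divided by \<open>n\<close>, is asymptotically an exponential variable of rate \<open>c\<close> truncated at \<open>1\<close>.\<close>

section \<open>Recursive trees as increasing insertions\<close>

text \<open>The obstacle is that the flammable edges depend on the earlier fires. The set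
  \<open>U_k\<close> does not: it is a function of the order alone, hence independent of the marks,
  and it contains every flammable edge. So a fire burns at most a component of \<open>U_k\<close>.
  At the first root fire this bound is attained: an earlier fire, at step \<open>j\<close>, stayed
  in a component of \<open>U_j\<close> disjoint from \<open>R_j\<close>, and \<open>R_j\<close>
  contains \<open>R_k\<close>, so no edge of \<open>U_k\<close> that meets \<open>R_k\<close> has
  burnt.

  First moments suffice because there are at least \<open>|R_k|^2\<close> connected ordered pairs:
  an upper bound for their mean number and a lower bound for the mean of \<open>|R_k|\<close>
  control the deviation of \<open>|R_k|\<close> and the pairs outside \<open>R_k\<close> at once.

  The two bounds match only for \<open>t <= K\<close> with \<open>K\<close> fixed. Later fires are
  estimated crudely, in the critical regime by a term of order \<open>exp(- 2 K) n\<close>, and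
  \<open>K\<close> is chosen afterwards. With \<open>x = exp(- t)\<close> and \<open>mass\<close>
  the proportion burnt by the first root fire, survival up to \<open>t\<close> becomes the event
  \<open>mass <= x\<close>. Its limiting probability \<open>exp(- c (1 - x))\<close> is the
  distribution function of \<open>1 - min(X, 1)\<close> on \<open>[0, 1)\<close>, for
  \<open>X\<close> exponential of rate \<open>c\<close>.\<close>

abbreviation conn :: "'v set set \<Rightarrow> 'v \<Rightarrow> 'v \<Rightarrow> bool" where
  "conn U u v \<equiv> (u, v) \<in> (adj U)\<^sup>*"

lemma adj_mono: "U \<subseteq> U' \<Longrightarrow> adj U \<subseteq> adj U'"
  by (auto simp: adj_def)

lemma conn_mono: "conn U u v \<Longrightarrow> U \<subseteq> U' \<Longrightarrow> conn U' u v"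
  using rtrancl_mono[OF adj_mono] by blast

lemma conn_sym: "conn U u v \<Longrightarrow> conn U v u"
proof -
  have "sym (adj U)" by (auto simp: sym_def adj_def insert_commute)
  then show "conn U u v \<Longrightarrow> conn U v u" by (metis sym_rtrancl symD)
qed

lemma conn_trans: "conn U u v \<Longrightarrow> conn U v w \<Longrightarrow> conn U u w"
  by (rule rtrancl_trans)

lemma conn_edge: "{u, v} \<in> U \<Longrightarrow> conn U u v"
  by (auto simp: adj_def)

lemma conn_step: "conn U u v \<Longrightarrow> {v, w} \<in> U \<Longrightarrow> conn U u w"
  using conn_trans conn_edge by metis

lemma conn_in_Union: "conn U u v \<Longrightarrow> u \<noteq> v \<Longrightarrow> v \<in> \<Union>U"
  by (erule rtranclE) (auto simp: adj_def)

text \<open>The only way in or out of \<open>w\<close> is through \<open>i\<close>, so the invariant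
  along a walk reads a visit to \<open>w\<close> as a stay at \<open>i\<close>.\<close>

lemma conn_insert_leaf_aux:
  assumes "conn (insert {i, w} A) u x" "w \<notin> \<Union>A" "i \<noteq> w" "u \<noteq> w"
  shows "if x = w then conn A u i else conn A u x"
  using assms(1)
proof (induction rule: rtrancl_induct)
  case base
  then show ?case using assms by simp
next
  case (step y z)
  have "{y, z} = {i, w} \<or> {y, z} \<in> A"
    using step.hyps(2) by (auto simp: adj_def)
  then show ?case
  proof
    assume "{y, z} = {i, w}"
    then have "y = i \<and> z = w \<or> y = w \<and> z = i" by (simp add: doubleton_eq_iff)
    then show ?thesis using step.IH assms(3) by auto
  next
    assume yz: "{y, z} \<in> A"
    then have "y \<noteq> w" "z \<noteq> w" using assms(2) by auto
    then show ?thesis using step.IH conn_step[OF _ yz] by simp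
  qed
qed

lemma conn_insert_leaf:
  assumes "w \<notin> \<Union>A" "i \<noteq> w" "u \<noteq> w"
  shows "v \<noteq> w \<Longrightarrow> conn (insert {i, w} A) u v \<longleftrightarrow> conn A u v"
    and "conn (insert {i, w} A) u w \<longleftrightarrow> conn A u i"
proof -
  have mono: "conn A u v \<Longrightarrow> conn (insert {i, w} A) u v" for v
    by (rule conn_mono) auto
  show "v \<noteq> w \<Longrightarrow> conn (insert {i, w} A) u v \<longleftrightarrow> conn A u v"
    using conn_insert_leaf_aux[OF _ assms] mono by fastforce
  show "conn (insert {i, w} A) u w \<longleftrightarrow> conn A u i"
    using conn_insert_leaf_aux[OF _ assms, of w] mono[of i] conn_step[of u i "insert {i, w} A" w]
    by auto
qed

lemma conn_isolated: "w \<notin> \<Union>A \<Longrightarrow> conn A u w \<longleftrightarrow> u = w"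
  using conn_in_Union by fastforce

section \<open>Simple paths, cycles and branches\<close>

lemma graph_path_snoc:
  "graph_path E xs \<Longrightarrow> y \<notin> set xs \<Longrightarrow> {last xs, y} \<in> E \<Longrightarrow> graph_path E (xs @ [y])"
  by (auto simp: graph_path_def successively_append_iff)

lemma graph_path_prefix: "graph_path E (ys @ zs) \<Longrightarrow> ys \<noteq> [] \<Longrightarrow> graph_path E ys"
  by (auto simp: graph_path_def successively_append_iff)

lemma graph_path_suffix: "graph_path E (ys @ zs) \<Longrightarrow> zs \<noteq> [] \<Longrightarrow> graph_path E zs"
  by (auto simp: graph_path_def successively_append_iff)

lemma conn_graph_path:
  "conn E u v \<Longrightarrow> \<exists>xs. graph_path E xs \<and> hd xs = u \<and> last xs = v"
proof (induction rule: rtrancl_induct)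
  case base
  show ?case by (rule exI[of _ "[u]"]) (simp add: graph_path_def)
next
  case (step y z)
  then obtain xs where xs: "graph_path E xs" "hd xs = u" "last xs = y" by blast
  have ne: "xs \<noteq> []" using xs by (simp add: graph_path_def)
  have yz: "{y, z} \<in> E" using step.hyps(2) by (simp add: adj_def)
  show ?case
  \<comment> \<open>A walk that returns to a vertex of the path is cut back to the prefix ending
    there, which keeps the path simple.\<close>
  proof (cases "z \<in> set xs")
    case True
    then obtain ys zs where s: "xs = (ys @ [z]) @ zs" by (metis append_Cons append_Nil append_assoc split_list)
    then have "graph_path E (ys @ [z])" using xs graph_path_prefix by (metis snoc_eq_iff_butlast)
    moreover have "hd (ys @ [z]) = u" using xs s by (cases ys) auto
    ultimately show ?thesis by (metis last_snoc)
  next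
    case False
    then have "graph_path E (xs @ [z])" using xs yz graph_path_snoc by metis
    then show ?thesis using xs ne by (intro exI[of _ "xs @ [z]"]) auto
  qed
qed

lemma graph_path_conn: "graph_path E xs \<Longrightarrow> x \<in> set xs \<Longrightarrow> conn E (hd xs) x"
proof (induction xs arbitrary: x rule: rev_induct)
  case (snoc y xs)
  show ?case
  proof (cases "xs = []")
    case False
    then have "graph_path E xs" "{last xs, y} \<in> E"
      using snoc.prems(1) graph_path_prefix[of E xs "[y]"]
      by (auto simp: graph_path_def successively_append_iff)
    then have "conn E (hd xs) x" if "x \<in> set xs" for x
      using snoc.IH that by blast
    moreover have "conn E (hd xs) y"
      using calculation[of "last xs"] conn_step \<open>{last xs, y} \<in> E\<close> False by (metis last_in_set)
    ultimately show ?thesis using snoc.prems(2) False by auto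
  qed (use snoc.prems in auto)
qed (simp add: graph_path_def)

text \<open>Serves as a contrapositive: a vertex with a single neighbour lies on no cycle. The first
  and the last vertex of the list get one of their neighbours from the closing edge.\<close>

lemma graph_cycle_two_neighbours:
  assumes "graph_cycle E xs" "x \<in> set xs"
  shows "\<exists>a b. a \<noteq> b \<and> {a, x} \<in> E \<and> {x, b} \<in> E"
proof -
  obtain ys zs where s: "xs = ys @ x # zs" using assms(2) split_list by metis
  have d: "distinct xs" and l: "3 \<le> length xs" and c: "{last xs, hd xs} \<in> E"
    and p: "successively (\<lambda>u v. {u, v} \<in> E) xs"
    using assms(1) by (auto simp: graph_cycle_def graph_path_def)
  consider "ys = []" | "zs = []" "ys \<noteq> []" | "ys \<noteq> []" "zs \<noteq> []" by blast
  then show ?thesis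
  proof cases
    case 1
    then obtain z z' zs' where z: "zs = z # z' # zs'" using l s by (cases zs; cases "tl zs") auto
    have "last zs \<noteq> z" using d s z by auto
    moreover have "{last zs, x} \<in> E" using c s 1 z by simp
    moreover have "{x, z} \<in> E" using p s 1 z by simp
    ultimately show ?thesis by blast
  next
    case 2
    then obtain z z' zs' where z: "ys = z # z' # zs'" using l s by (cases ys; cases "tl ys") auto
    have "last ys \<noteq> z" using d s z by auto
    moreover have "{last ys, x} \<in> E" using p s 2 by (simp add: successively_append_iff)
    moreover have "{x, z} \<in> E" using c s 2 z by simp
    ultimately show ?thesis by blast
  next
    case 3
    have "last ys \<in> set ys" "hd zs \<in> set zs" using 3 by auto
    then have "last ys \<noteq> hd zs" using d s by auto
    moreover have "{last ys, x} \<in> E" "{x, hd zs} \<in> E"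
      using p s 3 by (auto simp: successively_append_iff successively_Cons)
    ultimately show ?thesis by blast
  qed
qed

text \<open>The paths close up through \<open>w\<close>. This is what forces the largest label of a
  recursive tree to have a single neighbour.\<close>

lemma two_paths_graph_cycle:
  assumes P: "graph_path E P" "hd P = r" "last P = a" and Q: "graph_path E Q" "hd Q = r" "last Q = b"
    and ab: "a \<noteq> b" and w: "w \<notin> set P" "w \<notin> set Q" "{a, w} \<in> E" "{b, w} \<in> E"
  shows "\<exists>xs. graph_cycle E xs"
proof -
  have "P \<noteq> []" "Q \<noteq> []" using P Q by (auto simp: graph_path_def)
  then have "\<exists>x\<in>set P. x \<in> set Q" using P(2) Q(2) by (metis hd_in_set)
  \<comment> \<open>Branching off at the last vertex \<open>c\<close> of \<open>P\<close> that lies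
    on \<open>Q\<close> makes the two tails disjoint; the cycle runs from \<open>c\<close> along
    \<open>P\<close> to \<open>a\<close>, through \<open>w\<close> to \<open>b\<close> and back
    along \<open>Q\<close>.\<close>
  from split_list_last_prop[OF this] obtain P1 c P2 where
    Ps: "P = P1 @ c # P2" and c: "c \<in> set Q" and P2: "\<forall>x\<in>set P2. x \<notin> set Q" by blast
  obtain Q1 Q2 where Qs: "Q = Q1 @ c # Q2" using c split_list by metis
  have sym: "{u, v} \<in> E \<longleftrightarrow> {v, u} \<in> E" for u v by (simp add: insert_commute)
  have gP: "graph_path E (c # P2)" using graph_path_suffix[of E P1 "c # P2"] P Ps by simp
  have gQ: "graph_path E (c # Q2)" using graph_path_suffix[of E Q1 "c # Q2"] Q Qs by simp
  have la: "last (c # P2) = a" "last (c # Q2) = b" using P Q Ps Qs by auto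
  let ?C = "c # P2 @ w # rev Q2"
  have d: "distinct ?C" using gP gQ P2 w Ps Qs by (auto simp: graph_path_def)
  have s1: "successively (\<lambda>u v. {u, v} \<in> E) (c # P2 @ [w])"
    using graph_path_snoc[OF gP, of w] w la d by (auto simp: graph_path_def)
  have revs: "successively (\<lambda>u v. {u, v} \<in> E) (rev (c # Q2))"
    using gQ unfolding successively_rev by (auto simp: graph_path_def sym)
  have "successively (\<lambda>u v. {u, v} \<in> E) ((c # P2 @ [w]) @ rev Q2)"
  proof (cases "Q2 = []")
    case False
    have "hd (rev Q2) = b" using la False by (simp add: hd_rev)
    moreover have "successively (\<lambda>u v. {u, v} \<in> E) (rev Q2)"
      using revs by (auto simp: successively_append_iff)
    moreover have "{w, b} \<in> E" using w sym by blast
    ultimately show ?thesis using s1 by (subst successively_append_iff) simp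
  qed (use s1 in simp)
  moreover have "{last ?C, hd ?C} \<in> E"
  proof (cases Q2)
    case Nil
    then show ?thesis using la w by (simp add: sym)
  next
    case (Cons q Q3)
    then show ?thesis using gQ by (simp add: graph_path_def sym)
  qed
  moreover have "length ?C \<ge> 3"
  proof (rule ccontr)
    assume "\<not> ?thesis"
    then have "P2 = []" "Q2 = []" by (cases P2; cases Q2; simp)+
    then show False using la ab by simp
  qed
  ultimately have "graph_cycle E ?C" using d by (simp add: graph_cycle_def graph_path_def)
  then show ?thesis by blast
qed

text \<open>A last vertex that is no leaf has an edge other than the one by which it was reached,
  and acyclicity makes the other end of that edge new; the vertex set is finite, so this stops.
  Starting with two vertices gives the last one a predecessor and keeps it apart from
  \<open>r\<close>, which is never a leaf by definition.\<close>

lemma extend_to_branch: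
  assumes fin: "finite V" and E: "E \<subseteq> {e. e \<subseteq> V \<and> card e = 2}" and acyc: "\<nexists>xs. graph_cycle E xs"
  shows "graph_path E xs \<Longrightarrow> hd xs = r \<Longrightarrow> 2 \<le> length xs \<Longrightarrow> \<exists>ys. branch E r (xs @ ys)"
proof (induction "card V - length xs" arbitrary: xs rule: less_induct)
  case less
  define x where "x = last xs"
  have "xs \<noteq> []" using less.prems by auto
  then obtain zs where zs: "xs = zs @ [x]" using x_def by (metis append_butlast_last_id)
  with less.prems have zne: "zs \<noteq> []" by auto
  define y where "y = last zs"
  obtain zs' where zs': "zs = zs' @ [y]" using zne y_def by (metis append_butlast_last_id)
  have d: "distinct xs" and yx: "{y, x} \<in> E"
    using less.prems zs zs' by (auto simp: graph_path_def successively_append_iff)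
  have xr: "x \<noteq> r" using d zs less.prems(2) zne by (cases zs) auto
  have finE: "finite E" using E by (rule finite_subset) (use fin in auto)
  show ?case
  proof (cases "card {e \<in> E. x \<in> e} = 1")
    case True
    then have "leaf E r (last xs)" using xr by (simp add: leaf_def x_def)
    then have "branch E r (xs @ [])" using less.prems by (simp add: branch_def)
    then show ?thesis by blast
  next
    case False
    have "{e \<in> E. x \<in> e} \<noteq> {{y, x}}" using False by auto
    then obtain e where e: "e \<in> E" "x \<in> e" "e \<noteq> {y, x}" using yx by blast
    have "card e = 2" using e E by auto
    then obtain z where z: "e = {x, z}" "z \<noteq> x" using e(2) by (auto simp: card_2_iff)
    then have zy: "z \<noteq> y" using e by auto
    have zs_notin: "z \<notin> set xs"
    proof
      assume "z \<in> set xs"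
      then have "z \<in> set zs'" using zs zs' z zy by auto
      then obtain as bs where s: "zs' = as @ z # bs" using split_list by metis
      have "graph_path E (z # bs @ [y, x])"
        using graph_path_suffix[of E as "z # bs @ [y, x]"] less.prems zs zs' s by simp
      then have "graph_cycle E (z # bs @ [y, x])" using e z by (simp add: graph_cycle_def)
      then show False using acyc by blast
    qed
    then have gp: "graph_path E (xs @ [z])"
      using graph_path_snoc[OF less.prems(1)] e z x_def by simp
    have in_V: "\<Union>E \<subseteq> V" using E by auto
    have "set xs \<subseteq> \<Union>E"
    proof
      fix u assume "u \<in> set xs"
      then consider "u = x" | "u \<in> set zs" using zs by auto
      then show "u \<in> \<Union>E"
      proof cases
        case 1 then show ?thesis using yx by auto
      next
        case 2
        then obtain as bs where s: "zs = as @ u # bs" using split_list by metis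
        then have "graph_path E (u # bs @ [x])"
          using graph_path_suffix[of E as "u # bs @ [x]"] less.prems zs by simp
        then have "{u, hd (bs @ [x])} \<in> E" by (auto simp: graph_path_def successively_Cons)
        then show ?thesis by auto
      qed
    qed
    then have "insert z (set xs) \<subseteq> V" using in_V e z by auto
    then have "card (insert z (set xs)) \<le> card V" by (rule card_mono[OF fin])
    then have "Suc (length xs) \<le> card V" using zs_notin d distinct_card by fastforce
    then have lt: "card V - length (xs @ [z]) < card V - length xs" by simp
    have "\<exists>ys. branch E r ((xs @ [z]) @ ys)"
      by (rule less.hyps[OF lt gp]) (use less.prems \<open>xs \<noteq> []\<close> in simp_all)
    then show ?thesis by (metis append_assoc)
  qed
qed

text \<open>Every path of at least two vertices from the root is an initial segment of a branch, so
  monotonicity passes from branches to all paths. In this form the condition is stable under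
  removing a leaf, which would change the set of branches.\<close>

lemma recursive_trees_altdef:
  "recursive_trees n =
     {E. is_tree {1..n} E \<and> (\<forall>xs. graph_path E xs \<and> hd xs = 1 \<longrightarrow> sorted_wrt (<) xs)}"
proof -
  have "sorted_wrt (<) xs"
    if t: "is_tree {1..n} E" and b: "\<forall>xs. branch E 1 xs \<longrightarrow> sorted_wrt (<) xs"
      and xs: "graph_path E xs" "hd xs = 1" for E and xs :: "nat list"
  proof (cases "2 \<le> length xs")
    case True
    then obtain ys where "branch E 1 (xs @ ys)"
      using extend_to_branch[of "{1..n}" E xs 1] t xs by (auto simp: is_tree_def)
    then show ?thesis using b by (auto simp: sorted_wrt_append)
  next
    case False
    then show ?thesis by (cases xs; cases "tl xs") auto
  qed
  then show ?thesis unfolding recursive_trees_def by (auto simp: branch_def)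
qed

section \<open>Attaching and removing the largest label\<close>

lemma successively_mono_set:
  "successively P xs \<Longrightarrow> (\<And>x y. x \<in> set xs \<Longrightarrow> y \<in> set xs \<Longrightarrow> P x y \<Longrightarrow> Q x y) \<Longrightarrow> successively Q xs"
  by (induction xs rule: induct_list012) auto

text \<open>The new vertex has the single neighbour \<open>i\<close>: it lies on no cycle and can
  only come last on a path from the root, where the largest label keeps the path increasing.\<close>

lemma recursive_trees_insert:
  assumes E: "E \<in> recursive_trees n" and i: "i \<in> {1..n}"
  shows "insert {i, Suc n} E \<in> recursive_trees (Suc n)"
proof -
  define w where "w = Suc n"
  let ?E = "insert {i, w} E"
  have n: "n \<ge> 1" using i by simp
  have t: "is_tree {1..n} E" and s: "\<And>xs. graph_path E xs \<Longrightarrow> hd xs = 1 \<Longrightarrow> sorted_wrt (<) xs"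
    using E by (auto simp: recursive_trees_altdef)
  have edges: "E \<subseteq> {e. e \<subseteq> {1..n} \<and> card e = 2}" using t by (simp add: is_tree_def)
  have wE: "w \<notin> \<Union>E" using edges by (fastforce simp: w_def)
  have iw: "i \<noteq> w" using i by (auto simp: w_def)
  have conE: "conn E u v" if "u \<in> {1..n}" "v \<in> {1..n}" for u v using t that by (auto simp: is_tree_def)
  have con: "conn ?E u v" if "u \<in> {1..w}" "v \<in> {1..w}" for u v
  proof -
    have a: "conn ?E i u" if "u \<in> {1..w}" for u
    proof (cases "u = w")
      case False
      then show ?thesis using that i conn_mono[OF conE[of i u], of ?E] by (auto simp: w_def)
    qed (auto intro: conn_edge)
    show ?thesis using conn_trans[OF conn_sym[OF a[OF that(1)]] a[OF that(2)]] .
  qed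
  have nb: "a = i" if "{a, w} \<in> ?E" for a
    using that wE iw by (auto simp: doubleton_eq_iff)
  have succ: "successively (\<lambda>u v. {u, v} \<in> E) xs"
    if "successively (\<lambda>u v. {u, v} \<in> ?E) xs" "w \<notin> set xs" for xs
    by (rule successively_mono_set[OF that(1)]) (use that(2) in \<open>auto simp: doubleton_eq_iff\<close>)
  have "\<not> graph_cycle ?E xs" for xs
  proof
    assume c: "graph_cycle ?E xs"
    show False
    proof (cases "w \<in> set xs")
      case True
      from graph_cycle_two_neighbours[OF c this] show False using nb by (metis insert_commute)
    next
      case False
      then have "last xs \<noteq> w" "hd xs \<noteq> w" using c by (auto simp: graph_cycle_def graph_path_def)
      then have "graph_cycle E xs" using c succ False
        by (auto simp: graph_cycle_def graph_path_def doubleton_eq_iff)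
      then show False using t by (auto simp: is_tree_def)
    qed
  qed
  moreover have "sorted_wrt (<) xs" if xs: "graph_path ?E xs" "hd xs = 1" for xs
  proof (cases "w \<in> set xs")
    case False
    then have "graph_path E xs" using xs succ by (auto simp: graph_path_def)
    then show ?thesis using s xs by blast
  next
    case True
    then obtain ys zs where sp: "xs = ys @ w # zs" using split_list by metis
    have ys: "ys \<noteq> []" using xs sp n by (auto simp: w_def)
    have d: "distinct xs" using xs by (simp add: graph_path_def)
    have "{last ys, w} \<in> ?E" using xs sp ys unfolding graph_path_def by (simp add: successively_append_iff)
    then have l: "last ys = i" using nb by blast
    have "zs = []"
    proof (rule ccontr)
      assume z: "zs \<noteq> []"
      then have "{w, hd zs} \<in> ?E" using xs sp ys
        unfolding graph_path_def by (simp add: successively_append_iff successively_Cons)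
      then have "hd zs = i" using nb by (metis insert_commute)
      then show False using l d sp ys z by (auto dest: last_in_set hd_in_set)
    qed
    then have xs': "xs = ys @ [w]" using sp by simp
    have "graph_path E ys" using graph_path_prefix[of ?E ys "[w]"] xs xs' ys succ[of ys] d
      by (auto simp: graph_path_def)
    moreover have "hd ys = 1" using xs xs' ys by simp
    ultimately have "sorted_wrt (<) ys" using s by blast
    moreover have "u < w" if "u \<in> set ys" for u
    proof -
      have "conn E 1 u" using graph_path_conn[OF \<open>graph_path E ys\<close> that] \<open>hd ys = 1\<close> by simp
      then have "u = 1 \<or> u \<in> \<Union>E" using conn_in_Union by metis
      then show ?thesis using edges n by (force simp: w_def)
    qed
    ultimately show ?thesis using xs' by (simp add: sorted_wrt_append)
  qed
  moreover have "?E \<subseteq> {e. e \<subseteq> {1..w} \<and> card e = 2}" using edges i iw by (fastforce simp: w_def)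
  ultimately show ?thesis using con unfolding recursive_trees_altdef is_tree_def w_def by blast
qed

text \<open>The largest label is a leaf: an increasing path from the root cannot continue after
  \<open>w\<close>, so the paths from the root to the neighbours of \<open>w\<close> avoid
  \<open>w\<close>, and two distinct neighbours would produce a cycle.\<close>

lemma recursive_trees_delete:
  assumes E: "E \<in> recursive_trees (Suc n)" and n: "n \<ge> 1"
  shows "\<exists>i\<in>{1..n}. \<exists>E'\<in>recursive_trees n. E = insert {i, Suc n} E'"
proof -
  define w where "w = Suc n"
  have t: "is_tree {1..w} E" and s: "\<And>xs. graph_path E xs \<Longrightarrow> hd xs = 1 \<Longrightarrow> sorted_wrt (<) xs"
    using E by (auto simp: recursive_trees_altdef w_def)
  have edges: "E \<subseteq> {e. e \<subseteq> {1..w} \<and> card e = 2}" using t by (simp add: is_tree_def)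
  have con: "conn E u v" if "u \<in> {1..w}" "v \<in> {1..w}" for u v using t that by (auto simp: is_tree_def)
  have inV: "a \<in> {1..n} \<and> a \<noteq> w" if "{a, w} \<in> E" for a
  proof -
    have "card {a, w} = 2" "{a, w} \<subseteq> {1..w}" using that edges by auto
    then have "a \<noteq> w" "a \<in> {1..w}" by auto
    then show ?thesis by (auto simp: w_def)
  qed
  have path: "\<exists>P. graph_path E P \<and> hd P = 1 \<and> last P = a \<and> w \<notin> set P" if a: "{a, w} \<in> E" for a
  proof -
    have "conn E 1 a" using con[of 1 a] inV[OF a] n by (auto simp: w_def)
    then obtain P where P: "graph_path E P" "hd P = 1" "last P = a" using conn_graph_path by metis
    have "w \<notin> set P"
    proof
      assume "w \<in> set P"
      then obtain ys zs where sp: "P = ys @ w # zs" using split_list by metis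
      have "zs \<noteq> []" using P sp inV[OF a] by auto
      then have "w < hd zs" using s[OF P(1,2)] sp by (simp add: sorted_wrt_append)
      moreover have "{w, hd zs} \<in> E" using P(1) sp \<open>zs \<noteq> []\<close>
        by (auto simp: graph_path_def successively_append_iff successively_Cons)
      then have "hd zs \<le> w" using edges by auto
      ultimately show False by simp
    qed
    then show ?thesis using P by blast
  qed
  have "conn E w 1" using con n by (auto simp: w_def)
  then obtain i where i: "{i, w} \<in> E"
    using n by (cases rule: converse_rtranclE) (auto simp: w_def adj_def insert_commute)
  have uniq: "a = i" if a: "{a, w} \<in> E" for a
  proof (rule ccontr)
    assume ne: "a \<noteq> i"
    obtain P where P: "graph_path E P" "hd P = 1" "last P = a" "w \<notin> set P" using path[OF a] by blast
    obtain Q where Q: "graph_path E Q" "hd Q = 1" "last Q = i" "w \<notin> set Q" using path[OF i] by blast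
    have "\<exists>xs. graph_cycle E xs"
      by (rule two_paths_graph_cycle[OF P(1,2,3) Q(1,2,3) ne P(4) Q(4) a i])
    then show False using t by (auto simp: is_tree_def)
  qed
  define E' where "E' = E - {{i, w}}"
  have EE: "E = insert {i, w} E'" using i by (auto simp: E'_def)
  have wE': "w \<notin> \<Union>E'"
  proof
    assume "w \<in> \<Union>E'"
    then obtain e where e: "e \<in> E'" "w \<in> e" by blast
    then have "card e = 2" using edges by (auto simp: E'_def)
    then obtain a where "e = {a, w}" using e by (auto simp: card_2_iff)
    then show False using uniq[of a] e by (auto simp: E'_def)
  qed
  have iw: "i \<noteq> w" "i \<in> {1..n}" using inV[OF i] by auto
  have "E' \<subseteq> {e. e \<subseteq> {1..n} \<and> card e = 2}"
  proof
    fix e assume e: "e \<in> E'"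
    then have "e \<subseteq> {1..w} \<and> card e = 2" "w \<notin> e" using edges wE' by (auto simp: E'_def)
    moreover have "{1..w} - {w} \<subseteq> {1..n}" by (auto simp: w_def)
    ultimately show "e \<in> {e. e \<subseteq> {1..n} \<and> card e = 2}" by blast
  qed
  moreover have "conn E' u v" if "u \<in> {1..n}" "v \<in> {1..n}" for u v
    using conn_insert_leaf(1)[OF wE' iw(1), of u v] con[of u v] that EE by (auto simp: w_def)
  moreover have "\<not> graph_cycle E' xs" for xs
  proof
    assume "graph_cycle E' xs"
    then have "graph_cycle E xs" by (auto simp: graph_cycle_def graph_path_def E'_def intro: successively_mono)
    then show False using t by (auto simp: is_tree_def)
  qed
  moreover have "sorted_wrt (<) xs" if "graph_path E' xs" "hd xs = 1" for xs
    by (rule s) (use that in \<open>auto simp: graph_path_def E'_def intro: successively_mono\<close>)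
  ultimately have "E' \<in> recursive_trees n" unfolding recursive_trees_altdef is_tree_def by blast
  then show ?thesis using EE iw by (auto simp: w_def)
qed

lemma recursive_trees_edges:
  "E \<in> recursive_trees n \<Longrightarrow> e \<in> E \<Longrightarrow> e \<subseteq> {1..n} \<and> card e = 2"
  by (auto simp: recursive_trees_def is_tree_def)

lemma recursive_trees_notin:
  assumes "E \<in> recursive_trees n" shows "Suc n \<notin> \<Union>E"
  using recursive_trees_edges[OF assms] by fastforce

lemma recursive_trees_one: "recursive_trees 1 = {{}}"
proof -
  have "E = {}" if "E \<in> recursive_trees 1" for E
  proof (rule ccontr)
    assume "E \<noteq> {}"
    then obtain e where "e \<in> E" by blast
    then have "e \<subseteq> {1..1}" "card e = 2" using recursive_trees_edges[OF that] by auto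
    then have "card e \<le> card {1..1::nat}" by (intro card_mono) auto
    then show False using \<open>card e = 2\<close> by simp
  qed
  then show ?thesis using recursive_trees_nonempty[of 1] by auto
qed

text \<open>A uniform recursive tree on \<open>n + 1\<close> vertices is thus a uniform one on
  \<open>n\<close> vertices with the new vertex attached to an independent uniform vertex. All
  recursions for averages over trees come from this.\<close>

lemma bij_betw_recursive_trees_Suc:
  assumes "n \<ge> 1"
  shows "bij_betw (\<lambda>(E, i). insert {i, Suc n} E) (recursive_trees n \<times> {1..n}) (recursive_trees (Suc n))"
  unfolding bij_betw_def
proof
  show "inj_on (\<lambda>(E, i). insert {i, Suc n} E) (recursive_trees n \<times> {1..n})"
  proof (rule inj_onI)
    fix x y
    assume a: "x \<in> recursive_trees n \<times> {1..n}" "y \<in> recursive_trees n \<times> {1..n}"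
      and eq: "(\<lambda>(E, i). insert {i, Suc n} E) x = (\<lambda>(E, i). insert {i, Suc n} E) y"
    obtain E i E' i' where xy: "x = (E, i)" "y = (E', i')" by (cases x; cases y)
    have n: "Suc n \<notin> e" if "e \<in> E \<or> e \<in> E'" for e
      using recursive_trees_notin[of E n] recursive_trees_notin[of E' n] a that unfolding xy by auto
    have nin: "{j, Suc n} \<notin> E" "{j, Suc n} \<notin> E'" for j using n[of "{j, Suc n}"] by auto
    have eq': "insert {i, Suc n} E = insert {i', Suc n} E'" using eq by (simp add: xy)
    have "{i, Suc n} \<in> insert {i', Suc n} E'" unfolding eq'[symmetric] by (rule insertI1)
    then have *: "{i, Suc n} = {i', Suc n}" using nin by (simp only: insert_iff simp_thms)
    then have "i = i'" by (auto simp: doubleton_eq_iff)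
    moreover have "E = E'" using eq' * nin by (metis insert_ident)
    ultimately show "x = y" by (simp add: xy)
  qed
  show "(\<lambda>(E, i). insert {i, Suc n} E) ` (recursive_trees n \<times> {1..n}) = recursive_trees (Suc n)"
  proof (intro equalityI subsetI)
    fix E assume "E \<in> (\<lambda>(E, i). insert {i, Suc n} E) ` (recursive_trees n \<times> {1..n})"
    then show "E \<in> recursive_trees (Suc n)" using recursive_trees_insert by auto
  next
    fix E assume "E \<in> recursive_trees (Suc n)"
    from recursive_trees_delete[OF this assms] obtain i E' where
      "i \<in> {1..n}" "E' \<in> recursive_trees n" "E = insert {i, Suc n} E'" by blast
    then show "E \<in> (\<lambda>(E, i). insert {i, Suc n} E) ` (recursive_trees n \<times> {1..n})"
      by (intro image_eqI[of _ _ "(E', i)"]) auto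
  qed
qed

lemma recursive_trees_induct [consumes 2, case_names one insert]:
  assumes "E \<in> recursive_trees n" "n \<ge> 1"
    and "P 1 {}"
    and "\<And>n E i. n \<ge> 1 \<Longrightarrow> E \<in> recursive_trees n \<Longrightarrow> i \<in> {1..n} \<Longrightarrow> P n E \<Longrightarrow> P (Suc n) (insert {i, Suc n} E)"
  shows "P n E"
  using assms(2,1)
proof (induction n arbitrary: E rule: dec_induct)
  case base
  then have "E = {}" unfolding recursive_trees_one by (rule singletonD)
  then show ?case using assms(3) by simp
next
  case (step n)
  from recursive_trees_delete[OF step.prems step.hyps(1)] obtain i E' where
    i: "i \<in> {1..n}" and E': "E' \<in> recursive_trees n" and E: "E = insert {i, Suc n} E'" by blast
  show ?case unfolding E by (rule assms(4)[OF step.hyps(1) E' i step.IH[OF E']])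
qed

section \<open>Bridges and the recursion over trees\<close>

text \<open>In a tree these are the edges of the path from \<open>u\<close> to \<open>v\<close>, so
  their number is the distance. Describing them by removal avoids choosing a path and is symmetric
  in \<open>u\<close> and \<open>v\<close>; for vertices that are not connected it gives all of
  \<open>E\<close>.\<close>

definition bridges :: "'v set set \<Rightarrow> 'v \<Rightarrow> 'v \<Rightarrow> 'v set set" where
  "bridges E u v = {e \<in> E. \<not> conn (E - {e}) u v}"

definition component :: "'v set set \<Rightarrow> 'v \<Rightarrow> 'v set" where
  "component U v = {w. conn U v w}"

text \<open>For an edge \<open>e\<close> of \<open>U\<close> this is the component containing
  \<open>e\<close>. Asking for each \<open>v\<close> whether its component meets \<open>e\<close>
  lets a sum over edges be exchanged with a sum over vertices.\<close>

definition edge_component :: "'v set set \<Rightarrow> 'v set \<Rightarrow> 'v set" where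
  "edge_component U e = {v. e \<inter> component U v \<noteq> {}}"

lemma bridges_self [simp]: "bridges E u u = {}"
  by (simp add: bridges_def)

lemma bridges_sym: "bridges E u v = bridges E v u"
  using conn_sym unfolding bridges_def by metis

lemma bridges_subset: "bridges E u v \<subseteq> E"
  by (auto simp: bridges_def)

text \<open>A new leaf is one edge farther away than its neighbour and lies on no path between old
  vertices. The hypothesis \<open>conn E u v\<close> is what keeps the new edge out of their
  bridges.\<close>

lemma bridges_insert_leaf:
  assumes w: "w \<notin> \<Union>E" "i \<noteq> w" and u: "u \<noteq> w"
  shows "v \<noteq> w \<Longrightarrow> conn E u v \<Longrightarrow> bridges (insert {i, w} E) u v = bridges E u v"
    and "bridges (insert {i, w} E) u w = insert {i, w} (bridges E u i)"
proof -
  let ?e = "{i, w}"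
  have e: "?e \<notin> E" using w by auto
  have 1: "insert ?e E - {?e} = E" using e by simp
  have 2: "insert ?e E - {f} = insert ?e (E - {f})" if "f \<in> E" for f using that e by auto
  have w': "w \<notin> \<Union>(E - {f})" for f using w by auto
  show "bridges (insert {i, w} E) u v = bridges E u v" if "v \<noteq> w" "conn E u v"
  proof (intro set_eqI)
    fix f
    show "f \<in> bridges (insert {i, w} E) u v \<longleftrightarrow> f \<in> bridges E u v"
    proof (cases "f \<in> E")
      case True
      then show ?thesis using conn_insert_leaf(1)[OF w'[of f] w(2) u that(1)]
        unfolding bridges_def mem_Collect_eq 2[OF True] by blast
    next
      case False
      have "f = ?e \<Longrightarrow> conn (insert ?e E - {f}) u v" using that 1 by simp
      then show ?thesis using False unfolding bridges_def by blast
    qed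
  qed
  show "bridges (insert {i, w} E) u w = insert {i, w} (bridges E u i)"
  proof (intro set_eqI)
    fix f
    have "\<not> conn E u w" using conn_isolated[OF w(1), of u] u by simp
    then show "f \<in> bridges (insert {i, w} E) u w \<longleftrightarrow> f \<in> insert ?e (bridges E u i)"
    proof (cases "f \<in> E")
      case True
      then have "f \<noteq> ?e" using e by blast
      then show ?thesis using True conn_insert_leaf(2)[OF w'[of f] w(2) u]
        unfolding bridges_def mem_Collect_eq insert_iff 2[OF True] by blast
    next
      case False
      have "f = ?e \<Longrightarrow> \<not> conn (insert ?e E - {f}) u w" using \<open>\<not> conn E u w\<close> 1 by simp
      then show ?thesis using False unfolding bridges_def by blast
    qed
  qed
qed

lemma recursive_trees_conn:
  "E \<in> recursive_trees n \<Longrightarrow> u \<in> {1..n} \<Longrightarrow> v \<in> {1..n} \<Longrightarrow> conn E u v"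
  unfolding recursive_trees_def is_tree_def by blast

lemma recursive_trees_finite:
  assumes "E \<in> recursive_trees n" shows "finite E"
proof (rule finite_subset)
  show "E \<subseteq> Pow {1..n}" using recursive_trees_edges[OF assms] by blast
qed simp

lemma card_recursive_tree:
  assumes "E \<in> recursive_trees n" "n \<ge> 1" shows "card E = n - 1"
  using assms
proof (induction rule: recursive_trees_induct)
  case (insert n E i)
  have "{i, Suc n} \<notin> E" using recursive_trees_notin[OF insert.hyps(2)] by auto
  then show ?case using insert recursive_trees_finite[OF insert.hyps(2)] by simp
qed simp

text \<open>Turns connectivity in a random set of edges into the survival of a fixed set of edges,
  whose probability under the random order can be estimated. The induction removes the leaf with the
  largest label, whose edge lies on a path exactly when the leaf is one of its two distinct
  ends.\<close>

lemma bridges_subset_iff_conn: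
  assumes "E \<in> recursive_trees n" "n \<ge> 1"
  shows "U \<subseteq> E \<Longrightarrow> u \<in> {1..n} \<Longrightarrow> v \<in> {1..n} \<Longrightarrow> conn U u v \<longleftrightarrow> bridges E u v \<subseteq> U"
  using assms
proof (induction arbitrary: U u v rule: recursive_trees_induct)
  case (insert n E i)
  define w where "w = Suc n"
  have wE: "w \<notin> \<Union>E" using recursive_trees_notin[OF insert.hyps(2)] by (simp add: w_def)
  have iw: "i \<noteq> w" using insert.hyps(3) by (auto simp: w_def)
  define U0 where "U0 = U - {{i, w}}"
  have U0: "U0 \<subseteq> E" using insert.prems(1) by (auto simp: U0_def w_def)
  then have wU0: "w \<notin> \<Union>U0" using wE by auto
  have inn: "x \<in> {1..n} \<longleftrightarrow> x \<noteq> w" if "x \<in> {1..Suc n}" for x using that by (auto simp: w_def)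
  have eE: "{i, w} \<notin> E" using wE by auto
  have *: "conn U u w \<longleftrightarrow> bridges (insert {i, w} E) u w \<subseteq> U" if u: "u \<in> {1..n}" for u
  proof -
    have uw: "u \<noteq> w" using u by (auto simp: w_def)
    show ?thesis
    proof (cases "{i, w} \<in> U")
      case True
      then have "U = insert {i, w} U0" by (auto simp: U0_def)
      then have "conn U u w \<longleftrightarrow> conn U0 u i" using conn_insert_leaf(2)[OF wU0 iw uw] by simp
      also have "\<dots> \<longleftrightarrow> bridges E u i \<subseteq> U0" using insert.IH[OF U0 u insert.hyps(3)] .
      also have "\<dots> \<longleftrightarrow> bridges (insert {i, w} E) u w \<subseteq> U"
        using bridges_insert_leaf(2)[OF wE iw uw] True bridges_subset[of E u i] eE
        by (auto simp: U0_def)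
      finally show ?thesis .
    next
      case False
      then have "U = U0" by (auto simp: U0_def)
      then have "\<not> conn U u w" using conn_isolated[OF wU0] uw by simp
      moreover have "\<not> bridges (insert {i, w} E) u w \<subseteq> U"
        using bridges_insert_leaf(2)[OF wE iw uw] False by auto
      ultimately show ?thesis by simp
    qed
  qed
  consider "u \<noteq> w" "v \<noteq> w" | "u = w" "v = w" | "u \<noteq> w" "v = w" | "u = w" "v \<noteq> w" by blast
  then have "conn U u v \<longleftrightarrow> bridges (insert {i, w} E) u v \<subseteq> U"
  proof cases
    case 1
    then have uv: "u \<in> {1..n}" "v \<in> {1..n}" using insert.prems inn by auto
    have "conn U u v \<longleftrightarrow> conn U0 u v"
    proof (cases "{i, w} \<in> U")
      case True
      then have "U = insert {i, w} U0" by (auto simp: U0_def)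
      then show ?thesis using conn_insert_leaf(1)[OF wU0 iw 1] by simp
    next
      case False
      then show ?thesis by (simp add: U0_def)
    qed
    also have "\<dots> \<longleftrightarrow> bridges E u v \<subseteq> U0" using insert.IH[OF U0 uv] .
    also have "\<dots> \<longleftrightarrow> bridges (insert {i, w} E) u v \<subseteq> U"
      using bridges_insert_leaf(1)[OF wE iw 1 recursive_trees_conn[OF insert.hyps(2) uv]]
        bridges_subset[of E u v] eE by (auto simp: U0_def)
    finally show ?thesis .
  next
    case 2
    then show ?thesis by simp
  next
    case 3
    then show ?thesis using *[of u] inn insert.prems by simp
  next
    case 4
    then have "conn U v w \<longleftrightarrow> bridges (insert {i, w} E) v w \<subseteq> U" using *[of v] inn insert.prems by simp
    then show ?thesis using 4 conn_sym[of u v U] conn_sym[of v u U] bridges_sym[of _ u v] by auto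
  qed
  then show ?case by (simp add: w_def)
qed simp

text \<open>Every vertex other than \<open>1\<close> has a unique smaller neighbour, so an edge is
  recorded by its larger end.\<close>

lemma inj_on_Max_recursive_tree:
  assumes "E \<in> recursive_trees n" "n \<ge> 1" shows "inj_on Max E"
  using assms
proof (induction rule: recursive_trees_induct)
  case (insert n E i)
  have "Max e \<noteq> Suc n" if "e \<in> E" for e
  proof -
    have "e \<subseteq> {1..n}" "card e = 2" using recursive_trees_edges[OF insert.hyps(2) that] by auto
    then have "Max e \<in> e" by (intro Max_in) (auto intro: finite_subset)
    then show ?thesis using \<open>e \<subseteq> {1..n}\<close> by auto
  qed
  moreover have "Max {i, Suc n} = Suc n" using insert.hyps(3) by auto
  ultimately have "Max {i, Suc n} \<notin> Max ` (E - {{i, Suc n}})" by (metis DiffD1 imageE)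
  then show ?case unfolding inj_on_insert using insert.IH by blast
qed simp

text \<open>Together with \<open>inj_on_Max_recursive_tree\<close> this gives every vertex other
  than \<open>1\<close> of the root component its own edge inside that component.\<close>

lemma parent_edge:
  assumes "E \<in> recursive_trees n" "n \<ge> 1"
  shows "w \<in> {2..n} \<Longrightarrow> \<exists>e\<in>bridges E 1 w. Max e = w"
  using assms
proof (induction arbitrary: w rule: recursive_trees_induct)
  case (insert n E i)
  have wE: "Suc n \<notin> \<Union>E" using recursive_trees_notin[OF insert.hyps(2)] .
  have iw: "i \<noteq> Suc n" "1 \<noteq> Suc n" "i \<le> Suc n" using insert.hyps by auto
  show ?case
  proof (cases "w = Suc n")
    case True
    have "Max {i, Suc n} = Suc n" using iw by (simp add: max_def)
    then show ?thesis using bridges_insert_leaf(2)[OF wE iw(1,2)] True by auto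
  next
    case False
    then have w: "w \<in> {2..n}" "w \<in> {1..n}" "1 \<in> {1..n}" using insert.prems by auto
    have "bridges (insert {i, Suc n} E) 1 w = bridges E 1 w"
      by (rule bridges_insert_leaf(1)[OF wE iw(1,2) False recursive_trees_conn[OF insert.hyps(2) w(3,2)]])
    then show ?thesis using insert.IH[OF w(1)] by simp
  qed
qed simp

section \<open>Components of subgraphs and their edge counts\<close>

lemma self_in_component [simp]: "v \<in> component U v"
  by (simp add: component_def)

lemma component_mono: "U \<subseteq> U' \<Longrightarrow> component U v \<subseteq> component U' v"
  using conn_mono by (auto simp: component_def)

lemma component_eq: "w \<in> component U v \<Longrightarrow> component U w = component U v"
  unfolding component_def using conn_trans conn_sym by fast

lemma component_sym: "w \<in> component U v \<longleftrightarrow> v \<in> component U w"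
  unfolding component_def using conn_sym by fast

lemma component_step: "v \<in> component U u \<Longrightarrow> {v, w} \<in> U \<Longrightarrow> w \<in> component U u"
  using conn_step[of u v U w] by (simp add: component_def)

locale recursive_tree =
  fixes n :: nat and E :: "nat set set"
  assumes E: "E \<in> recursive_trees n" and n: "n \<ge> 1"
begin

lemma edge: "e \<in> E \<Longrightarrow> e \<subseteq> {1..n}" "e \<in> E \<Longrightarrow> card e = 2"
  using recursive_trees_edges[OF E] by auto

lemma fin_E: "finite E"
  using recursive_trees_finite[OF E] .

lemma component_subset: "U \<subseteq> E \<Longrightarrow> v \<in> {1..n} \<Longrightarrow> component U v \<subseteq> {1..n}"
proof
  fix w assume "U \<subseteq> E" "v \<in> {1..n}" "w \<in> component U v"
  then have "w = v \<or> w \<in> \<Union>U" using conn_in_Union[of v w U] by (auto simp: component_def)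
  then show "w \<in> {1..n}" using \<open>v \<in> {1..n}\<close> \<open>U \<subseteq> E\<close> edge by blast
qed

lemma finite_component: "U \<subseteq> E \<Longrightarrow> v \<in> {1..n} \<Longrightarrow> finite (component U v)"
  by (rule finite_subset[OF component_subset]) auto

lemma edge_in_component:
  assumes "U \<subseteq> E" "e \<in> U" "e \<inter> component U v \<noteq> {}"
  shows "e \<subseteq> component U v"
proof -
  obtain a where a: "a \<in> e" "a \<in> component U v" using assms by blast
  obtain x y where xy: "e = {x, y}" using edge(2)[of e] assms(1,2) unfolding card_2_iff by blast
  have "{x, y} \<in> U" "{y, x} \<in> U" using assms(2) xy insert_commute[of x y "{}"] by simp_all
  then have "x \<in> component U v \<longleftrightarrow> y \<in> component U v" using component_step by metis
  then show ?thesis using a xy by auto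
qed

lemma card_edges_in_component:
  assumes U: "U \<subseteq> E" and v: "v \<in> {1..n}"
  shows "card {e \<in> U. e \<inter> component U v \<noteq> {}} \<le> card (component U v) - 1"
proof -
  let ?C = "component U v" and ?X = "{e \<in> U. e \<inter> component U v \<noteq> {}}"
  have fC: "finite ?C" using finite_component[OF U v] .
  \<comment> \<open>The larger end of an edge inside the component cannot be the smallest vertex of
    the component; with injectivity of \<open>Max\<close> this leaves at most as many edges as
    vertices minus one.\<close>
  have "Max ` ?X \<subseteq> ?C - {Min ?C}"
  proof
    fix m assume "m \<in> Max ` ?X"
    then obtain e where e: "e \<in> U" "e \<inter> ?C \<noteq> {}" and m: "m = Max e" by blast
    have eC: "e \<subseteq> ?C" using edge_in_component[OF U e] .
    have c2: "card e = 2" using edge(2) e U by blast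
    have fe: "finite e" using eC fC by (rule finite_subset)
    obtain x y where xy: "e = {x, y}" "x < y"
    proof -
      obtain a b where "e = {a, b}" "a \<noteq> b" using c2 unfolding card_2_iff by blast
      then show ?thesis using that[of a b] that[of b a] by (cases "a < b") (auto simp: insert_commute)
    qed
    have "Max e = y" using xy by simp
    moreover have "Min ?C \<le> x" using eC xy fC by (intro Min_le) auto
    ultimately show "m \<in> ?C - {Min ?C}" using m xy eC by auto
  qed
  then have "card (Max ` ?X) \<le> card (?C - {Min ?C})" by (intro card_mono) (use fC in auto)
  moreover have "card (Max ` ?X) = card ?X"
    by (intro card_image inj_on_subset[OF inj_on_Max_recursive_tree[OF E n]]) (use U in auto)
  moreover have "Min ?C \<in> ?C" using fC by (intro Min_in) (auto simp: component_def)
  ultimately show ?thesis by simp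
qed

text \<open>Equality comes from \<open>parent_edge\<close>: the path from a vertex of the component
  to the root lies in \<open>U\<close>, and so does the edge to its smaller neighbour. The exact
  count makes the survival recursion exact.\<close>

lemma card_edges_in_root_component:
  assumes U: "U \<subseteq> E"
  shows "card {e \<in> U. e \<inter> component U 1 \<noteq> {}} = card (component U 1) - 1"
proof (rule antisym)
  show "card {e \<in> U. e \<inter> component U 1 \<noteq> {}} \<le> card (component U 1) - 1"
    using card_edges_in_component[OF U, of 1] n by auto
  let ?X = "{e \<in> U. e \<inter> component U 1 \<noteq> {}}"
  have fX: "finite ?X" using finite_subset[OF U fin_E] by simp
  have "component U 1 - {1} \<subseteq> Max ` ?X"
  proof
    fix w assume w: "w \<in> component U 1 - {1}"
    have wn: "w \<in> {1..n}" using w component_subset[OF U, of 1] n by auto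
    then have "w \<in> {2..n}" using w by auto
    then obtain e where e: "e \<in> bridges E 1 w" "Max e = w" using parent_edge[OF E n] by blast
    have "bridges E 1 w \<subseteq> U"
      using bridges_subset_iff_conn[OF E n U, of 1 w] w wn n by (auto simp: component_def)
    then have eU: "e \<in> U" using e by blast
    have "card e = 2" using edge(2) eU U by blast
    then have "finite e" "e \<noteq> {}" by (auto intro: card_ge_0_finite)
    then have "w \<in> e" using Max_in[of e] e by simp
    then show "w \<in> Max ` ?X" using e eU w by (intro image_eqI[of _ _ e]) auto
  qed
  then have "card (component U 1 - {1}) \<le> card (Max ` ?X)" by (rule card_mono[rotated]) (use fX in simp)
  also have "\<dots> \<le> card ?X" using card_image_le[OF fX] .
  finally show "card (component U 1) - 1 \<le> card ?X" by simp
qed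

text \<open>After exchanging the sums, each vertex is counted at most once for every edge of its
  component, and a component has fewer edges than vertices. Choosing \<open>S\<close> smaller than
  the whole vertex set is what later removes the root component.\<close>

lemma sum_card_edge_component_le:
  assumes U: "U \<subseteq> E" and X: "X \<subseteq> U" and S: "S \<subseteq> {1..n}" and XS: "\<And>e. e \<in> X \<Longrightarrow> edge_component U e \<subseteq> S"
  shows "(\<Sum>e\<in>X. real (card (edge_component U e))) \<le> (\<Sum>v\<in>S. real (card (component U v)) - 1)"
proof -
  have fU: "finite U" using U fin_E by (rule finite_subset)
  have fX: "finite X" using X fU by (rule finite_subset)
  have fS: "finite S" using S by (rule finite_subset) simp
  have "(\<Sum>e\<in>X. real (card (edge_component U e))) = (\<Sum>e\<in>X. \<Sum>v\<in>S. if e \<inter> component U v \<noteq> {} then 1 else 0)"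
  proof (rule sum.cong)
    fix e assume "e \<in> X"
    then have "edge_component U e = {v \<in> S. e \<inter> component U v \<noteq> {}}" using XS by (auto simp: edge_component_def)
    then show "real (card (edge_component U e)) = (\<Sum>v\<in>S. if e \<inter> component U v \<noteq> {} then 1 else 0)"
      using fS by (simp add: sum.If_cases Int_def)
  qed simp
  also have "\<dots> = (\<Sum>v\<in>S. \<Sum>e\<in>X. if e \<inter> component U v \<noteq> {} then 1 else 0)"
    by (rule sum.swap)
  also have "\<dots> \<le> (\<Sum>v\<in>S. real (card (component U v)) - 1)"
  proof (rule sum_mono)
    fix v assume "v \<in> S"
    then have v: "v \<in> {1..n}" using S by blast
    have "(\<Sum>e\<in>X. if e \<inter> component U v \<noteq> {} then 1 else 0) = real (card {e \<in> X. e \<inter> component U v \<noteq> {}})"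
      using fX by (simp add: sum.If_cases Int_def)
    also have "\<dots> \<le> real (card {e \<in> U. e \<inter> component U v \<noteq> {}})"
      by (intro of_nat_mono card_mono) (use fU X in auto)
    also have "\<dots> \<le> real (card (component U v) - 1)" using card_edges_in_component[OF U v] by simp
    also have "\<dots> = real (card (component U v)) - 1"
    proof -
      have "card (component U v) \<noteq> 0" using finite_component[OF U v] by (auto simp: component_def)
      then show ?thesis by simp
    qed
    finally show "(\<Sum>e\<in>X. if e \<inter> component U v \<noteq> {} then 1 else 0) \<le> real (card (component U v)) - 1" .
  qed
  finally show ?thesis .
qed

lemma edge_component_subset: "U \<subseteq> E \<Longrightarrow> e \<in> E \<Longrightarrow> edge_component U e \<subseteq> {1..n}"
proof
  fix v assume a: "U \<subseteq> E" "e \<in> E" "v \<in> edge_component U e"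
  then obtain w where w: "w \<in> e" "w \<in> component U v" by (auto simp: edge_component_def)
  then have "v \<in> component U w" using component_sym by metis
  then show "v \<in> {1..n}" using component_subset[OF a(1), of w] edge(1)[OF a(2)] w by blast
qed

lemma sum_card_edge_component_all:
  assumes U: "U \<subseteq> E"
  shows "(\<Sum>e\<in>U. real (card (edge_component U e))) \<le> (\<Sum>v\<in>{1..n}. real (card (component U v)) - 1)"
  by (rule sum_card_edge_component_le[OF U]) (use U edge_component_subset in auto)

text \<open>The vertices of the root component account for exactly the square of its size among the
  connected pairs. The difference is small when both terms are close to the same square.\<close>

lemma sum_card_edge_component_nonroot:
  assumes U: "U \<subseteq> E"
  shows "(\<Sum>e\<in>{e \<in> U. e \<inter> component U 1 = {}}. real (card (edge_component U e)))
      \<le> (\<Sum>v\<in>{1..n}. real (card (component U v))) - real (card (component U 1)) ^ 2"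
proof -
  let ?R = "component U 1"
  have root_card: "?R \<subseteq> {1..n}" using component_subset[OF U, of 1] n by auto
  have "(\<Sum>e\<in>{e \<in> U. e \<inter> ?R = {}}. real (card (edge_component U e)))
      \<le> (\<Sum>v\<in>{1..n} - ?R. real (card (component U v)) - 1)"
  proof (rule sum_card_edge_component_le[OF U])
    fix e assume e: "e \<in> {e \<in> U. e \<inter> ?R = {}}"
    have "v \<notin> ?R" if "v \<in> edge_component U e" for v
      using that e component_eq[of v U 1] by (auto simp: edge_component_def)
    then show "edge_component U e \<subseteq> {1..n} - ?R" using edge_component_subset[OF U] e U by blast
  qed auto
  also have "\<dots> \<le> (\<Sum>v\<in>{1..n} - ?R. real (card (component U v)))" by (rule sum_mono) simp
  also have "\<dots> = (\<Sum>v\<in>{1..n}. real (card (component U v))) - (\<Sum>v\<in>?R. real (card (component U v)))"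
    by (rule sum_diff) (use root_card in auto)
  also have "(\<Sum>v\<in>?R. real (card (component U v))) = (\<Sum>v\<in>?R. real (card ?R))"
    by (rule sum.cong) (simp_all add: component_eq)
  finally show ?thesis by (simp add: power2_eq_square)
qed

end

section \<open>Recursions for moments of distances\<close>

lemma sum_recursive_trees_Suc:
  assumes "n \<ge> 1"
  shows "(\<Sum>E\<in>recursive_trees (Suc n). F E) = (\<Sum>E\<in>recursive_trees n. \<Sum>i\<in>{1..n}. F (insert {i, Suc n} E))"
  unfolding sum.reindex_bij_betw[OF bij_betw_recursive_trees_Suc[OF assms], of F, symmetric]
  by (simp add: sum.cartesian_product split_def)

lemma card_recursive_trees_Suc:
  assumes "n \<ge> 1"
  shows "card (recursive_trees (Suc n)) = n * card (recursive_trees n)"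
  using bij_betw_same_card[OF bij_betw_recursive_trees_Suc[OF assms]] by (simp add: card_cartesian_product mult.commute)

lemma bridges_recursive_trees_insert:
  assumes E: "E \<in> recursive_trees n" and i: "i \<in> {1..n}"
  shows "u \<in> {1..n} \<Longrightarrow> v \<in> {1..n} \<Longrightarrow> card (bridges (insert {i, Suc n} E) u v) = card (bridges E u v)"
    and "u \<in> {1..n} \<Longrightarrow> card (bridges (insert {i, Suc n} E) u (Suc n)) = Suc (card (bridges E u i))"
proof -
  have wE: "Suc n \<notin> \<Union>E" using recursive_trees_notin[OF E] .
  have iw: "i \<noteq> Suc n" using i by auto
  have u: "u \<noteq> Suc n" if "u \<in> {1..n}" for u using that by auto
  have "{i, Suc n} \<notin> E" using wE by auto
  then have "{i, Suc n} \<notin> bridges E u i" for u by (simp add: bridges_def)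
  moreover have "finite (bridges E u i)" for u 
    by (rule finite_subset[OF bridges_subset recursive_trees_finite[OF E]])
  ultimately show "card (bridges (insert {i, Suc n} E) u (Suc n)) = Suc (card (bridges E u i))"
    if "u \<in> {1..n}" using bridges_insert_leaf(2)[OF wE iw u[OF that]] by simp
  show "card (bridges (insert {i, Suc n} E) u v) = card (bridges E u v)" if "u \<in> {1..n}" "v \<in> {1..n}"
    using bridges_insert_leaf(1)[OF wE iw u u recursive_trees_conn[OF E]] that by simp
qed

definition rt_avg :: "nat \<Rightarrow> (nat set set \<Rightarrow> real) \<Rightarrow> real" where
  "rt_avg n F = (\<Sum>E\<in>recursive_trees n. F E) / card (recursive_trees n)"

lemma card_recursive_trees_pos: "n \<ge> 1 \<Longrightarrow> card (recursive_trees n) > 0"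
  using recursive_trees_nonempty finite_recursive_trees by (simp add: card_gt_0_iff)

lemma rt_avg_Suc:
  assumes "n \<ge> 1"
  shows "rt_avg (Suc n) F = rt_avg n (\<lambda>E. (\<Sum>i\<in>{1..n}. F (insert {i, Suc n} E)) / n)"
  using assms card_recursive_trees_pos[of n]
  by (simp add: rt_avg_def sum_recursive_trees_Suc card_recursive_trees_Suc sum_divide_distrib[symmetric])

lemma rt_avg_cong: "(\<And>E. E \<in> recursive_trees n \<Longrightarrow> F E = G E) \<Longrightarrow> rt_avg n F = rt_avg n G"
  unfolding rt_avg_def by (metis (mono_tags, lifting) sum.cong)

lemma rt_avg_mono: "(\<And>E. E \<in> recursive_trees n \<Longrightarrow> F E \<le> G E) \<Longrightarrow> rt_avg n F \<le> rt_avg n G"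
  unfolding rt_avg_def by (intro divide_right_mono sum_mono) auto

lemma rt_avg_add: "rt_avg n (\<lambda>E. F E + G E) = rt_avg n F + rt_avg n G"
  by (simp add: rt_avg_def sum.distrib add_divide_distrib)

lemma rt_avg_diff: "rt_avg n (\<lambda>E. F E - G E) = rt_avg n F - rt_avg n G"
  by (simp add: rt_avg_def sum_subtractf diff_divide_distrib)

lemma rt_avg_mult: "rt_avg n (\<lambda>E. c * F E) = c * rt_avg n F"
  by (simp add: rt_avg_def sum_distrib_left)

lemma rt_avg_sum: "rt_avg n (\<lambda>E. \<Sum>i\<in>I. F i E) = (\<Sum>i\<in>I. rt_avg n (F i))"
  unfolding rt_avg_def by (subst sum.swap) (simp add: sum_divide_distrib)

lemma rt_avg_const: "n \<ge> 1 \<Longrightarrow> rt_avg n (\<lambda>_. c) = c"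
  using card_recursive_trees_pos[of n] by (simp add: rt_avg_def)

lemma sum_Suc_square:
  fixes f :: "nat \<Rightarrow> nat \<Rightarrow> real"
  assumes "\<And>u v. f u v = f v u"
  shows "(\<Sum>u\<in>{1..Suc n}. \<Sum>v\<in>{1..Suc n}. f u v)
    = (\<Sum>u\<in>{1..n}. \<Sum>v\<in>{1..n}. f u v) + 2 * (\<Sum>u\<in>{1..n}. f u (Suc n)) + f (Suc n) (Suc n)"
  using assms by (simp add: sum.distrib algebra_simps)

definition pair_moment :: "nat \<Rightarrow> real \<Rightarrow> real" where
  "pair_moment n q = rt_avg n (\<lambda>E. \<Sum>u\<in>{1..n}. \<Sum>v\<in>{1..n}. q ^ card (bridges E u v))"

definition mean_depth :: "nat \<Rightarrow> real" where
  "mean_depth n = rt_avg n (\<lambda>E. \<Sum>u\<in>{1..n}. real (card (bridges E 1 u)))"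

text \<open>The new vertex, attached to \<open>i\<close>, contributes a diagonal term
  \<open>1\<close> and twice \<open>q\<close> times the sum of \<open>q ^ d(u, i)\<close> over old
  \<open>u\<close>. Averaging over \<open>i\<close> turns that sum into the old double sum divided
  by \<open>n\<close>, so the recursion closes.\<close>

lemma pair_moment_Suc:
  assumes n: "n \<ge> 1"
  shows "pair_moment (Suc n) q = (1 + 2 * q / n) * pair_moment n q + 1"
proof -
  have "pair_moment (Suc n) q = rt_avg n (\<lambda>E. (\<Sum>i\<in>{1..n}. \<Sum>u\<in>{1..Suc n}. \<Sum>v\<in>{1..Suc n}.
      q ^ card (bridges (insert {i, Suc n} E) u v)) / n)"
    unfolding pair_moment_def by (rule rt_avg_Suc[OF n])
  also have "\<dots> = rt_avg n (\<lambda>E. (1 + 2 * q / n) * (\<Sum>u\<in>{1..n}. \<Sum>v\<in>{1..n}. q ^ card (bridges E u v)) + 1)"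
  proof (rule rt_avg_cong)
    fix E assume E: "E \<in> recursive_trees n"
    let ?S = "\<Sum>u\<in>{1..n}. \<Sum>v\<in>{1..n}. q ^ card (bridges E u v)"
    have "(\<Sum>u\<in>{1..Suc n}. \<Sum>v\<in>{1..Suc n}. q ^ card (bridges (insert {i, Suc n} E) u v))
       = ?S + 2 * q * (\<Sum>u\<in>{1..n}. q ^ card (bridges E u i)) + 1" if i: "i \<in> {1..n}" for i
    proof -
      have "(\<Sum>u\<in>{1..Suc n}. \<Sum>v\<in>{1..Suc n}. q ^ card (bridges (insert {i, Suc n} E) u v))
        = (\<Sum>u\<in>{1..n}. \<Sum>v\<in>{1..n}. q ^ card (bridges (insert {i, Suc n} E) u v))
          + 2 * (\<Sum>u\<in>{1..n}. q ^ card (bridges (insert {i, Suc n} E) u (Suc n))) + 1"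
        by (subst sum_Suc_square) (simp_all add: bridges_sym[of _ _ "_ :: nat"])
      also have "(\<Sum>u\<in>{1..n}. \<Sum>v\<in>{1..n}. q ^ card (bridges (insert {i, Suc n} E) u v)) = ?S"
        using bridges_recursive_trees_insert(1)[OF E i] by (intro sum.cong) auto
      also have "(\<Sum>u\<in>{1..n}. q ^ card (bridges (insert {i, Suc n} E) u (Suc n)))
          = (\<Sum>u\<in>{1..n}. q * q ^ card (bridges E u i))"
        using bridges_recursive_trees_insert(2)[OF E i] by (intro sum.cong) auto
      finally show ?thesis by (simp add: sum_distrib_left[symmetric])
    qed
    then have "(\<Sum>i\<in>{1..n}. \<Sum>u\<in>{1..Suc n}. \<Sum>v\<in>{1..Suc n}. q ^ card (bridges (insert {i, Suc n} E) u v))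
       = (\<Sum>i\<in>{1..n}. ?S + 2 * q * (\<Sum>u\<in>{1..n}. q ^ card (bridges E u i)) + 1)"
      by (intro sum.cong) auto
    also have "\<dots> = n * ?S + 2 * q * (\<Sum>i\<in>{1..n}. \<Sum>u\<in>{1..n}. q ^ card (bridges E u i)) + n"
      by (simp add: sum.distrib sum_distrib_left)
    also have "(\<Sum>i\<in>{1..n}. \<Sum>u\<in>{1..n}. q ^ card (bridges E u i)) = ?S"
      by (rule sum.swap)
    finally show "(\<Sum>i\<in>{1..n}. \<Sum>u\<in>{1..Suc n}. \<Sum>v\<in>{1..Suc n}.
      q ^ card (bridges (insert {i, Suc n} E) u v)) / n = (1 + 2 * q / n) * ?S + 1"
      using n by (simp add: field_simps)
  qed
  also have "\<dots> = (1 + 2 * q / n) * pair_moment n q + 1"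
    unfolding pair_moment_def rt_avg_add rt_avg_mult rt_avg_const[OF n] ..
  finally show ?thesis .
qed

lemma pair_moment_1: "pair_moment 1 q = 1"
  unfolding pair_moment_def rt_avg_def recursive_trees_one by simp

lemma mean_depth_Suc:
  assumes n: "n \<ge> 1"
  shows "mean_depth (Suc n) = (1 + 1 / n) * mean_depth n + 1"
proof -
  have one: "1 \<in> {1..n}" using n by simp
  have "mean_depth (Suc n) = rt_avg n (\<lambda>E. (\<Sum>i\<in>{1..n}. \<Sum>u\<in>{1..Suc n}.
      real (card (bridges (insert {i, Suc n} E) 1 u))) / n)"
    unfolding mean_depth_def by (rule rt_avg_Suc[OF n])
  also have "\<dots> = rt_avg n (\<lambda>E. (1 + 1 / n) * (\<Sum>u\<in>{1..n}. real (card (bridges E 1 u))) + 1)"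
  proof (rule rt_avg_cong)
    fix E assume E: "E \<in> recursive_trees n"
    let ?S = "\<Sum>u\<in>{1..n}. real (card (bridges E 1 u))"
    have "(\<Sum>u\<in>{1..Suc n}. real (card (bridges (insert {i, Suc n} E) 1 u)))
      = ?S + real (card (bridges E 1 i)) + 1" if i: "i \<in> {1..n}" for i
      using bridges_recursive_trees_insert[OF E i] one by (simp add: sum.nat_ivl_Suc')
    then have "(\<Sum>i\<in>{1..n}. \<Sum>u\<in>{1..Suc n}. real (card (bridges (insert {i, Suc n} E) 1 u)))
       = (\<Sum>i\<in>{1..n}. ?S + real (card (bridges E 1 i)) + 1)"
      by (intro sum.cong) auto
    also have "\<dots> = n * ?S + ?S + n" by (simp add: sum.distrib)
    finally show "(\<Sum>i\<in>{1..n}. \<Sum>u\<in>{1..Suc n}. real (card (bridges (insert {i, Suc n} E) 1 u))) / n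
        = (1 + 1 / n) * ?S + 1"
      using n by (simp add: field_simps)
  qed
  also have "\<dots> = (1 + 1 / n) * mean_depth n + 1"
    unfolding mean_depth_def rt_avg_add rt_avg_mult rt_avg_const[OF n] ..
  finally show ?thesis .
qed

text \<open>The exact solution of the recursion is \<open>n (H_n - 1)\<close> with the harmonic
  number \<open>H_n\<close>.\<close>

lemma mean_depth_le:
  assumes "n \<ge> 1" shows "mean_depth n \<le> n * ln n"
  using assms
proof (induction n rule: dec_induct)
  case base
  then show ?case unfolding mean_depth_def rt_avg_def recursive_trees_one by simp
next
  case (step n)
  have n: "real n > 0" using step by simp
  have "1 / real (Suc n) \<le> ln (real (Suc n) / n)"
    using ln_le_minus_one[of "n / real (Suc n)"] n by (simp add: ln_div field_simps)
  then have l: "real (Suc n) * ln n + 1 \<le> real (Suc n) * ln (Suc n)"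
    using n by (simp add: ln_div field_simps)
  have "mean_depth (Suc n) = (1 + 1 / n) * mean_depth n + 1" using mean_depth_Suc step by simp
  also have "\<dots> \<le> (1 + 1 / n) * (n * ln n) + 1"
    using step.IH by (intro add_right_mono mult_left_mono) auto
  also have "\<dots> = real (Suc n) * ln n + 1" using n by (simp add: field_simps)
  finally show ?case using l by linarith
qed

text \<open>For \<open>q = 1\<close> the homogeneous recursion is solved by
  \<open>n (n + 1) / 2\<close>. For \<open>q = 1 - z\<close> each factor is multiplied by
  \<open>1 - 2 z / (n + 2)\<close>, and the product of these is estimated by an exponential. The
  term \<open>- b n\<close> in the induction is a particular solution of the inhomogeneous
  recursion: this means \<open>b (2 q - 1) = 1\<close>, with \<open>b > 0\<close> because
  \<open>q > 1 / 2\<close>.\<close>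

lemma pair_moment_le:
  assumes q: "1 / 2 < q" "q \<le> 1" and n: "n \<ge> 1"
  defines "z \<equiv> 1 - q"
  shows "pair_moment n q \<le> q / (2 * q - 1) * (n * (n + 1)) * exp (4 * z) * exp (- 2 * z * ln n)"
proof -
  define b where "b = 1 / (2 * q - 1)"
  have b0: "b > 0" and b1: "b * (2 * q - 1) = 1" using q by (auto simp: b_def)
  have z: "0 \<le> z" "q = 1 - z" using q by (auto simp: z_def)
  \<comment> \<open>The factor \<open>1 + b\<close> makes both sides equal to \<open>1\<close> at
    \<open>n = 1\<close>, and the logarithm vanishes there because
    \<open>(1 + 2) / 3 = 1\<close>.\<close>
  have claim: "pair_moment n q \<le> (1 + b) * (n * (n + 1) / 2) * exp (- 2 * z * ln ((real n + 2) / 3)) - b * n"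
    using n
  proof (induction n rule: dec_induct)
    case base
    then show ?case using pair_moment_1[of q] by simp
  next
    case (step n)
    have n: "real n > 0" using step by simp
    define X where "X = exp (- 2 * z * ln ((real n + 2) / 3))"
    define X' where "X' = exp (- 2 * z * ln ((real (Suc n) + 2) / 3))"
    have "ln ((real n + 3) / (n + 2)) \<le> 1 / (real n + 2)"
      using ln_le_minus_one[of "(real n + 3) / (n + 2)"] n by (simp add: field_simps)
    moreover have "ln ((real (Suc n) + 2) / 3) = ln ((real n + 2) / 3) + ln ((real n + 3) / (n + 2))"
      using n by (simp add: ln_div ln_mult add.commute)
    ultimately have lnle: "ln ((real (Suc n) + 2) / 3) \<le> ln ((real n + 2) / 3) + 1 / (real n + 2)" by simp
    have "1 - 2 * z / (n + 2) \<le> exp (- 2 * z / (n + 2))"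
      using exp_ge_add_one_self[of "- 2 * z / (n + 2)"] by simp
    then have "(1 - 2 * z / (n + 2)) * X \<le> exp (- 2 * z / (n + 2)) * X"
      by (rule mult_right_mono) (simp add: X_def)
    also have "\<dots> = exp (- 2 * z * (ln ((real n + 2) / 3) + 1 / (real n + 2)))"
      by (simp add: X_def exp_add[symmetric] algebra_simps)
    also have "\<dots> \<le> X'" unfolding X'_def using mult_left_mono[OF lnle, of "2 * z"] z by simp
    finally have XX: "(1 - 2 * z / (n + 2)) * X \<le> X'" .
    have "pair_moment (Suc n) q = (1 + 2 * q / n) * pair_moment n q + 1" using pair_moment_Suc step by simp
    also have "\<dots> \<le> (1 + 2 * q / n) * ((1 + b) * (n * (n + 1) / 2) * X - b * n) + 1"
      using step.IH q n unfolding X_def by (intro add_right_mono mult_left_mono) (auto simp: add.commute)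
    also have "\<dots> = (1 + b) * (real ((n + 1) * (n + 2)) / 2) * ((1 - 2 * z / (n + 2)) * X) - b * n - b * (2 * q) + 1"
    proof -
      have e1: "(1 + 2 * q / n) * (real (n * (n + 1)) / 2) = real ((n + 1) * (n + 2)) / 2 * (1 - 2 * z / real (n + 2))"
        unfolding z(2) using n by (simp add: field_simps)
      have e2: "(1 + 2 * q / n) * (b * n) = b * n + b * (2 * q)" using n by (simp add: field_simps)
      have *: "a * ((1 + b) * c * X - d) = (1 + b) * (a * c) * X - a * d" for a c d
        by (simp add: algebra_simps)
      show ?thesis unfolding * e1 e2 by simp
    qed
    also have "\<dots> \<le> (1 + b) * (real ((n + 1) * (n + 2)) / 2) * X' - b * n - b * (2 * q) + 1"
      by (intro add_right_mono diff_right_mono mult_left_mono XX) (use b0 in auto)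
    also have "\<dots> = (1 + b) * (real ((n + 1) * (n + 2)) / 2) * X' - b * (n + 1)"
      using b1 by (simp add: algebra_simps)
    finally show ?case unfolding X'_def by (simp add: add.commute)
  qed
  \<comment> \<open>Since \<open>ln 3 <= 2\<close>, passing from \<open>(n + 2) / 3\<close> to
    \<open>n\<close> costs at most the factor \<open>exp (4 * z)\<close>.\<close>
  have "ln (real n) - 2 \<le> ln ((real n + 2) / 3)"
  proof -
    have "ln 3 \<le> (2::real)" using ln_le_minus_one[of 3] by simp
    moreover have "ln (real n) \<le> ln (real n + 2)" using n by simp
    moreover have "ln ((real n + 2) / 3) = ln (real n + 2) - ln 3" by (simp add: ln_div)
    ultimately show ?thesis by linarith
  qed
  then have "2 * z * (ln (real n) - 2) \<le> 2 * z * ln ((real n + 2) / 3)"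
    by (rule mult_left_mono) (use z in simp)
  then have "exp (- 2 * z * ln ((real n + 2) / 3)) \<le> exp (4 * z) * exp (- 2 * z * ln n)"
    by (simp add: exp_add[symmetric] algebra_simps)
  then have "(1 + b) * (n * (n + 1) / 2) * exp (- 2 * z * ln ((real n + 2) / 3))
      \<le> (1 + b) * (n * (n + 1) / 2) * (exp (4 * z) * exp (- 2 * z * ln n))"
    by (rule mult_left_mono) (use b0 in auto)
  moreover have "b * n \<ge> 0" using b0 by simp
  ultimately have "pair_moment n q \<le> (1 + b) * (n * (n + 1) / 2) * (exp (4 * z) * exp (- 2 * z * ln n))"
    using claim by linarith
  also have "1 + b = 2 * (q / (2 * q - 1))" using q by (simp add: b_def field_simps)
  also have "2 * c * (real (n * (n + 1)) / 2) * X = c * real (n * (n + 1)) * X" for c X :: real by simp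
  finally show ?thesis by (simp only: mult.assoc of_nat_mult of_nat_add of_nat_1)
qed

section \<open>Deterministic analysis of the dynamics\<close>

text \<open>The coin \<open>b\<close> of \<open>e\<close> is drawn in advance. A skipped edge has a
  coin too, which is ignored; this makes the final state a deterministic function of the marked
  order.\<close>

fun step :: "'v set set \<Rightarrow> 'v set set \<times> 'v set set \<Rightarrow> 'v set \<times> bool \<Rightarrow> 'v set set \<times> 'v set set" where
  "step E (B, F) (e, b) =
     (if e \<in> B then (B, F) else if b then (B \<union> cluster (E - B - F) e, F) else (B, insert e F))"

definition run :: "'v set set \<Rightarrow> ('v set \<times> bool) list \<Rightarrow> 'v set set \<times> 'v set set" where
  "run E xs = foldl (step E) ({}, {}) xs"

text \<open>An edge that has burnt stays pending until its turn comes, so fires leave no trace in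
  this set.\<close>

definition pending :: "'v set set \<Rightarrow> ('v set \<times> bool) list \<Rightarrow> 'v set set" where
  "pending E xs = E - fst ` set xs"

lemma run_Nil [simp]: "run E [] = ({}, {})"
  by (simp add: run_def)

lemma run_snoc [simp]: "run E (xs @ [x]) = step E (run E xs) x"
  by (simp add: run_def)

lemma pending_Nil [simp]: "pending E [] = E"
  by (simp add: pending_def)

lemma pending_subset: "pending E xs \<subseteq> E"
  by (auto simp: pending_def)

lemma pending_antimono: "set xs \<subseteq> set ys \<Longrightarrow> pending E ys \<subseteq> pending E xs"
  by (auto simp: pending_def)

lemma pending_take_antimono: "j \<le> k \<Longrightarrow> pending E (take k xs) \<subseteq> pending E (take j xs)"
  by (intro pending_antimono set_take_subset_set_take)

definition root_cut :: "nat set set \<Rightarrow> (nat set \<times> bool) list \<Rightarrow> nat \<Rightarrow> bool" where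
  "root_cut E xs k \<longleftrightarrow> fst (xs ! k) \<inter> component (pending E (take k xs)) 1 \<noteq> {}"

definition root_fire :: "nat set set \<Rightarrow> (nat set \<times> bool) list \<Rightarrow> nat \<Rightarrow> bool" where
  "root_fire E xs k \<longleftrightarrow> snd (xs ! k) \<and> root_cut E xs k"

definition no_root_fire :: "nat set set \<Rightarrow> (nat set \<times> bool) list \<Rightarrow> bool" where
  "no_root_fire E xs \<longleftrightarrow> (\<forall>k<length xs. \<not> root_fire E xs k)"

text \<open>Decided by the marks and the pending edges without the state, so a marked edge that has
  already burnt counts as well. The overcount keeps the expectation computable step by step.\<close>

definition small_fire :: "nat set set \<Rightarrow> (nat set \<times> bool) list \<Rightarrow> nat \<Rightarrow> nat set" where
  "small_fire E xs k = (if snd (xs ! k) \<and> \<not> root_cut E xs k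
     then edge_component (pending E (take k xs)) (fst (xs ! k)) else {})"

definition small_fires :: "nat set set \<Rightarrow> (nat set \<times> bool) list \<Rightarrow> nat set" where
  "small_fires E xs = (\<Union>k<length xs. small_fire E xs k)"

lemma root_cut_append: "k < length xs \<Longrightarrow> root_cut E (xs @ ys) k = root_cut E xs k"
  by (simp add: root_cut_def nth_append)

lemma root_fire_append: "k < length xs \<Longrightarrow> root_fire E (xs @ ys) k = root_fire E xs k"
  by (simp add: root_fire_def nth_append root_cut_append)

lemma small_fire_append: "k < length xs \<Longrightarrow> small_fire E (xs @ ys) k = small_fire E xs k"
  by (simp add: small_fire_def nth_append root_cut_append)

lemma small_fires_snoc: "small_fires E (xs @ [x]) = small_fires E xs \<union> small_fire E (xs @ [x]) (length xs)"
proof -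
  have "small_fires E (xs @ [x]) = (\<Union>k<length xs. small_fire E (xs @ [x]) k) \<union> small_fire E (xs @ [x]) (length xs)"
    by (auto simp: small_fires_def lessThan_Suc)
  also have "(\<Union>k<length xs. small_fire E (xs @ [x]) k) = small_fires E xs"
    unfolding small_fires_def by (rule SUP_cong) (simp_all add: small_fire_append)
  finally show ?thesis .
qed

lemma no_root_fire_snoc:
  "no_root_fire E (xs @ [x]) \<longleftrightarrow> no_root_fire E xs \<and> \<not> root_fire E (xs @ [x]) (length xs)"
  by (auto simp: no_root_fire_def less_Suc_eq root_fire_append)

lemma no_root_fire_take:
  "k \<le> length xs \<Longrightarrow> no_root_fire E (take k xs) \<longleftrightarrow> (\<forall>j<k. \<not> root_fire E xs j)"
proof -
  assume k: "k \<le> length xs"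
  have "root_fire E (take k xs) j = root_fire E xs j" if "j < k" for j
    using root_fire_append[of j "take k xs" E "drop k xs"] that k by simp
  then show ?thesis using k by (auto simp: no_root_fire_def)
qed

lemma cluster_subset: "e \<in> A \<Longrightarrow> cluster A e \<subseteq> A"
  by (auto simp: cluster_def elim: rtranclE)

lemma mem_cluster_self [simp]: "e \<in> cluster A e"
  by (simp add: cluster_def)

lemma cluster_step: "f \<in> cluster A e \<Longrightarrow> f \<in> A \<Longrightarrow> g \<in> A \<Longrightarrow> f \<inter> g \<noteq> {} \<Longrightarrow> g \<in> cluster A e"
  unfolding cluster_def by (auto intro: rtrancl_into_rtrancl)

lemma run_invariant:
  assumes "distinct (map fst xs)" "fst ` set xs \<subseteq> E" "run E xs = (B, F)"
  shows "F \<subseteq> fst ` set xs \<and> F \<inter> B = {} \<and> fst ` set xs \<subseteq> B \<union> F \<and> B \<subseteq> E"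
  using assms
proof (induction xs arbitrary: B F rule: rev_induct)
  case (snoc x xs)
  obtain e b where x: "x = (e, b)" by (cases x)
  obtain B0 F0 where BF0: "run E xs = (B0, F0)" by (cases "run E xs")
  have IH: "F0 \<subseteq> fst ` set xs" "F0 \<inter> B0 = {}" "fst ` set xs \<subseteq> B0 \<union> F0" "B0 \<subseteq> E"
    using snoc.IH[of B0 F0] snoc.prems BF0 by auto
  have e: "e \<notin> fst ` set xs" "e \<in> E" using snoc.prems x by auto
  show ?case
  proof (cases "e \<in> B0 \<or> \<not> b")
    case True
    then show ?thesis using IH e snoc.prems(3) BF0 x by (auto split: if_splits)
  next
    case False
    then have "e \<in> E - B0 - F0" using e IH by auto
    then have c: "cluster (E - B0 - F0) e \<subseteq> E - B0 - F0" by (rule cluster_subset)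
    have BF: "B = B0 \<union> cluster (E - B0 - F0) e" "F = F0" using False snoc.prems(3) BF0 x by auto
    have "e \<in> B" unfolding BF by simp
    then show ?thesis using IH e c BF x by auto
  qed
qed (auto)

lemma run_mono:
  assumes "run E xs = (B, F)" "run E (xs @ ys) = (B', F')" shows "B \<subseteq> B'"
  using assms(2)
proof (induction ys arbitrary: B' F' rule: rev_induct)
  case Nil
  then show ?case using assms by simp
next
  case (snoc y ys)
  obtain B0 F0 where 0: "run E (xs @ ys) = (B0, F0)" by (cases "run E (xs @ ys)")
  obtain e b where y: "y = (e, b)" by (cases y)
  have "step E (B0, F0) (e, b) = (B', F')" using snoc.prems 0 y by (simp flip: append_assoc)
  then have "B0 \<subseteq> B'" by (auto split: if_splits)
  then show ?case using snoc.IH[OF 0] by blast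
qed

lemma edge_component_disjoint:
  assumes "e \<inter> component U r = {}" shows "edge_component U e \<inter> component U r = {}"
proof -
  have "v \<notin> component U r" if "v \<in> edge_component U e" for v
    using that assms component_eq[of v U r] by (auto simp: edge_component_def)
  then show ?thesis by blast
qed

context recursive_tree
begin

text \<open>Fire passes only between edges with a common vertex, hence between edges of the same
  component of \<open>U\<close>.\<close>

lemma Union_cluster_subset:
  assumes A: "A \<subseteq> U" "e \<in> U" and U: "U \<subseteq> E"
  shows "\<Union>(cluster A e) \<subseteq> edge_component U e"
proof -
  have "f \<subseteq> edge_component U e" if "(e, f) \<in> {(a, b). a \<in> A \<and> b \<in> A \<and> a \<inter> b \<noteq> {}}\<^sup>*" for f
    using that
  proof (induction rule: rtrancl_induct)
    case base
    show ?case using self_in_component by (force simp: edge_component_def)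
  next
    case (step f g)
    then obtain x where x: "x \<in> f" "x \<in> g" and g: "g \<in> U" using A by blast
    then have "x \<in> edge_component U e" using step.IH by blast
    then obtain y where y: "y \<in> e" "y \<in> component U x" by (auto simp: edge_component_def)
    show ?case
    proof
      fix z assume "z \<in> g"
      have "g \<subseteq> component U x" by (rule edge_in_component[OF U g]) (use x self_in_component[of x U] in blast)
      then have "z \<in> component U x" using \<open>z \<in> g\<close> by blast
      then have "component U z = component U x" by (rule component_eq)
      then show "z \<in> edge_component U e" using y by (auto simp: edge_component_def)
    qed
  qed
  then show ?thesis unfolding cluster_def by blast
qed

definition valid :: "(nat set \<times> bool) list \<Rightarrow> bool" where
  "valid xs \<longleftrightarrow> distinct (map fst xs) \<and> fst ` set xs \<subseteq> E"

lemma valid_appendD: "valid (xs @ ys) \<Longrightarrow> valid xs"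
  by (auto simp: valid_def)

lemma valid_take: "valid xs \<Longrightarrow> valid (take k xs)"
  by (metis append_take_drop_id valid_appendD)

lemma flammable_subset:
  assumes "valid xs" "run E xs = (B, F)" shows "E - B - F \<subseteq> pending E xs" "E - B - F = pending E xs - B"
  using run_invariant[of xs E B F] assms by (auto simp: valid_def pending_def)

text \<open>Disjointness is inherited because root components decrease along the order and each new
  fire avoids the current one.\<close>

lemma burnt_disjoint_root:
  assumes "valid xs" "no_root_fire E xs" "run E xs = (B, F)"
  shows "\<Union>B \<inter> component (pending E xs) 1 = {}"
  using assms
proof (induction xs arbitrary: B F rule: rev_induct)
  case (snoc x xs)
  obtain e b where x: "x = (e, b)" by (cases x)
  obtain B0 F0 where BF0: "run E xs = (B0, F0)" by (cases "run E xs")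
  have v: "valid xs" using snoc.prems(1) by (rule valid_appendD)
  have nr: "no_root_fire E xs" "\<not> root_fire E (xs @ [x]) (length xs)"
    using snoc.prems(2) by (auto simp: no_root_fire_snoc)
  have e: "e \<in> pending E xs" using snoc.prems(1) x by (auto simp: valid_def pending_def)
  have IH: "\<Union>B0 \<inter> component (pending E xs) 1 = {}" using snoc.IH[OF v nr(1) BF0] .
  have sub: "component (pending E (xs @ [x])) 1 \<subseteq> component (pending E xs) 1"
    by (intro component_mono pending_antimono) auto
  show ?case
  proof (cases "e \<in> B0 \<or> \<not> b")
    case True
    then show ?thesis using IH snoc.prems(3) BF0 x sub by (auto split: if_splits)
  next
    case False
    have BF: "B = B0 \<union> cluster (E - B0 - F0) e" using False snoc.prems(3) BF0 x by auto
    have "e \<inter> component (pending E xs) 1 = {}" using nr(2) False x by (auto simp: root_fire_def root_cut_def)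
    then have "edge_component (pending E xs) e \<inter> component (pending E xs) 1 = {}" by (rule edge_component_disjoint)
    moreover have "\<Union>(cluster (E - B0 - F0) e) \<subseteq> edge_component (pending E xs) e"
      by (rule Union_cluster_subset[OF flammable_subset(1)[OF v BF0] e pending_subset])
    ultimately show ?thesis using IH sub unfolding BF by blast
  qed
qed simp

text \<open>\<open>root_fire\<close> ignores the state and may hold at several steps, but the later
  root components are contained in the first. One set \<open>C\<close> containing all of them covers
  every such fire, whether or not the root has already burnt.\<close>

lemma burnt_subset:
  assumes "valid xs" "run E xs = (B, F)"
    and "\<And>k. k < length xs \<Longrightarrow> root_fire E xs k \<Longrightarrow> component (pending E (take k xs)) 1 \<subseteq> C"
  shows "\<Union>B \<subseteq> C \<union> small_fires E xs"
  using assms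
proof (induction xs arbitrary: B F rule: rev_induct)
  case (snoc x xs)
  obtain e b where x: "x = (e, b)" by (cases x)
  obtain B0 F0 where BF0: "run E xs = (B0, F0)" by (cases "run E xs")
  have v: "valid xs" using snoc.prems(1) by (rule valid_appendD)
  have e: "e \<in> pending E xs" using snoc.prems(1) x by (auto simp: valid_def pending_def)
  have IH: "\<Union>B0 \<subseteq> C \<union> small_fires E xs"
  proof (rule snoc.IH[OF v BF0])
    fix k assume "k < length xs" "root_fire E xs k"
    then show "component (pending E (take k xs)) 1 \<subseteq> C" using snoc.prems(3)[of k] by (simp add: root_fire_append)
  qed
  show ?case
  proof (cases "e \<in> B0 \<or> \<not> b")
    case True
    then show ?thesis using IH snoc.prems(2) BF0 x by (auto simp: small_fires_snoc split: if_splits)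
  next
    case False
    have BF: "B = B0 \<union> cluster (E - B0 - F0) e" using False snoc.prems(2) BF0 x by auto
    have c: "\<Union>(cluster (E - B0 - F0) e) \<subseteq> edge_component (pending E xs) e"
      by (rule Union_cluster_subset[OF flammable_subset(1)[OF v BF0] e pending_subset])
    have "edge_component (pending E xs) e \<subseteq> C \<union> small_fire E (xs @ [x]) (length xs)"
    proof (cases "root_cut E (xs @ [x]) (length xs)")
      case True
      then have "component (pending E xs) 1 \<subseteq> C"
        using snoc.prems(3)[of "length xs"] False x by (simp add: root_fire_def)
      moreover have "edge_component (pending E xs) e \<subseteq> component (pending E xs) 1"
      proof
        fix v assume "v \<in> edge_component (pending E xs) e"
        then obtain w where w: "w \<in> e" "w \<in> component (pending E xs) v" by (auto simp: edge_component_def)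
        have "e \<inter> component (pending E xs) 1 \<noteq> {}" using True x by (simp add: root_cut_def)
        then have "w \<in> component (pending E xs) 1" using edge_in_component[OF pending_subset e] w by blast
        then show "v \<in> component (pending E xs) 1" using w component_eq self_in_component by metis
      qed
      ultimately show ?thesis by blast
    next
      case F: False
      then show ?thesis using False x by (simp add: small_fire_def)
    qed
    then show ?thesis using IH c unfolding BF small_fires_snoc by blast
  qed
qed simp

text \<open>By \<open>burnt_disjoint_root\<close> every pending edge that meets the root component
  is flammable, so the cluster of the starting edge exhausts the component. The membership
  \<open>1 \<in> \<Union>B\<close> is recorded separately, because \<open>component B 1\<close>
  contains \<open>1\<close> even if no edge at \<open>1\<close> has burnt.\<close>

lemma root_fire_burns:
  assumes v: "valid xs" and k: "k < length xs" and f: "root_fire E xs k"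
    and nr: "no_root_fire E (take k xs)" and r: "run E xs = (B, F)"
  shows "component (pending E (take k xs)) 1 \<subseteq> component B 1" "1 \<in> \<Union>B"
proof -
  define ys where "ys = take k xs"
  define U where "U = pending E ys"
  obtain e b where x: "xs ! k = (e, b)" by (cases "xs ! k")
  have b: b and eR: "e \<inter> component U 1 \<noteq> {}" using f x by (auto simp: root_fire_def root_cut_def U_def ys_def)
  have take: "take (Suc k) xs = ys @ [(e, b)]" using k x by (simp add: ys_def take_Suc_conv_app_nth)
  have vy: "valid ys" using v by (simp add: ys_def valid_take)
  have e: "e \<in> U" using valid_take[OF v, of "Suc k"] unfolding take by (auto simp: valid_def pending_def U_def)
  have UE: "U \<subseteq> E" by (simp add: U_def pending_subset)
  obtain B0 F0 where BF0: "run E ys = (B0, F0)" by (cases "run E ys")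
  have dis: "\<Union>B0 \<inter> component U 1 = {}"
    using burnt_disjoint_root[OF vy _ BF0] nr by (simp add: U_def ys_def)
  have A: "E - B0 - F0 = U - B0" using flammable_subset(2)[OF vy BF0] by (simp add: U_def)
  define C where "C = cluster (U - B0) e"
  have eB: "e \<notin> B0" using dis eR by blast
  have "run E (take (Suc k) xs) = (B0 \<union> C, F0)" unfolding take using BF0 eB b by (simp add: A C_def)
  moreover have "run E (take (Suc k) xs @ drop (Suc k) xs) = (B, F)" using r by simp
  ultimately have CB: "C \<subseteq> B" using run_mono by blast
  obtain w where w: "w \<in> e" "w \<in> component U 1" using eR by blast
  have inA: "g \<in> U - B0" if "g \<in> U" "g \<inter> component U 1 \<noteq> {}" for g using that dis by blast
  \<comment> \<open>Along a walk from the end \<open>w\<close> of the starting edge, all pending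
    edges at each visited vertex join the cluster; having the full star in the invariant is what
    lets the next edge of the walk burn.\<close>
  have HC: "v \<in> component U 1 \<and> (\<forall>g\<in>U. v \<in> g \<longrightarrow> g \<in> C)" if "conn U w v" for v
    using that
  proof (induction rule: rtrancl_induct)
    case base
    have "g \<in> C" if g: "g \<in> U" "w \<in> g" for g
      unfolding C_def by (rule cluster_step[of e]) (use g w e inA in auto)
    then show ?case using w by blast
  next
    case (step y z)
    have yz: "{y, z} \<in> U" using step.hyps by (simp add: adj_def)
    then have z: "z \<in> component U 1" using step.IH component_step by metis
    have "{y, z} \<in> C" using yz step.IH by blast
    then have "g \<in> C" if g: "g \<in> U" "z \<in> g" for g
      unfolding C_def by (rule cluster_step[of "{y, z}"]) (use g z yz inA in auto)
    then show ?case using z by blast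
  qed
  have CC: "conn C u v" if "conn U u v" "conn U w u" for u v
    using that
  proof (induction rule: rtrancl_induct)
    case (step y z)
    have yz: "{y, z} \<in> U" using step.hyps by (simp add: adj_def)
    have "conn U w y" using step.hyps(1) step.prems conn_trans by metis
    then have "{y, z} \<in> C" using HC yz by blast
    then show ?case using step.IH[OF step.prems] conn_step by metis
  qed simp
  have w1: "conn U w 1" using w(2) conn_sym by (auto simp: component_def)
  have "component U 1 \<subseteq> component C 1" using CC[of 1] w1 by (auto simp: component_def)
  also have "\<dots> \<subseteq> component B 1" using CB by (rule component_mono)
  finally show "component (pending E (take k xs)) 1 \<subseteq> component B 1" by (simp add: U_def ys_def)
  have "1 \<in> \<Union>C"
  proof (cases "w = 1")
    case True
    then show ?thesis using w by (auto simp: C_def)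
  next
    case False
    have "conn C w 1" using CC[OF w1] by simp
    then show ?thesis using conn_in_Union False by metis
  qed
  then show "1 \<in> \<Union>B" using CB by blast
qed

end

section \<open>Sizes of the burnt subtrees\<close>

text \<open>\<open>g\<close> is the proportion burnt together with the root; the limit in the
  theorem is the case \<open>g = 1 - min (\<epsilon> \<omega>) 1\<close>.\<close>

definition limit_vector :: "real \<Rightarrow> nat \<Rightarrow> real" where
  "limit_vector g k = (if k = 0 then 1 - g else if k = 1 then g else 0)"

text \<open>The value \<open>0\<close> stands for a root component that never catches fire. Later
  root fires are ignored, since what they burn is contained in the first one.\<close>

definition root_fire_mass :: "nat set set \<Rightarrow> (nat set \<times> bool) list \<Rightarrow> nat" where
  "root_fire_mass E xs = (if no_root_fire E xs then 0
     else card (component (pending E (take (LEAST k. k < length xs \<and> root_fire E xs k) xs)) 1))"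

definition all_fires :: "nat set set \<Rightarrow> (nat set \<times> bool) list \<Rightarrow> nat set" where
  "all_fires E xs = (\<Union>k<length xs. if snd (xs ! k) then edge_component (pending E (take k xs)) (fst (xs ! k)) else {})"

lemma finite_support_l1:
  assumes "\<And>k. k > N \<Longrightarrow> x k = 0" shows "x \<in> l1_space"
proof -
  have "(\<lambda>k. \<bar>x k\<bar>) summable_on {..N}" by simp
  then have "(\<lambda>k. \<bar>x k\<bar>) summable_on UNIV"
    by (rule summable_on_cong_neutral[THEN iffD1, rotated -1]) (use assms in \<open>auto simp: not_le\<close>)
  then show ?thesis by (simp add: l1_space_def)
qed

lemma rescaled_sizes_l1: "rescaled_sizes n S \<in> l1_space"
proof (rule finite_support_l1)
  fix k assume "k > Suc (length (burnt_sizes n S))"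
  then show "rescaled_sizes n S k = 0"
    by (cases k) (auto simp: rescaled_sizes_def ranked_burnt_size_def)
qed

lemma limit_vector_l1: "limit_vector g \<in> l1_space"
  by (rule finite_support_l1[of 1]) (auto simp: limit_vector_def)

lemma l1_dist_finite:
  assumes "\<And>k. k > N \<Longrightarrow> x k = y k" shows "l1_dist x y = (\<Sum>k\<le>N. \<bar>x k - y k\<bar>)"
proof -
  have "l1_dist x y = (\<Sum>\<^sub>\<infinity>k\<in>{..N}. \<bar>x k - y k\<bar>)"
    unfolding l1_dist_def by (rule infsum_cong_neutral) (use assms in \<open>auto simp: not_le\<close>)
  then show ?thesis by simp
qed

lemma l1_dist_limit_vector: "l1_dist (limit_vector g) (limit_vector h) = 2 * \<bar>g - h\<bar>"
proof -
  have "l1_dist (limit_vector g) (limit_vector h) = (\<Sum>k\<le>1. \<bar>limit_vector g k - limit_vector h k\<bar>)"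
    by (rule l1_dist_finite) (auto simp: limit_vector_def)
  then show ?thesis by (simp add: limit_vector_def)
qed

text \<open>The contributions are \<open>(M - G) / n\<close> from the fireproof vertices,
  \<open>(r 0 - G) / n\<close> from the largest burnt subtree, and the sum of the other sizes over
  \<open>n\<close>; \<open>r 0\<close> cancels between the last two. A lower bound for the largest
  size and an upper bound for the total are therefore enough.\<close>

lemma l1_dist_rescaled_sizes:
  assumes n: "n \<ge> 1" and M: "num_fireproof n S = n - M" "M \<le> n" and s: "sum_list (burnt_sizes n S) \<le> M"
    and G: "real G \<le> ranked_burnt_size n S 0"
  shows "l1_dist (rescaled_sizes n S) (limit_vector (G / n)) \<le> 2 * (real M - G) / n"
proof -
  let ?L = "burnt_sizes n S"
  define r where "r = (\<lambda>j. real (ranked_burnt_size n S j))"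
  have n0: "real n > 0" using n by simp
  have "l1_dist (rescaled_sizes n S) (limit_vector (G / n))
    = (\<Sum>k\<le>Suc (Suc (length ?L)). \<bar>rescaled_sizes n S k - limit_vector (G / n) k\<bar>)"
  proof (rule l1_dist_finite)
    fix k assume "k > Suc (Suc (length ?L))"
    then show "rescaled_sizes n S k = limit_vector (G / n) k"
      by (cases k) (auto simp: rescaled_sizes_def ranked_burnt_size_def limit_vector_def)
  qed
  also have "\<dots> = \<bar>(real n - real M) / n - (1 - G / n)\<bar> + \<bar>r 0 / n - G / n\<bar>
      + (\<Sum>k\<le>length ?L. r (Suc k) / n)"
    using M by (simp add: sum.atMost_Suc_shift rescaled_sizes_def limit_vector_def r_def of_nat_diff del: sum.atMost_Suc)
  also have "(\<Sum>k\<le>length ?L. r (Suc k) / n) = ((\<Sum>k\<le>length ?L. r k) - r 0) / n"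
  proof -
    have "(\<Sum>k\<le>Suc (length ?L). r k) = r 0 + (\<Sum>k\<le>length ?L. r (Suc k))"
      by (rule sum.atMost_Suc_shift)
    moreover have "r (Suc (length ?L)) = 0" by (simp add: r_def ranked_burnt_size_def)
    ultimately show ?thesis by (simp add: sum_divide_distrib[symmetric])
  qed
  also have "(\<Sum>k\<le>length ?L. r k) = sum_list ?L"
  proof -
    have "(\<Sum>k\<le>length ?L. r k) = (\<Sum>k<length ?L. r k)"
      by (simp add: lessThan_Suc_atMost[symmetric] r_def ranked_burnt_size_def)
    also have "\<dots> = (\<Sum>k<length ?L. real (?L ! k))"
      by (rule sum.cong) (simp_all add: r_def ranked_burnt_size_def)
    also have "\<dots> = real (\<Sum>k<length ?L. ?L ! k)" by simp
    finally show ?thesis by (simp add: sum_list_sum_nth atLeast0LessThan)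
  qed
  also have "\<bar>(real n - real M) / n - (1 - G / n)\<bar> = \<bar>real M - G\<bar> / n"
  proof -
    have "(real n - real M) / n - (1 - G / n) = (real G - real M) / n" using n0 by (simp add: field_simps)
    then show ?thesis using n0 by (simp add: abs_minus_commute abs_divide)
  qed
  also have "\<bar>r 0 / n - G / n\<bar> = (r 0 - G) / n"
    using G n0 by (simp add: r_def diff_divide_distrib[symmetric])
  also have "r 0 \<le> sum_list ?L"
    unfolding r_def ranked_burnt_size_def by (auto intro: member_le_sum_list)
  then have "G \<le> real M" using G s unfolding r_def by linarith
  then have "\<bar>real M - G\<bar> / n + (r 0 - G) / n + (real (sum_list ?L) - r 0) / n
      = (real M - 2 * G + sum_list ?L) / n" by (simp add: add_divide_distrib diff_divide_distrib)
  also have "\<dots> \<le> 2 * (real M - G) / n"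
    using s n0 by (intro divide_right_mono) auto
  finally show ?thesis .
qed

lemma first_root_fire:
  assumes "\<not> no_root_fire E xs"
  defines "\<tau> \<equiv> LEAST k. k < length xs \<and> root_fire E xs k"
  shows "\<tau> < length xs" "root_fire E xs \<tau>" "no_root_fire E (take \<tau> xs)"
    and "\<And>k. k < length xs \<Longrightarrow> root_fire E xs k \<Longrightarrow> \<tau> \<le> k"
    and "root_fire_mass E xs = card (component (pending E (take \<tau> xs)) 1)"
proof -
  have ex: "\<exists>k. k < length xs \<and> root_fire E xs k" using assms by (auto simp: no_root_fire_def)
  from LeastI_ex[OF ex] show a: "\<tau> < length xs" "root_fire E xs \<tau>" by (auto simp: \<tau>_def)
  show le: "\<tau> \<le> k" if "k < length xs" "root_fire E xs k" for k
    unfolding \<tau>_def by (rule Least_le) (use that in simp)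
  show "no_root_fire E (take \<tau> xs)" 
  proof -
    have "\<not> root_fire E xs j" if "j < \<tau>" for j using le[of j] that a(1) by auto
    then show ?thesis using a(1) by (subst no_root_fire_take) auto
  qed
  show "root_fire_mass E xs = card (component (pending E (take \<tau> xs)) 1)"
    using assms by (simp add: root_fire_mass_def)
qed

lemma sum_list_burnt_sizes:
  assumes "finite (\<Union>(burnt_subtrees {1..n} S))"
  shows "sum_list (burnt_sizes n S) \<le> card (\<Union>(burnt_subtrees {1..n} S))"
proof -
  let ?BS = "burnt_subtrees {1..n} S"
  have fBS: "finite ?BS" by (simp add: burnt_subtrees_def graph_components_def)
  have dis: "C \<inter> C' = {}" if C: "C \<in> ?BS" "C' \<in> ?BS" "C \<noteq> C'" for C C'
  proof -
    obtain u v where "C = component (final_forest {1..n} S) u" "C' = component (final_forest {1..n} S) v"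
      using C by (auto simp: burnt_subtrees_def graph_components_def component_def Image_def)
    then show ?thesis using C(3) component_eq[of _ "final_forest {1..n} S" u] component_eq[of _ "final_forest {1..n} S" v]
      by (metis disjoint_iff)
  qed
  have "sum_list (burnt_sizes n S) = sum_mset (image_mset card (mset_set ?BS))"
    unfolding burnt_sizes_def by (simp only: sum_mset_sum_list[symmetric] mset_rev mset_sorted_list_of_multiset)
  also have "\<dots> = (\<Sum>C\<in>?BS. card C)" by (simp add: sum_unfold_sum_mset)
  also have "\<dots> = card (\<Union>?BS)"
    using dis assms fBS by (intro card_Union_disjoint[symmetric])
      (auto simp: pairwise_def disjnt_def intro: finite_subset[OF Union_upper])
  finally show ?thesis by simp
qed

lemma card_le_ranked_burnt_size:
  assumes "C \<in> burnt_subtrees {1..n} S" shows "card C \<le> ranked_burnt_size n S 0"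
proof -
  let ?L = "burnt_sizes n S"
  let ?M = "image_mset card (mset_set (burnt_subtrees {1..n} S))"
  have fBS: "finite (burnt_subtrees {1..n} S)" by (simp add: burnt_subtrees_def graph_components_def)
  then have C: "card C \<in> set ?L" using assms by (simp add: burnt_sizes_def)
  have "sorted (rev ?L)" unfolding burnt_sizes_def rev_rev_ident by (rule sorted_sorted_list_of_multiset)
  then have "sorted_wrt (\<ge>) ?L" by (simp add: sorted_wrt_rev)
  then have "x \<le> ?L ! 0" if "x \<in> set ?L" for x
    using that by (cases ?L) auto
  then show ?thesis using C by (auto simp: ranked_burnt_size_def)
qed

context recursive_tree
begin

text \<open>Once all edges have been considered, each is burnt or fireproof, so the burnt vertices
  are those on an edge of \<open>B\<close>. In the final forest a burnt vertex keeps only burnt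
  edges, so the subtree of a burnt root consists of burnt vertices, and it contains
  \<open>component B 1\<close>.\<close>

lemma
  assumes v: "valid xs" and full: "fst ` set xs = E" and r: "run E xs = (B, F)"
  shows num_fireproof_run: "num_fireproof n (run E xs) = n - card (\<Union>B)"
    and Union_burnt_subset: "\<Union>B \<subseteq> {1..n}"
    and sum_list_burnt_sizes_run: "sum_list (burnt_sizes n (run E xs)) \<le> card (\<Union>B)"
    and root_comp_le_ranked: "1 \<in> \<Union>B \<Longrightarrow> card (component B 1) \<le> ranked_burnt_size n (run E xs) 0"
proof -
  have inv: "F \<inter> B = {}" "B \<subseteq> E" "E = B \<union> F"
    using run_invariant[of xs E B F] v full r by (auto simp: valid_def)
  show BV: "\<Union>B \<subseteq> {1..n}" using inv(2) edge(1) by blast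
  have fp: "fireproof_vertices {1..n} (B, F) = {1..n} - \<Union>B" using inv by auto
  show "num_fireproof n (run E xs) = n - card (\<Union>B)"
    unfolding num_fireproof_def r fp using BV by (subst card_Diff_subset) (auto intro: finite_subset)
  have bv: "burnt_vertices {1..n} (B, F) = \<Union>B" using BV unfolding burnt_vertices_def fp by blast
  let ?FF = "final_forest {1..n} (B, F)"
  have FF: "?FF = B \<union> {e \<in> F. e \<inter> \<Union>B = {}}" unfolding final_forest.simps bv using inv(1) by blast
  have sub: "\<Union>(burnt_subtrees {1..n} (B, F)) \<subseteq> \<Union>B" unfolding burnt_subtrees_def bv by blast
  have fB: "finite (\<Union>B)" using BV by (rule finite_subset) simp
  have "finite (\<Union>(burnt_subtrees {1..n} (B, F)))" using sub fB by (rule finite_subset)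
  from sum_list_burnt_sizes[OF this] show "sum_list (burnt_sizes n (run E xs)) \<le> card (\<Union>B)"
    using card_mono[OF fB sub] r by simp
  assume one: "1 \<in> \<Union>B"
  have "v \<in> \<Union>B" if "conn ?FF 1 v" for v
    using that
  proof (induction rule: rtrancl_induct)
    case (step y z)
    have "{y, z} \<in> ?FF" using step.hyps by (simp add: adj_def)
    then have "{y, z} \<in> B" using step.IH unfolding FF by blast
    then show ?case by blast
  qed (rule one)
  then have cB: "component ?FF 1 \<subseteq> \<Union>B" by (auto simp: component_def)
  have "component ?FF 1 = (adj ?FF)\<^sup>* `` {1}" by (auto simp: component_def)
  then have "component ?FF 1 \<in> graph_components {1..n} ?FF" unfolding graph_components_def using n by auto
  then have "component ?FF 1 \<in> burnt_subtrees {1..n} (B, F)" 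
    using cB unfolding burnt_subtrees_def bv by blast
  from card_le_ranked_burnt_size[OF this] have "card (component ?FF 1) \<le> ranked_burnt_size n (run E xs) 0"
    unfolding r .
  moreover have "card (component B 1) \<le> card (component ?FF 1)"
    by (intro card_mono component_mono finite_subset[OF cB fB]) (unfold FF, blast)
  ultimately show "card (component B 1) \<le> ranked_burnt_size n (run E xs) 0" by simp
qed

lemma small_fires_subset:
  assumes "valid xs" shows "small_fires E xs \<subseteq> {1..n}" "all_fires E xs \<subseteq> {1..n}"
proof -
  have "edge_component (pending E (take k xs)) (fst (xs ! k)) \<subseteq> {1..n}" if "k < length xs" for k
  proof -
    have "fst (xs ! k) \<in> E" using assms that by (force simp: valid_def)
    then show ?thesis using edge_component_subset[OF pending_subset] by blast
  qed
  then show "small_fires E xs \<subseteq> {1..n}" "all_fires E xs \<subseteq> {1..n}"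
    unfolding small_fires_def small_fire_def all_fires_def by (auto split: if_splits)
qed

lemma card_Union_burnt_all_fires:
  assumes v: "valid xs" and r: "run E xs = (B, F)"
  shows "card (\<Union>B) \<le> card (all_fires E xs)"
proof (rule card_mono)
  show "finite (all_fires E xs)" using small_fires_subset(2)[OF v] finite_subset by blast
  have "component (pending E (take k xs)) 1 \<subseteq> all_fires E xs" if k: "k < length xs" and f: "root_fire E xs k" for k
  proof
    fix u assume "u \<in> component (pending E (take k xs)) 1"
    then have "u \<in> edge_component (pending E (take k xs)) (fst (xs ! k))"
      using f component_eq[of u "pending E (take k xs)" 1] by (auto simp: root_fire_def root_cut_def edge_component_def)
    then show "u \<in> all_fires E xs" using k f unfolding all_fires_def root_fire_def by auto
  qed
  from burnt_subset[OF v r this] have "\<Union>B \<subseteq> all_fires E xs \<union> small_fires E xs" by blast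
  also have "small_fires E xs \<subseteq> all_fires E xs"
    unfolding small_fires_def all_fires_def small_fire_def by (auto split: if_splits)
  finally show "\<Union>B \<subseteq> all_fires E xs" by blast
qed

lemma card_Union_burnt_bounds:
  assumes v: "valid xs" and full: "fst ` set xs = E" and r: "run E xs = (B, F)"
  shows "card (\<Union>B) \<le> root_fire_mass E xs + card (small_fires E xs)"
    and "root_fire_mass E xs \<le> ranked_burnt_size n (run E xs) 0"
    and "root_fire_mass E xs \<le> card (\<Union>B)"
proof -
  have fS: "finite (small_fires E xs)" using small_fires_subset(1)[OF v] finite_subset by blast
  have fB: "finite (\<Union>B)" using Union_burnt_subset[OF assms] by (rule finite_subset) simp
  have "card (\<Union>B) \<le> root_fire_mass E xs + card (small_fires E xs) \<and>
    root_fire_mass E xs \<le> ranked_burnt_size n (run E xs) 0 \<and> root_fire_mass E xs \<le> card (\<Union>B)"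
  proof (cases "no_root_fire E xs")
    case True
    then have "\<Union>B \<subseteq> {} \<union> small_fires E xs"
      by (intro burnt_subset[OF v r]) (auto simp: no_root_fire_def)
    then show ?thesis using True card_mono[OF fS] by (simp add: root_fire_mass_def)
  next
    case False
    define \<tau> where "\<tau> = (LEAST k. k < length xs \<and> root_fire E xs k)"
    note \<tau> = first_root_fire[OF False, folded \<tau>_def]
    let ?C = "component (pending E (take \<tau> xs)) 1"
    have "component (pending E (take k xs)) 1 \<subseteq> ?C" if "k < length xs" "root_fire E xs k" for k
      by (rule component_mono[OF pending_take_antimono[OF \<tau>(4)[OF that]]])
    from burnt_subset[OF v r this] have sub: "\<Union>B \<subseteq> ?C \<union> small_fires E xs" .
    have fC: "finite ?C" by (rule finite_component[OF pending_subset]) (use n in simp)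
    have "card (\<Union>B) \<le> card (?C \<union> small_fires E xs)" using sub fC fS by (intro card_mono) auto
    also have "\<dots> \<le> card ?C + card (small_fires E xs)" by (rule card_Un_le)
    finally have 1: "card (\<Union>B) \<le> card ?C + card (small_fires E xs)" .
    note b = root_fire_burns[OF v \<tau>(1,2,3) r]
    have "component B 1 \<subseteq> \<Union>B"
    proof
      fix u assume "u \<in> component B 1"
      then show "u \<in> \<Union>B" using b(2) conn_in_Union[of 1 u B] by (cases "u = 1") (auto simp: component_def)
    qed
    then have fcB: "finite (component B 1)" "card (component B 1) \<le> card (\<Union>B)"
      using fB by (auto intro: finite_subset card_mono)
    have "card ?C \<le> card (component B 1)" using b(1) fcB(1) by (rule card_mono[rotated])
    then show ?thesis using 1 \<tau>(5) fcB(2) root_comp_le_ranked[OF assms b(2)] by simp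
  qed
  then show "card (\<Union>B) \<le> root_fire_mass E xs + card (small_fires E xs)"
    and "root_fire_mass E xs \<le> ranked_burnt_size n (run E xs) 0"
    and "root_fire_mass E xs \<le> card (\<Union>B)" by simp_all
qed

text \<open>From here on one number governs the whole sequence: apart from the small fires,
  everything that burns does so in the first root fire. It remains to bound the small fires and to
  find the law of this number.\<close>

theorem l1_dist_run:
  assumes v: "valid xs" and full: "fst ` set xs = E"
  shows "l1_dist (rescaled_sizes n (run E xs)) (limit_vector (real (root_fire_mass E xs) / n))
    \<le> 2 * card (small_fires E xs) / n"
proof -
  obtain B F where r: "run E xs = (B, F)" by (cases "run E xs")
  note b = card_Union_burnt_bounds[OF v full r]
  have M: "card (\<Union>B) \<le> n" using card_mono[OF _ Union_burnt_subset[OF v full r]] by simp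
  have "l1_dist (rescaled_sizes n (run E xs)) (limit_vector (real (root_fire_mass E xs) / n))
    \<le> 2 * (real (card (\<Union>B)) - root_fire_mass E xs) / n"
    by (rule l1_dist_rescaled_sizes[OF n num_fireproof_run[OF v full r] M sum_list_burnt_sizes_run[OF v full r]])
      (use b(2) in simp)
  also have "\<dots> \<le> 2 * card (small_fires E xs) / n"
    using b(1) by (intro divide_right_mono) auto
  finally show ?thesis .
qed

lemma num_fireproof_le:
  assumes v: "valid xs" and full: "fst ` set xs = E"
  shows "real (num_fireproof n (run E xs)) \<le> n - real (root_fire_mass E xs)"
    and "real (num_fireproof n (run E xs)) \<ge> n - real (card (all_fires E xs))"
    and "num_fireproof n (run E xs) \<le> n"
proof -
  obtain B F where r: "run E xs = (B, F)" by (cases "run E xs")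
  have M: "card (\<Union>B) \<le> n" using card_mono[OF _ Union_burnt_subset[OF v full r]] by simp
  then have "real (num_fireproof n (run E xs)) = n - real (card (\<Union>B))"
    using num_fireproof_run[OF v full r] by simp
  then show "real (num_fireproof n (run E xs)) \<le> n - real (root_fire_mass E xs)"
    and "real (num_fireproof n (run E xs)) \<ge> n - real (card (all_fires E xs))"
    using card_Union_burnt_bounds(3)[OF v full r] card_Union_burnt_all_fires[OF v r] by auto
  show "num_fireproof n (run E xs) \<le> n"
    using num_fireproof_run[OF v full r] by simp
qed

end

section \<open>The random order with marks\<close>

text \<open>Stopping after \<open>k\<close> draws gives the law of the first \<open>k\<close> steps,
  on which the one-step expectations are conditioned.\<close>

primrec order_pmf :: "real \<Rightarrow> 'e set \<Rightarrow> nat \<Rightarrow> ('e \<times> bool) list pmf" where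
  "order_pmf p A 0 = return_pmf []"
| "order_pmf p A (Suc k) = bind_pmf (pmf_of_set A) (\<lambda>e. bind_pmf (bernoulli_pmf p) (\<lambda>b.
     map_pmf (Cons (e, b)) (order_pmf p (A - {e}) k)))"

text \<open>The definition adds steps in front, which suits the comparison with random permutations;
  conditioning on the past requires the new step at the end.\<close>

lemma order_pmf_snoc:
  "order_pmf p A (Suc k) = bind_pmf (order_pmf p A k) (\<lambda>xs. bind_pmf (pmf_of_set (A - fst ` set xs)) (\<lambda>e.
     bind_pmf (bernoulli_pmf p) (\<lambda>b. return_pmf (xs @ [(e, b)]))))"
proof (induction k arbitrary: A)
  case 0
  show ?case by (simp add: bind_return_pmf)
next
  case (Suc k)
  have "order_pmf p A (Suc (Suc k)) = bind_pmf (pmf_of_set A) (\<lambda>e. bind_pmf (bernoulli_pmf p) (\<lambda>b.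
     map_pmf (Cons (e, b)) (order_pmf p (A - {e}) (Suc k))))" by (rule order_pmf.simps(2))
  also have "\<dots> = bind_pmf (pmf_of_set A) (\<lambda>e. bind_pmf (bernoulli_pmf p) (\<lambda>b.
      bind_pmf (order_pmf p (A - {e}) k) (\<lambda>xs. bind_pmf (pmf_of_set (A - fst ` set ((e, b) # xs))) (\<lambda>e'.
        bind_pmf (bernoulli_pmf p) (\<lambda>b'. return_pmf (((e, b) # xs) @ [(e', b')]))))))"
    unfolding Suc.IH by (simp add: map_bind_pmf Diff_insert2 [symmetric])
  also have "\<dots> = bind_pmf (order_pmf p A (Suc k)) (\<lambda>xs. bind_pmf (pmf_of_set (A - fst ` set xs)) (\<lambda>e.
     bind_pmf (bernoulli_pmf p) (\<lambda>b. return_pmf (xs @ [(e, b)]))))"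
    by (simp only: order_pmf.simps(2) bind_assoc_pmf map_pmf_def bind_return_pmf)
  finally show ?case .
qed

lemma set_order_pmf:
  assumes "finite A" "k \<le> card A" "xs \<in> set_pmf (order_pmf p A k)"
  shows "length xs = k \<and> distinct (map fst xs) \<and> fst ` set xs \<subseteq> A"
  using assms
proof (induction k arbitrary: A xs)
  case (Suc k)
  have "A \<noteq> {}" using Suc.prems by auto
  then obtain e b ys where *: "e \<in> A" "ys \<in> set_pmf (order_pmf p (A - {e}) k)" "xs = (e, b) # ys"
    using Suc.prems by auto
  have "length ys = k \<and> distinct (map fst ys) \<and> fst ` set ys \<subseteq> A - {e}"
    by (rule Suc.IH) (use * Suc.prems in auto)
  then show ?case using * by auto
qed simp

lemma finite_set_order_pmf:
  assumes "finite A" "k \<le> card A" shows "finite (set_pmf (order_pmf p A k))"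
proof (rule finite_subset)
  show "set_pmf (order_pmf p A k) \<subseteq> {xs. set xs \<subseteq> A \<times> UNIV \<and> length xs = k}"
    using set_order_pmf[OF assms] by fastforce
  show "finite {xs :: ('a \<times> bool) list. set xs \<subseteq> A \<times> UNIV \<and> length xs = k}"
    using assms by (intro finite_lists_length_eq) auto
qed

lemma map_take_order_pmf:
  assumes "finite A" "k \<le> l" "l \<le> card A"
  shows "map_pmf (take k) (order_pmf p A l) = order_pmf p A k"
  using assms(2,3)
proof (induction l rule: dec_induct)
  case base
  have "map_pmf (take k) (order_pmf p A k) = map_pmf id (order_pmf p A k)"
    by (rule map_pmf_cong) (use set_order_pmf[OF assms(1)] base in auto)
  then show ?case by simp
next
  case (step l)
  have "map_pmf (take k) (order_pmf p A (Suc l)) = bind_pmf (order_pmf p A l) (\<lambda>xs. bind_pmf (pmf_of_set (A - fst ` set xs)) (\<lambda>e.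
     bind_pmf (bernoulli_pmf p) (\<lambda>b. return_pmf (take k (xs @ [(e, b)])))))"
    unfolding order_pmf_snoc map_bind_pmf map_return_pmf ..
  also have "\<dots> = bind_pmf (order_pmf p A l) (\<lambda>xs. return_pmf (take k xs))"
  proof (rule bind_pmf_cong[OF refl])
    fix xs assume "xs \<in> set_pmf (order_pmf p A l)"
    then have "length xs = l" using set_order_pmf[OF assms(1)] step by auto
    then show "bind_pmf (pmf_of_set (A - fst ` set xs)) (\<lambda>e.
     bind_pmf (bernoulli_pmf p) (\<lambda>b. return_pmf (take k (xs @ [(e, b)])))) = return_pmf (take k xs)"
      using step by simp
  qed
  also have "\<dots> = map_pmf (take k) (order_pmf p A l)" by (simp add: map_pmf_def)
  also have "\<dots> = order_pmf p A k" using step by simp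
  finally show ?case .
qed

text \<open>Tossing a coin also for a skipped edge does not change the law, since
  \<open>step\<close> ignores it.\<close>

lemma fire_dynamics_Cons:
  "fire_dynamics p E (e # es) S = bind_pmf (bernoulli_pmf p) (\<lambda>b. fire_dynamics p E es (step E S (e, b)))"
  by (cases S) (auto intro!: bind_pmf_cong)

lemma fire_dynamics_marked_order:
  assumes "finite A"
  shows "bind_pmf (pmf_of_set (permutations_of_set A)) (\<lambda>es. fire_dynamics p E es S)
    = map_pmf (foldl (step E) S) (order_pmf p A (card A))"
  using assms
proof (induction "card A" arbitrary: A S)
  case 0
  then have "A = {}" by simp
  then show ?case by (cases S) (simp add: pmf_of_set_singleton bind_return_pmf)
next
  case (Suc k)
  then have A: "A \<noteq> {}" "finite A" by auto
  have "bind_pmf (pmf_of_set (permutations_of_set A)) (\<lambda>es. fire_dynamics p E es S)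
    = bind_pmf (pmf_of_set A) (\<lambda>e. bind_pmf (pmf_of_set (permutations_of_set (A - {e}))) (\<lambda>es.
        bind_pmf (bernoulli_pmf p) (\<lambda>b. fire_dynamics p E es (step E S (e, b)))))"
    unfolding random_permutation_of_set[OF A(2,1)]
    by (simp add: bind_assoc_pmf bind_return_pmf fire_dynamics_Cons del: fire_dynamics.simps)
  also have "\<dots> = bind_pmf (pmf_of_set A) (\<lambda>e. bind_pmf (bernoulli_pmf p) (\<lambda>b.
     map_pmf (foldl (step E) (step E S (e, b))) (order_pmf p (A - {e}) k)))"
  proof (rule bind_pmf_cong[OF refl])
    fix e assume "e \<in> set_pmf (pmf_of_set A)"
    then have e: "e \<in> A" using A by simp
    then have k: "k = card (A - {e})" "finite (A - {e})" using Suc.hyps(2) A by auto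
    show "bind_pmf (pmf_of_set (permutations_of_set (A - {e}))) (\<lambda>es.
        bind_pmf (bernoulli_pmf p) (\<lambda>b. fire_dynamics p E es (step E S (e, b)))) =
      bind_pmf (bernoulli_pmf p) (\<lambda>b. map_pmf (foldl (step E) (step E S (e, b))) (order_pmf p (A - {e}) k))"
      \<comment> \<open>The order of the remaining edges is drawn before the coin of
        \<open>e\<close> in the dynamics, but after it in \<open>order_pmf\<close>; the two draws
        are independent.\<close>
      unfolding bind_commute_pmf[of _ "bernoulli_pmf p"]
      using Suc.hyps(1)[OF k] by (simp add: k(1)[symmetric])
  qed
  also have "\<dots> = map_pmf (foldl (step E) S) (order_pmf p A (Suc k))"
    by (simp add: map_bind_pmf pmf.map_comp o_def)
  finally show ?case using Suc.hyps(2) by simp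
qed

section \<open>Expectations over marked orders and the probability of sparing a set of edges\<close>

abbreviation marked_mean :: "real \<Rightarrow> 'e set \<Rightarrow> nat \<Rightarrow> (('e \<times> bool) list \<Rightarrow> real) \<Rightarrow> real" where
  "marked_mean p A k h \<equiv> measure_pmf.expectation (order_pmf p A k) h"

lemma expectation_bind_finite:
  fixes h :: "'b \<Rightarrow> real"
  assumes "finite (set_pmf M)" "\<And>x. x \<in> set_pmf M \<Longrightarrow> finite (set_pmf (f x))"
  shows "measure_pmf.expectation (bind_pmf M f) h = measure_pmf.expectation M (\<lambda>x. measure_pmf.expectation (f x) h)"
  using assms by (subst pmf_expectation_bind[of "set_pmf M"], simp_all)
    (subst integral_measure_pmf[of "set_pmf M"], simp_all)

lemma expectation_mono_finite:
  fixes f g :: "'b \<Rightarrow> real"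
  assumes "finite (set_pmf M)" "\<And>x. x \<in> set_pmf M \<Longrightarrow> f x \<le> g x"
  shows "measure_pmf.expectation M f \<le> measure_pmf.expectation M g"
  by (intro integral_mono_AE integrable_measure_pmf_finite assms(1)) (use assms(2) in \<open>simp add: AE_measure_pmf_iff\<close>)

lemma expectation_cong:
  fixes f g :: "'b \<Rightarrow> real"
  assumes "\<And>x. x \<in> set_pmf M \<Longrightarrow> f x = g x"
  shows "measure_pmf.expectation M f = measure_pmf.expectation M g"
  by (intro integral_cong_AE) (use assms in \<open>auto simp: AE_measure_pmf_iff\<close>)

locale marked_order =
  fixes p :: real and A :: "'e set"
  assumes p: "0 \<le> p" "p \<le> 1" and fin: "finite A"
begin

lemma integrable_marked_order: "k \<le> card A \<Longrightarrow> integrable (order_pmf p A k) (h :: _ \<Rightarrow> real)"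
  by (intro integrable_measure_pmf_finite finite_set_order_pmf fin)

lemma marked_mean_mono:
  "k \<le> card A \<Longrightarrow> (\<And>xs. xs \<in> set_pmf (order_pmf p A k) \<Longrightarrow> f xs \<le> g xs) \<Longrightarrow> marked_mean p A k f \<le> marked_mean p A k g"
  by (intro expectation_mono_finite finite_set_order_pmf fin)

lemma marked_mean_sum: "k \<le> card A \<Longrightarrow> marked_mean p A k (\<lambda>xs. \<Sum>i\<in>I. f i xs) = (\<Sum>i\<in>I. marked_mean p A k (f i))"
  by (intro Bochner_Integration.integral_sum integrable_marked_order)

lemma marked_mean_take: "k \<le> l \<Longrightarrow> l \<le> card A \<Longrightarrow> marked_mean p A l (\<lambda>xs. h (take k xs)) = marked_mean p A k h"
  using map_take_order_pmf[OF fin, of k l p] integral_map_pmf[of "take k" "order_pmf p A l" h] by simp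

lemma marked_mean_Suc:
  assumes k: "k < card A"
  shows "marked_mean p A (Suc k) h = marked_mean p A k (\<lambda>xs.
    (\<Sum>e\<in>A - fst ` set xs. p * h (xs @ [(e, True)]) + (1 - p) * h (xs @ [(e, False)])) / real (card A - k))"
proof -
  have ne: "A - fst ` set xs \<noteq> {}" and c: "card (A - fst ` set xs) = card A - k"
    if "xs \<in> set_pmf (order_pmf p A k)" for xs
  proof -
    have x: "length xs = k" "distinct (map fst xs)" "fst ` set xs \<subseteq> A"
      using set_order_pmf[OF fin _ that] k by auto
    have "card (fst ` set xs) = k" using distinct_card[OF x(2)] x(1) by simp
    then show "card (A - fst ` set xs) = card A - k" using x(3) by (simp add: card_Diff_subset)
    then show "A - fst ` set xs \<noteq> {}" using k by (metis card.empty zero_less_diff less_irrefl)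
  qed
  have "marked_mean p A (Suc k) h = marked_mean p A k (\<lambda>xs. measure_pmf.expectation (bind_pmf (pmf_of_set (A - fst ` set xs)) (\<lambda>e.
     bind_pmf (bernoulli_pmf p) (\<lambda>b. return_pmf (xs @ [(e, b)])))) h)"
    unfolding order_pmf_snoc using k ne fin by (intro expectation_bind_finite finite_set_order_pmf) auto
  also have "\<dots> = marked_mean p A k (\<lambda>xs.
    (\<Sum>e\<in>A - fst ` set xs. p * h (xs @ [(e, True)]) + (1 - p) * h (xs @ [(e, False)])) / real (card A - k))"
  proof (rule expectation_cong)
    fix xs assume xs: "xs \<in> set_pmf (order_pmf p A k)"
    have "measure_pmf.expectation (bind_pmf (pmf_of_set (A - fst ` set xs)) (\<lambda>e.
      bind_pmf (bernoulli_pmf p) (\<lambda>b. return_pmf (xs @ [(e, b)])))) h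
      = measure_pmf.expectation (pmf_of_set (A - fst ` set xs)) (\<lambda>e.
        measure_pmf.expectation (bind_pmf (bernoulli_pmf p) (\<lambda>b. return_pmf (xs @ [(e, b)]))) h)"
      using ne[OF xs] fin by (intro expectation_bind_finite) auto
    also have "(\<lambda>e. measure_pmf.expectation (bind_pmf (bernoulli_pmf p) (\<lambda>b. return_pmf (xs @ [(e, b)]))) h)
      = (\<lambda>e. p * h (xs @ [(e, True)]) + (1 - p) * h (xs @ [(e, False)]))"
      using p by (simp add: map_pmf_def[symmetric] mult.commute)
    finally show "measure_pmf.expectation (bind_pmf (pmf_of_set (A - fst ` set xs)) (\<lambda>e.
      bind_pmf (bernoulli_pmf p) (\<lambda>b. return_pmf (xs @ [(e, b)])))) h =
      (\<Sum>e\<in>A - fst ` set xs. p * h (xs @ [(e, True)]) + (1 - p) * h (xs @ [(e, False)])) / real (card A - k)"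
      using ne[OF xs] fin c[OF xs] by (simp add: integral_pmf_of_set)
  qed
  finally show ?thesis .
qed

definition avoid :: "'e set \<Rightarrow> nat \<Rightarrow> real" where
  "avoid D k = marked_mean p A k (\<lambda>xs. of_bool (D \<inter> fst ` set xs = {}))"

lemma avoid_0: "avoid D 0 = 1"
  by (simp add: avoid_def)

text \<open>If the first \<open>k\<close> edges avoid \<open>D\<close>, the next one is uniform
  among \<open>card A - k\<close> edges that still include all of \<open>D\<close>.\<close>

lemma avoid_Suc:
  assumes k: "k < card A" and D: "D \<subseteq> A"
  shows "avoid D (Suc k) = avoid D k * (1 - real (card D) / real (card A - k))"
proof -
  have "avoid D (Suc k) = marked_mean p A k (\<lambda>xs. of_bool (D \<inter> fst ` set xs = {}) * (1 - real (card D) / real (card A - k)))"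
    unfolding avoid_def marked_mean_Suc[OF k]
  proof (rule expectation_cong)
    fix xs assume xs: "xs \<in> set_pmf (order_pmf p A k)"
    have x: "length xs = k" "distinct (map fst xs)" "fst ` set xs \<subseteq> A"
      using set_order_pmf[OF fin _ xs] k by auto
    have c: "card (fst ` set xs) = k" using distinct_card[OF x(2)] x(1) by simp
    let ?X = "fst ` set xs"
    have "(\<Sum>e\<in>A - ?X. p * of_bool (D \<inter> fst ` set (xs @ [(e, True)]) = {})
          + (1 - p) * of_bool (D \<inter> fst ` set (xs @ [(e, False)]) = {}))
        = (\<Sum>e\<in>A - ?X. of_bool (D \<inter> ?X = {} \<and> e \<notin> D))"
      by (rule sum.cong) (auto simp: algebra_simps)
    also have "\<dots> = of_bool (D \<inter> ?X = {}) * real (card A - k - card D)"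
    proof (cases "D \<inter> ?X = {}")
      case True
      have "card (A - ?X - D) = card A - k - card D"
        using True D x(3) c fin by (subst card_Diff_subset) (auto intro: finite_subset simp: card_Diff_subset)
      moreover have "(A - ?X) \<inter> {e. e \<notin> D} = A - ?X - D" by auto
      ultimately show ?thesis using True fin by (simp add: of_bool_def sum.If_cases)
    qed simp
    finally have s: "(\<Sum>e\<in>A - ?X. p * of_bool (D \<inter> fst ` set (xs @ [(e, True)]) = {})
          + (1 - p) * of_bool (D \<inter> fst ` set (xs @ [(e, False)]) = {}))
        = of_bool (D \<inter> ?X = {}) * real (card A - k - card D)" .
    \<comment> \<open>Makes the subtraction of natural numbers exact whenever the indicator is not
      zero.\<close>
    have "card D \<le> card A - k" if "D \<inter> ?X = {}"
    proof -
      have "D \<subseteq> A - ?X" using that D by blast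
      then have "card D \<le> card (A - ?X)" using fin by (intro card_mono) auto
      then show ?thesis using x(3) c by (simp add: card_Diff_subset)
    qed
    then show "(\<Sum>e\<in>A - ?X. p * of_bool (D \<inter> fst ` set (xs @ [(e, True)]) = {})
          + (1 - p) * of_bool (D \<inter> fst ` set (xs @ [(e, False)]) = {})) / real (card A - k)
        = of_bool (D \<inter> ?X = {}) * (1 - real (card D) / real (card A - k))"
    proof (cases "D \<inter> ?X = {}")
      case True
      then have "real (card A - k - card D) = real (card A - k) - real (card D)"
        using \<open>D \<inter> ?X = {} \<Longrightarrow> card D \<le> card A - k\<close> by (simp only: of_nat_diff)
      then show ?thesis unfolding s using k True
        by (simp add: field_simps)
    qed (simp add: s)
  qed
  then show ?thesis by (simp add: avoid_def)
qed

lemma avoid_nonneg: "avoid D k \<ge> 0"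
  by (simp add: avoid_def)

lemma Bernoulli_power: "0 \<le> x \<Longrightarrow> x \<le> 1 \<Longrightarrow> 1 - real d * x \<le> (1 - x) ^ d"
  using Bernoulli_inequality[of "- x" d] by simp

text \<open>Bernoulli's inequality replaces the factor for \<open>D\<close> by \<open>card D\<close>
  factors for single edges, and the product over the steps for a single edge telescopes to
  \<open>1 - k / card A\<close>.\<close>

lemma avoid_le:
  assumes D: "D \<subseteq> A" shows "k \<le> card A \<Longrightarrow> avoid D k \<le> (1 - real k / card A) ^ card D"
proof (induction k)
  case (Suc k)
  define m where "m = card A"
  define d where "d = card D"
  have k: "k < m" using Suc.prems by (simp add: m_def)
  have "avoid D (Suc k) = avoid D k * (1 - real d * (1 / real (m - k)))"
    using avoid_Suc[OF _ D, of k] k by (simp add: m_def d_def)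
  also have "\<dots> \<le> avoid D k * (1 - 1 / real (m - k)) ^ d"
    using k by (intro mult_left_mono Bernoulli_power avoid_nonneg) (auto simp: field_simps)
  also have "\<dots> \<le> (1 - real k / m) ^ d * (1 - 1 / real (m - k)) ^ d"
    using Suc k by (intro mult_right_mono zero_le_power) (auto simp: m_def d_def field_simps)
  also have "\<dots> = ((1 - real k / m) * (1 - 1 / real (m - k))) ^ d"
    by (simp add: power_mult_distrib)
  also have "(1 - real k / m) * (1 - 1 / real (m - k)) = 1 - real (Suc k) / m"
  proof -
    have "real m > 0" "real m - real k > 0" using k by auto
    then show ?thesis using k by (simp add: of_nat_diff field_simps)
  qed
  finally show ?case by (simp add: m_def d_def)
qed (simp add: avoid_0)

text \<open>After \<open>1 + s <= exp s\<close> this is a quadratic inequality in \<open>y\<close>,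
  valid exactly as long as \<open>y (1 + \<eta>) <= \<eta>\<close>.\<close>

lemma exp_neg_le:
  fixes y \<eta> :: real
  assumes "0 < \<eta>" "0 \<le> y" "y * (1 + \<eta>) \<le> \<eta>" shows "exp (- (1 + \<eta>) * y) \<le> 1 - y"
proof -
  have y1: "y < 1" using assms by (smt (verit) mult_less_cancel_right1 mult.commute mult_le_cancel_left1)
  have "1 + (1 + \<eta>) * y \<le> exp ((1 + \<eta>) * y)" by (rule exp_ge_add_one_self)
  moreover have "1 \<le> (1 - y) * (1 + (1 + \<eta>) * y)"
  proof -
    have "y * (y * (1 + \<eta>)) \<le> y * \<eta>" using assms by (intro mult_left_mono) auto
    then show ?thesis by (simp add: algebra_simps)
  qed
  ultimately have "1 \<le> (1 - y) * exp ((1 + \<eta>) * y)"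
    using y1 by (smt (verit) mult_left_mono)
  then have "1 / exp ((1 + \<eta>) * y) \<le> 1 - y" by (simp add: divide_le_eq)
  moreover have "exp (- (1 + \<eta>) * y) = 1 / exp ((1 + \<eta>) * y)"
    unfolding mult_minus_left exp_minus by (rule inverse_eq_divide)
  ultimately show ?thesis by simp
qed

text \<open>The correction is linear in \<open>card D\<close>, so its average over trees is the mean
  depth. When \<open>D\<close> is too large for \<open>exp_neg_le\<close>, the correction exceeds
  \<open>1\<close> and the bound is trivial.\<close>

lemma avoid_ge:
  assumes D: "D \<subseteq> A" and \<eta>: "0 < \<eta>" and k: "k < card A"
  defines "y \<equiv> real (card D) / real (card A - k)"
  shows "avoid D k \<ge> exp (- (1 + \<eta>) * k * y) - (1 + \<eta>) / \<eta> * y"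
proof (cases "y * (1 + \<eta>) \<le> \<eta>")
  case True
  have y0: "0 \<le> y" by (simp add: y_def)
  have "exp (- (1 + \<eta>) * y) ^ j \<le> avoid D j" if "j \<le> k" for j
    using that
  proof (induction j)
    case (Suc j)
    have "exp (- (1 + \<eta>) * y) ^ Suc j = exp (- (1 + \<eta>) * y) ^ j * exp (- (1 + \<eta>) * y)"
      by simp
    also have "\<dots> \<le> avoid D j * (1 - real (card D) / real (card A - j))"
    proof (intro mult_mono)
      show "exp (- (1 + \<eta>) * y) ^ j \<le> avoid D j" using Suc by simp
      have "real (card D) / real (card A - j) \<le> y"
        unfolding y_def using Suc.prems k by (intro divide_left_mono) auto
      then show "exp (- (1 + \<eta>) * y) \<le> 1 - real (card D) / real (card A - j)"
        by (intro order_trans[OF exp_neg_le[OF \<eta> y0 True]] diff_left_mono)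
    qed (auto simp: avoid_nonneg)
    also have "\<dots> = avoid D (Suc j)" using avoid_Suc[OF _ D, of j] Suc.prems k by simp
    finally show ?case .
  qed (simp add: avoid_0)
  from this[of k] have "exp (- (1 + \<eta>) * k * y) \<le> avoid D k"
    by (simp add: exp_of_nat_mult[symmetric] mult_ac)
  moreover have "(1 + \<eta>) / \<eta> * y \<ge> 0" using \<eta> y0 by simp
  ultimately show ?thesis by linarith
next
  case False
  have "0 \<le> (1 + \<eta>) * k * y" using \<eta> by (simp add: y_def)
  then have "exp (- (1 + \<eta>) * k * y) \<le> 1" unfolding mult_minus_left by simp
  moreover have "(1 + \<eta>) / \<eta> * y > 1" using False \<eta> by (simp add: field_simps)
  ultimately show ?thesis using avoid_nonneg[of D k] by linarith
qed

end

section \<open>Expectations on a fixed tree\<close>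

locale fire_tree = recursive_tree n E + marked_order p E for n E p
begin

definition m :: nat where "m = card E"

lemma m_eq: "m = n - 1"
  using card_recursive_tree[OF E n] by (simp add: m_def)

definition num_pairs :: "(nat set \<times> bool) list \<Rightarrow> real" where
  "num_pairs xs = (\<Sum>v\<in>{1..n}. real (card (component (pending E xs) v)))"

definition root_card :: "(nat set \<times> bool) list \<Rightarrow> real" where
  "root_card xs = real (card (component (pending E xs) 1))"

lemma valid_marked_order: "k \<le> m \<Longrightarrow> xs \<in> set_pmf (order_pmf p E k) \<Longrightarrow> valid xs \<and> length xs = k"
  using set_order_pmf[OF fin, of k xs] by (auto simp: valid_def m_def)

lemma full_marked_order: "xs \<in> set_pmf (order_pmf p E m) \<Longrightarrow> fst ` set xs = E"
proof -
  assume "xs \<in> set_pmf (order_pmf p E m)"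
  then have x: "length xs = card E" "distinct (map fst xs)" "fst ` set xs \<subseteq> E"
    using set_order_pmf[OF fin, of m xs] by (auto simp: m_def)
  then have "card (fst ` set xs) = card E" using distinct_card[OF x(2)] by simp
  then show ?thesis using x(3) fin card_subset_eq by metis
qed

lemma root_card_bounds: "1 \<le> root_card xs" "root_card xs \<le> n"
proof -
  have "component (pending E xs) 1 \<subseteq> {1..n}" by (rule component_subset[OF pending_subset]) (use n in simp)
  then have "card (component (pending E xs) 1) \<le> card {1..n}" by (intro card_mono) auto
  then show "root_card xs \<le> n" by (simp add: root_card_def)
  have "finite (component (pending E xs) 1)" by (rule finite_component[OF pending_subset]) (use n in simp)
  then have "card (component (pending E xs) 1) \<noteq> 0" using self_in_component by (metis card_0_eq empty_iff)
  then show "1 \<le> root_card xs" by (simp add: root_card_def)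
qed

lemma card_component_eq:
  assumes U: "U \<subseteq> E" and u: "u \<in> {1..n}"
  shows "real (card (component U u)) = (\<Sum>v\<in>{1..n}. of_bool (bridges E u v \<subseteq> U))"
proof -
  have "v \<in> component U u \<longleftrightarrow> v \<in> {1..n} \<and> bridges E u v \<subseteq> U" for v
    using component_subset[OF U u] bridges_subset_iff_conn[OF E n U u, of v]
    by (cases "v \<in> {1..n}") (auto simp: component_def simp del: atLeastAtMost_iff)
  then have "component U u = {v \<in> {1..n}. bridges E u v \<subseteq> U}" by blast
  then show ?thesis by (simp add: of_bool_def sum.If_cases Int_def)
qed

lemma bridges_subset_pending: "bridges E u v \<subseteq> pending E xs \<longleftrightarrow> bridges E u v \<inter> fst ` set xs = {}"
  using bridges_subset[of E u v] by (auto simp: pending_def)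

lemma num_pairs_eq: "num_pairs xs = (\<Sum>u\<in>{1..n}. \<Sum>v\<in>{1..n}. of_bool (bridges E u v \<inter> fst ` set xs = {}))"
  unfolding num_pairs_def by (rule sum.cong) (simp_all add: card_component_eq[OF pending_subset] bridges_subset_pending)

lemma root_card_eq: "root_card xs = (\<Sum>v\<in>{1..n}. of_bool (bridges E 1 v \<inter> fst ` set xs = {}))"
  unfolding root_card_def using card_component_eq[OF pending_subset, of 1 xs] n by (simp add: bridges_subset_pending)

lemma mean_num_pairs_eq: "k \<le> m \<Longrightarrow> marked_mean p E k num_pairs = (\<Sum>u\<in>{1..n}. \<Sum>v\<in>{1..n}. avoid (bridges E u v) k)"
  unfolding num_pairs_eq[abs_def] avoid_def m_def by (simp only: marked_mean_sum)

lemma mean_root_card_eq: "k \<le> m \<Longrightarrow> marked_mean p E k root_card = (\<Sum>v\<in>{1..n}. avoid (bridges E 1 v) k)"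
  unfolding root_card_eq[abs_def] avoid_def m_def by (simp only: marked_mean_sum)

lemma mean_num_pairs_le:
  assumes k: "k \<le> m"
  shows "marked_mean p E k num_pairs \<le> (\<Sum>u\<in>{1..n}. \<Sum>v\<in>{1..n}. (1 - real k / m) ^ card (bridges E u v))"
  unfolding mean_num_pairs_eq[OF k] using k unfolding m_def by (intro sum_mono avoid_le bridges_subset)

text \<open>The weight \<open>1 / (m - k)\<close> is large near the end of the order. Distinct
  vertices have distance at least one, so one factor \<open>(m - k) / m\<close> of the power cancels
  the weight; in the other factors \<open>1 - k / m\<close> is replaced by the larger
  \<open>q\<close>, which can be kept above \<open>1 / 2\<close>.\<close>

lemma mean_num_pairs_off_diagonal_le:
  assumes k: "k < m" and q: "1 - real k / m \<le> q" "0 < q"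
  shows "1 / real (m - k) * (marked_mean p E k num_pairs - n)
    \<le> 1 / real m * ((1 / q) * (\<Sum>u\<in>{1..n}. \<Sum>v\<in>{1..n}. q ^ card (bridges E u v)))"
proof -
  have m0: "real m > 0" using k by simp
  have mk: "real (m - k) > 0" using k by simp
  let ?x = "1 - real k / m"
  have x: "?x = real (m - k) / m" using k by (simp add: of_nat_diff field_simps)
  have x0: "?x > 0" using x m0 mk by simp
  have *: "1 / real (m - k) * avoid (bridges E u v) k \<le> 1 / real m * ((1 / q) * q ^ card (bridges E u v))"
    if uv: "u \<in> {1..n}" "v \<in> {1..n}" "u \<noteq> v" for u v
  proof -
    have "bridges E u v \<noteq> {}"
    proof
      assume "bridges E u v = {}"
      then have "conn {} u v" using bridges_subset_iff_conn[OF E n _ uv(1,2), of "{}"] by simp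
      then show False using uv(3) conn_in_Union by fastforce
    qed
    moreover have "finite (bridges E u v)" using finite_subset[OF bridges_subset fin] .
    ultimately obtain d where d: "card (bridges E u v) = Suc d"
      by (metis card_gt_0_iff gr0_implies_Suc)
    have "avoid (bridges E u v) k \<le> ?x ^ Suc d"
      using avoid_le[OF bridges_subset, of k u v] k d by (simp add: m_def)
    also have "\<dots> = ?x * ?x ^ d" by simp
    also have "\<dots> \<le> ?x * q ^ d" using q x0 by (intro mult_left_mono power_mono) auto
    finally have "1 / real (m - k) * avoid (bridges E u v) k \<le> 1 / real (m - k) * (?x * q ^ d)"
      using mk by (intro mult_left_mono) auto
    also have "\<dots> = 1 / real m * q ^ d" unfolding x using mk m0 by simp
    also have "q ^ d = 1 / q * q ^ Suc d" using q by simp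
    finally show ?thesis using d by simp
  qed
  have avself: "avoid {} k = 1" by (simp add: avoid_def)
  have "marked_mean p E k num_pairs - n = (\<Sum>u\<in>{1..n}. \<Sum>v\<in>{1..n} - {u}. avoid (bridges E u v) k)"
  proof -
    have "marked_mean p E k num_pairs = (\<Sum>u\<in>{1..n}. 1 + (\<Sum>v\<in>{1..n} - {u}. avoid (bridges E u v) k))"
      unfolding mean_num_pairs_eq[OF less_imp_le[OF k]]
      by (rule sum.cong) (simp_all add: sum.remove avself)
    then show ?thesis by (simp add: sum.distrib)
  qed
  then have "1 / real (m - k) * (marked_mean p E k num_pairs - n)
      = (\<Sum>u\<in>{1..n}. \<Sum>v\<in>{1..n} - {u}. 1 / real (m - k) * avoid (bridges E u v) k)"
    by (simp add: sum_distrib_left)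
  also have "\<dots> \<le> (\<Sum>u\<in>{1..n}. \<Sum>v\<in>{1..n} - {u}. 1 / real m * ((1 / q) * q ^ card (bridges E u v)))"
    by (intro sum_mono *) auto
  also have "\<dots> \<le> (\<Sum>u\<in>{1..n}. \<Sum>v\<in>{1..n}. 1 / real m * ((1 / q) * q ^ card (bridges E u v)))"
    using q by (intro sum_mono sum_mono2) auto
  finally show ?thesis by (simp add: sum_distrib_left)
qed

lemma mean_root_card_ge:
  assumes k: "k < m" and \<eta>: "0 < \<eta>"
  shows "marked_mean p E k root_card \<ge> (\<Sum>v\<in>{1..n}. exp (- ((1 + \<eta>) * k / real (m - k)) * card (bridges E 1 v))
      - (1 + \<eta>) / (\<eta> * real (m - k)) * card (bridges E 1 v))"
  unfolding mean_root_card_eq[OF less_imp_le[OF k]]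
proof (rule sum_mono)
  fix v assume "v \<in> {1..n}"
  let ?d = "real (card (bridges E 1 v))"
  have "exp (- ((1 + \<eta>) * k / real (m - k)) * ?d) - (1 + \<eta>) / (\<eta> * real (m - k)) * ?d
    = exp (- (1 + \<eta>) * k * (?d / real (card E - k))) - (1 + \<eta>) / \<eta> * (?d / real (card E - k))"
    unfolding m_def mult_minus_left by simp
  also have "\<dots> \<le> avoid (bridges E 1 v) k"
    using avoid_ge[OF bridges_subset \<eta>, of k 1 v] k by (simp add: m_def)
  finally show "exp (- ((1 + \<eta>) * k / real (m - k)) * ?d) - (1 + \<eta>) / (\<eta> * real (m - k)) * ?d
      \<le> avoid (bridges E 1 v) k" .
qed

text \<open>Given the first \<open>k\<close> steps, the next edge is uniform among the pending ones
  and marked with probability \<open>p\<close>, so the conditional mean is a sum of component sizes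
  over the pending edges outside the root component.\<close>

lemma marked_mean_small_fire:
  assumes k: "k < m"
  shows "marked_mean p E m (\<lambda>xs. real (card (small_fire E xs k))) \<le> p / real (m - k) * marked_mean p E k (\<lambda>xs. num_pairs xs - (root_card xs)\<^sup>2)"
proof -
  have "marked_mean p E m (\<lambda>xs. real (card (small_fire E xs k)))
      = marked_mean p E m (\<lambda>xs. real (card (small_fire E (take (Suc k) xs) k)))"
  proof (rule expectation_cong)
    fix xs assume "xs \<in> set_pmf (order_pmf p E m)"
    then have "length xs = m" using valid_marked_order by blast
    then show "real (card (small_fire E xs k)) = real (card (small_fire E (take (Suc k) xs) k))"
      using small_fire_append[of k "take (Suc k) xs" E "drop (Suc k) xs"] k by simp
  qed
  also have "\<dots> = marked_mean p E (Suc k) (\<lambda>xs. real (card (small_fire E xs k)))"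
    using k by (intro marked_mean_take) (auto simp: m_def)
  also have "\<dots> = marked_mean p E k (\<lambda>xs. (\<Sum>e\<in>E - fst ` set xs. p * real (card (small_fire E (xs @ [(e, True)]) k))
      + (1 - p) * real (card (small_fire E (xs @ [(e, False)]) k))) / real (m - k))"
    using k unfolding m_def by (rule marked_mean_Suc)
  also have "\<dots> \<le> marked_mean p E k (\<lambda>xs. p / real (m - k) * (num_pairs xs - (root_card xs)\<^sup>2))"
  proof (rule marked_mean_mono)
    show "k \<le> card E" using k by (simp add: m_def)
    fix xs assume xs: "xs \<in> set_pmf (order_pmf p E k)"
    then have l: "length xs = k" using valid_marked_order k by auto
    let ?U = "pending E xs"
    have sf: "small_fire E (xs @ [(e, b)]) k = (if b \<and> e \<inter> component ?U 1 = {} then edge_component ?U e else {})" for e b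
      unfolding small_fire_def root_cut_def l[symmetric] by simp
    have "(\<Sum>e\<in>?U. p * real (card (small_fire E (xs @ [(e, True)]) k))
      + (1 - p) * real (card (small_fire E (xs @ [(e, False)]) k)))
      = p * (\<Sum>e\<in>?U. if e \<inter> component ?U 1 = {} then real (card (edge_component ?U e)) else 0)"
      unfolding sf sum_distrib_left by (rule sum.cong) auto
    also have "(\<Sum>e\<in>?U. if e \<inter> component ?U 1 = {} then real (card (edge_component ?U e)) else 0)
        = (\<Sum>e\<in>{e \<in> ?U. e \<inter> component ?U 1 = {}}. real (card (edge_component ?U e)))"
      using finite_subset[OF pending_subset fin] by (simp add: sum.inter_filter)
    also have "\<dots> \<le> num_pairs xs - (root_card xs)\<^sup>2"
      unfolding num_pairs_def root_card_def by (rule sum_card_edge_component_nonroot[OF pending_subset])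
    finally have "(\<Sum>e\<in>?U. p * real (card (small_fire E (xs @ [(e, True)]) k))
      + (1 - p) * real (card (small_fire E (xs @ [(e, False)]) k))) \<le> p * (num_pairs xs - (root_card xs)\<^sup>2)"
      using p by (simp add: mult_left_mono)
    then show "(\<Sum>e\<in>E - fst ` set xs. p * real (card (small_fire E (xs @ [(e, True)]) k))
      + (1 - p) * real (card (small_fire E (xs @ [(e, False)]) k))) / real (m - k)
      \<le> p / real (m - k) * (num_pairs xs - (root_card xs)\<^sup>2)"
      by (simp add: pending_def divide_right_mono)
  qed
  also have "\<dots> = p / real (m - k) * marked_mean p E k (\<lambda>xs. num_pairs xs - (root_card xs)\<^sup>2)" by simp
  finally show ?thesis .
qed

definition fire_at :: "(nat set \<times> bool) list \<Rightarrow> nat \<Rightarrow> nat set" where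
  "fire_at xs k = (if snd (xs ! k) then edge_component (pending E (take k xs)) (fst (xs ! k)) else {})"

lemma marked_mean_fire_at:
  assumes k: "k < m"
  shows "marked_mean p E m (\<lambda>xs. real (card (fire_at xs k))) \<le> p / real (m - k) * (marked_mean p E k num_pairs - n)"
proof -
  have "marked_mean p E m (\<lambda>xs. real (card (fire_at xs k)))
      = marked_mean p E m (\<lambda>xs. real (card (fire_at (take (Suc k) xs) k)))"
    by (simp add: fire_at_def min_def cong: if_cong)
  also have "\<dots> = marked_mean p E (Suc k) (\<lambda>xs. real (card (fire_at xs k)))"
    using k by (intro marked_mean_take) (auto simp: m_def)
  also have "\<dots> = marked_mean p E k (\<lambda>xs. (\<Sum>e\<in>E - fst ` set xs. p * real (card (fire_at (xs @ [(e, True)]) k))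
      + (1 - p) * real (card (fire_at (xs @ [(e, False)]) k))) / real (m - k))"
    using k unfolding m_def by (rule marked_mean_Suc)
  also have "\<dots> \<le> marked_mean p E k (\<lambda>xs. p / real (m - k) * (num_pairs xs - n))"
  proof (rule marked_mean_mono)
    show "k \<le> card E" using k by (simp add: m_def)
    fix xs assume xs: "xs \<in> set_pmf (order_pmf p E k)"
    then have l: "length xs = k" using valid_marked_order k by auto
    let ?U = "pending E xs"
    have sf: "fire_at (xs @ [(e, b)]) k = (if b then edge_component ?U e else {})" for e b
      unfolding fire_at_def l[symmetric] by simp
    have "(\<Sum>e\<in>?U. p * real (card (fire_at (xs @ [(e, True)]) k))
      + (1 - p) * real (card (fire_at (xs @ [(e, False)]) k))) = p * (\<Sum>e\<in>?U. real (card (edge_component ?U e)))"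
      unfolding sf sum_distrib_left by (rule sum.cong) auto
    also have "\<dots> \<le> p * (num_pairs xs - n)"
      using mult_left_mono[OF sum_card_edge_component_all[OF pending_subset, of xs] p(1)]
      unfolding num_pairs_def by (simp add: sum_subtractf)
    finally show "(\<Sum>e\<in>E - fst ` set xs. p * real (card (fire_at (xs @ [(e, True)]) k))
      + (1 - p) * real (card (fire_at (xs @ [(e, False)]) k))) / real (m - k)
      \<le> p / real (m - k) * (num_pairs xs - n)"
      by (simp add: pending_def divide_right_mono)
  qed
  also have "\<dots> = p / real (m - k) * (marked_mean p E k num_pairs - n)"
    using integrable_marked_order[of k num_pairs] k by (simp add: m_def)
  finally show ?thesis .
qed

lemma marked_mean_small_fires_le:
  "marked_mean p E m (\<lambda>xs. real (card (small_fires E xs))) \<le> (\<Sum>k<m. marked_mean p E m (\<lambda>xs. real (card (small_fire E xs k))))"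
proof -
  have "marked_mean p E m (\<lambda>xs. real (card (small_fires E xs))) \<le> marked_mean p E m (\<lambda>xs. \<Sum>k<m. real (card (small_fire E xs k)))"
  proof (rule marked_mean_mono)
    fix xs assume "xs \<in> set_pmf (order_pmf p E m)"
    then have "length xs = m" using valid_marked_order by blast
    then have "card (small_fires E xs) \<le> (\<Sum>k<m. card (small_fire E xs k))"
      unfolding small_fires_def by (simp add: card_UN_le)
    then show "real (card (small_fires E xs)) \<le> (\<Sum>k<m. real (card (small_fire E xs k)))"
      unfolding of_nat_sum[symmetric] by (rule of_nat_mono)
  qed (simp add: m_def)
  then show ?thesis by (simp add: integrable_marked_order m_def)
qed

lemma marked_mean_all_fires_le:
  "marked_mean p E m (\<lambda>xs. real (card (all_fires E xs))) \<le> (\<Sum>k<m. marked_mean p E m (\<lambda>xs. real (card (fire_at xs k))))"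
proof -
  have "marked_mean p E m (\<lambda>xs. real (card (all_fires E xs))) \<le> marked_mean p E m (\<lambda>xs. \<Sum>k<m. real (card (fire_at xs k)))"
  proof (rule marked_mean_mono)
    fix xs assume "xs \<in> set_pmf (order_pmf p E m)"
    then have "length xs = m" using valid_marked_order by blast
    then have "card (all_fires E xs) \<le> (\<Sum>k<m. card (fire_at xs k))"
      unfolding all_fires_def fire_at_def[symmetric] by (simp add: card_UN_le)
    then show "real (card (all_fires E xs)) \<le> (\<Sum>k<m. real (card (fire_at xs k)))"
      unfolding of_nat_sum[symmetric] by (rule of_nat_mono)
  qed (simp add: m_def)
  then show ?thesis by (simp add: integrable_marked_order m_def)
qed

lemma small_fire_le_fire_at:
  "marked_mean p E m (\<lambda>xs. real (card (small_fire E xs k))) \<le> marked_mean p E m (\<lambda>xs. real (card (fire_at xs k)))"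
  if k: "k < m"
proof (rule marked_mean_mono)
  fix xs assume xs: "xs \<in> set_pmf (order_pmf p E m)"
  then have v: "valid xs" "length xs = m" using valid_marked_order by auto
  have "fst (xs ! k) \<in> E" using v k by (force simp: valid_def)
  then have "finite (edge_component (pending E (take k xs)) (fst (xs ! k)))"
    by (rule finite_subset[OF edge_component_subset[OF pending_subset]]) simp
  then show "real (card (small_fire E xs k)) \<le> real (card (fire_at xs k))"
    by (auto simp: small_fire_def fire_at_def)
qed (simp add: m_def)

definition survive :: "nat \<Rightarrow> real" where
  "survive k = marked_mean p E k (\<lambda>xs. of_bool (no_root_fire E xs))"

text \<open>The hazard is exact because \<open>root_card xs - 1\<close> of the \<open>m - k\<close>
  pending edges lie in the root component.\<close>

lemma survive_Suc:
  assumes k: "k < m"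
  shows "survive (Suc k) = survive k - p * marked_mean p E k (\<lambda>xs. of_bool (no_root_fire E xs) * ((root_card xs - 1) / real (m - k)))"
proof -
  have "survive (Suc k) = marked_mean p E k (\<lambda>xs. (\<Sum>e\<in>E - fst ` set xs. p * of_bool (no_root_fire E (xs @ [(e, True)]))
      + (1 - p) * of_bool (no_root_fire E (xs @ [(e, False)]))) / real (m - k))"
    unfolding survive_def using k unfolding m_def by (rule marked_mean_Suc)
  also have "\<dots> = marked_mean p E k (\<lambda>xs. of_bool (no_root_fire E xs)
      - p * (of_bool (no_root_fire E xs) * ((root_card xs - 1) / real (m - k))))"
  proof (rule expectation_cong)
    fix xs assume xs: "xs \<in> set_pmf (order_pmf p E k)"
    have l: "length xs = k" and v: "valid xs" using valid_marked_order[OF less_imp_le[OF k] xs] by auto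
    let ?U = "pending E xs"
    let ?I = "of_bool (no_root_fire E xs) :: real"
    have fU: "finite ?U" using finite_subset[OF pending_subset fin] .
    have "no_root_fire E (xs @ [(e, b)]) \<longleftrightarrow> no_root_fire E xs \<and> \<not> (b \<and> e \<inter> component ?U 1 \<noteq> {})" for e b
      unfolding no_root_fire_snoc root_fire_def root_cut_def by simp
    then have "(\<Sum>e\<in>?U. p * of_bool (no_root_fire E (xs @ [(e, True)]))
      + (1 - p) * of_bool (no_root_fire E (xs @ [(e, False)])))
      = (\<Sum>e\<in>?U. ?I - p * ?I * (if e \<inter> component ?U 1 \<noteq> {} then 1 else 0))"
      by (intro sum.cong) (auto simp: algebra_simps)
    also have "\<dots> = real (card ?U) * ?I - p * ?I * real (card {e \<in> ?U. e \<inter> component ?U 1 \<noteq> {}})"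
      using fU by (simp add: sum_subtractf sum_distrib_left[symmetric] sum.If_cases Int_def)
    also have "real (card {e \<in> ?U. e \<inter> component ?U 1 \<noteq> {}}) = root_card xs - 1"
      using card_edges_in_root_component[OF pending_subset, of xs] root_card_bounds(1)[of xs] by (simp add: root_card_def)
    also have "card ?U = m - k"
    proof -
      have "card (fst ` set xs) = k" using v l distinct_card[of "map fst xs"] by (simp add: valid_def)
      then show ?thesis using v by (simp add: pending_def m_def valid_def card_Diff_subset)
    qed
    finally have eq: "(\<Sum>e\<in>?U. p * of_bool (no_root_fire E (xs @ [(e, True)]))
      + (1 - p) * of_bool (no_root_fire E (xs @ [(e, False)])))
      = real (m - k) * ?I - p * ?I * (root_card xs - 1)" .
    have "(a * I - p * I * r) / a = I - p * (I * (r / a))" if "a > 0" for a I r :: real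
      using that by (simp add: field_simps)
    then show "(\<Sum>e\<in>E - fst ` set xs. p * of_bool (no_root_fire E (xs @ [(e, True)]))
      + (1 - p) * of_bool (no_root_fire E (xs @ [(e, False)]))) / real (m - k)
      = ?I - p * (?I * ((root_card xs - 1) / real (m - k)))"
      unfolding pending_def[symmetric] eq using k by simp
  qed
  also have "\<dots> = survive k - p * marked_mean p E k (\<lambda>xs. of_bool (no_root_fire E xs) * ((root_card xs - 1) / real (m - k)))"
    using k integrable_marked_order unfolding survive_def by (subst Bochner_Integration.integral_diff) (auto simp: m_def)
  finally show ?thesis .
qed

end

section \<open>Averages over recursive trees\<close>

abbreviation pairs :: "nat \<Rightarrow> nat set set \<Rightarrow> (nat set \<times> bool) list \<Rightarrow> real" where
  "pairs n E xs \<equiv> fire_tree.num_pairs n E xs"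

abbreviation root_size :: "nat set set \<Rightarrow> (nat set \<times> bool) list \<Rightarrow> real" where
  "root_size E xs \<equiv> fire_tree.root_card E xs"

definition mean :: "nat \<Rightarrow> real \<Rightarrow> nat \<Rightarrow> (nat set set \<Rightarrow> (nat set \<times> bool) list \<Rightarrow> real) \<Rightarrow> real" where
  "mean n p k h = rt_avg n (\<lambda>E. marked_mean p E k (h E))"

lemma fire_treeI: "E \<in> recursive_trees n \<Longrightarrow> n \<ge> 1 \<Longrightarrow> 0 \<le> p \<Longrightarrow> p \<le> 1 \<Longrightarrow> fire_tree n E p"
  by unfold_locales (auto simp: recursive_trees_finite)

text \<open>The predicted proportion of vertices in the root component at step
  \<open>k\<close>.\<close>

definition decay :: "nat \<Rightarrow> nat \<Rightarrow> real" where
  "decay n k = exp (- real k * ln n / n)"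

text \<open>Error terms for the steps \<open>k \<le> K n / ln n\<close>: \<open>root_loss\<close> bounds \<open>decay n k - E|root_card\<^sub>k| / n\<close>, by
  \<open>mean_root_size_ge\<close> with \<open>\<eta> = 1 / ln n\<close>, and \<open>pair_gain\<close> bounds the excess of the rescaled number
  of connected pairs over \<open>(decay n k)\<^sup>2\<close>, by \<open>pair_moment_le\<close>.\<close>

definition root_loss :: "real \<Rightarrow> nat \<Rightarrow> real" where
  "root_loss K n = K * n / ln n * ((ln n + 1) / (real n - 1 - K * n / ln n) - ln n / n)
     + ln n * (ln n + 1) / (real n - 1 - K * n / ln n)"

definition pair_gain :: "real \<Rightarrow> nat \<Rightarrow> real" where
  "pair_gain K n = (1 + 1 / n) * exp (8 * K / ln n) / (1 - 4 * K / ln n) - 1"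

text \<open>In the square expanded around \<open>decay n k\<close> the pairs enter once, and the
  root component enters with the factor \<open>2 * decay n k\<close>, which is at most
  \<open>2\<close>.\<close>

definition var_bound :: "real \<Rightarrow> nat \<Rightarrow> real" where
  "var_bound K n = pair_gain K n + 2 * root_loss K n"

text \<open>The first term bounds the mean deviation of the root component from its prediction, the
  second the cost of replacing \<open>(root_size - 1) / (n - 1 - k)\<close> by
  \<open>root_size / n\<close>.\<close>

definition hazard_error :: "real \<Rightarrow> nat \<Rightarrow> real" where
  "hazard_error K n = 2 * sqrt (var_bound K n) + ((real n + 1) / (real n - 1 - K * n / ln n) - 1)"

locale mean_field =
  fixes n :: nat and p :: real
  assumes n2: "n \<ge> 2" and p: "0 \<le> p" "p \<le> 1"
begin

abbreviation L :: real where "L \<equiv> ln (real n)"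

lemma L_pos: "L > 0" using n2 by simp

lemma n1: "n \<ge> 1" using n2 by simp

lemma tree: "E \<in> recursive_trees n \<Longrightarrow> fire_tree n E p"
  using fire_treeI n1 p by blast

lemma m_tree: "E \<in> recursive_trees n \<Longrightarrow> fire_tree.m E = n - 1"
  using fire_tree.m_eq[OF tree] .

lemma card_tree: "E \<in> recursive_trees n \<Longrightarrow> card E = n - 1"
  using card_recursive_tree n1 by blast

lemma integrable_tree:
  "E \<in> recursive_trees n \<Longrightarrow> k \<le> n - 1 \<Longrightarrow> integrable (order_pmf p E k) (h :: _ \<Rightarrow> real)"
  using marked_order.integrable_marked_order[of p E k h] fire_tree.axioms(2)[OF tree] card_tree by simp

lemma mean_mono:
  assumes "k \<le> n - 1"
    "\<And>E xs. E \<in> recursive_trees n \<Longrightarrow> xs \<in> set_pmf (order_pmf p E k) \<Longrightarrow> f E xs \<le> g E xs"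
  shows "mean n p k f \<le> mean n p k g"
  unfolding mean_def
proof (rule rt_avg_mono)
  fix E assume E: "E \<in> recursive_trees n"
  interpret fire_tree n E p by (rule tree[OF E])
  show "marked_mean p E k (f E) \<le> marked_mean p E k (g E)"
    by (rule marked_mean_mono) (use assms E card_tree[OF E] in auto)
qed

lemma mean_add: "k \<le> n - 1 \<Longrightarrow> mean n p k (\<lambda>E xs. f E xs + g E xs) = mean n p k f + mean n p k g"
  unfolding mean_def rt_avg_add[symmetric]
  by (rule rt_avg_cong) (simp add: integrable_tree)

lemma mean_diff: "k \<le> n - 1 \<Longrightarrow> mean n p k (\<lambda>E xs. f E xs - g E xs) = mean n p k f - mean n p k g"
  unfolding mean_def rt_avg_diff[symmetric]
  by (rule rt_avg_cong) (simp add: integrable_tree)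

lemma mean_mult: "mean n p k (\<lambda>E xs. c * f E xs) = c * mean n p k f"
  unfolding mean_def by (simp add: rt_avg_mult)

lemma mean_const: "mean n p k (\<lambda>_ _. c) = c"
  unfolding mean_def using rt_avg_const[OF n1] by simp

lemma mean_cong:
  assumes "\<And>E xs. E \<in> recursive_trees n \<Longrightarrow> xs \<in> set_pmf (order_pmf p E k) \<Longrightarrow> f E xs = g E xs"
  shows "mean n p k f = mean n p k g"
  unfolding mean_def by (intro rt_avg_cong expectation_cong assms)

lemma mean_take:
  assumes "k \<le> l" "l \<le> n - 1"
  shows "mean n p l (\<lambda>E xs. h E (take k xs)) = mean n p k h"
  unfolding mean_def
proof (rule rt_avg_cong)
  fix E assume E: "E \<in> recursive_trees n"
  interpret fire_tree n E p by (rule tree[OF E])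
  show "marked_mean p E l (\<lambda>xs. h E (take k xs)) = marked_mean p E k (h E)"
    by (rule marked_mean_take) (use assms card_tree[OF E] in auto)
qed

lemma pairs_ge_root_size: 
  assumes E: "E \<in> recursive_trees n" shows "(root_size E xs)\<^sup>2 \<le> pairs n E xs"
proof -
  interpret fire_tree n E p by (rule tree[OF E])
  have "0 \<le> (\<Sum>e\<in>{e \<in> pending E xs. e \<inter> component (pending E xs) 1 = {}}. real (card (edge_component (pending E xs) e)))"
    by (intro sum_nonneg) auto
  then show ?thesis using sum_card_edge_component_nonroot[OF pending_subset, of xs] unfolding num_pairs_def root_card_def by linarith
qed

lemma root_size_bounds:
  assumes E: "E \<in> recursive_trees n" shows "1 \<le> root_size E xs" "root_size E xs \<le> n"
  using fire_tree.root_card_bounds[OF tree[OF E]] by auto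

lemma mean_pairs_le: "k \<le> n - 1 \<Longrightarrow> mean n p k (pairs n) \<le> pair_moment n (1 - real k / (n - 1))"
  unfolding mean_def pair_moment_def
proof (rule rt_avg_mono)
  fix E assume k: "k \<le> n - 1" and E: "E \<in> recursive_trees n"
  show "marked_mean p E k (pairs n E) \<le> (\<Sum>u\<in>{1..n}. \<Sum>v\<in>{1..n}. (1 - real k / (n - 1)) ^ card (bridges E u v))"
    using fire_tree.mean_num_pairs_le[OF tree[OF E], of k] k m_tree[OF E] n1 by (simp add: of_nat_diff)
qed

text \<open>The tangent of a convex function at \<open>a\<close>: Jensen's inequality before
  averaging.\<close>

lemma exp_tangent: "exp (- l * x) \<ge> exp (- l * a) * (1 - l * (x - a))" for l x a :: real
proof -
  have "1 + (- l * (x - a)) \<le> exp (- l * (x - a))" by (rule exp_ge_add_one_self)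
  then have "exp (- l * a) * (1 - l * (x - a)) \<le> exp (- l * a) * exp (- l * (x - a))"
    by (intro mult_left_mono) auto
  also have "\<dots> = exp (- l * x)" by (simp add: exp_add[symmetric] algebra_simps)
  finally show ?thesis .
qed

text \<open>The tangent is taken at \<open>L\<close> and not at the mean depth per vertex. Its slope
  in the depth is not positive, so the upper bound \<open>mean_depth_le\<close> works in the right
  direction.\<close>

lemma mean_root_size_ge:
  assumes k: "k < n - 1" and \<eta>: "0 < \<eta>"
  defines "l \<equiv> (1 + \<eta>) * k / real (n - 1 - k)" and "c \<equiv> (1 + \<eta>) / (\<eta> * real (n - 1 - k))"
  shows "mean n p k root_size \<ge> n * exp (- l * L) - c * (n * L)"
proof -
  have c: "c \<ge> 0" and l: "l \<ge> 0" using \<eta> by (auto simp: c_def l_def)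
  let ?D = "\<lambda>E. \<Sum>v\<in>{1..n}. real (card (bridges E 1 v))"
  have md: "mean_depth n \<le> n * L" using mean_depth_le[OF n1] .
  have "n * exp (- l * L) - c * (n * L) \<le> n * exp (- l * L) * (1 + l * L) - (exp (- l * L) * l + c) * mean_depth n"
  proof -
    have "(exp (- l * L) * l + c) * mean_depth n \<le> (exp (- l * L) * l + c) * (n * L)"
      using md c l by (intro mult_left_mono) auto
    then show ?thesis by (simp add: algebra_simps)
  qed
  also have "\<dots> = rt_avg n (\<lambda>E. n * exp (- l * L) * (1 + l * L) - (exp (- l * L) * l + c) * ?D E)"
    unfolding rt_avg_diff rt_avg_mult mean_depth_def rt_avg_const[OF n1] ..
  also have "\<dots> \<le> rt_avg n (\<lambda>E. marked_mean p E k (root_size E))"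
  proof (rule rt_avg_mono)
    fix E assume E: "E \<in> recursive_trees n"
    interpret fire_tree n E p by (rule tree[OF E])
    have mm: "m = n - 1" using m_tree[OF E] .
    have "n * exp (- l * L) * (1 + l * L) - (exp (- l * L) * l + c) * ?D E
      = (\<Sum>v\<in>{1..n}. exp (- l * L) * (1 - l * (card (bridges E 1 v) - L)) - c * card (bridges E 1 v))"
    proof -
      have "(\<Sum>v\<in>{1..n}. exp (- l * L) * (1 - l * (card (bridges E 1 v) - L)) - c * card (bridges E 1 v))
        = (\<Sum>v\<in>{1..n}. exp (- l * L) * (1 + l * L) - (exp (- l * L) * l + c) * card (bridges E 1 v))"
        by (rule sum.cong) (simp_all only: algebra_simps)
      then show ?thesis by (simp add: sum_subtractf sum_distrib_left)
    qed
    also have "\<dots> \<le> (\<Sum>v\<in>{1..n}. exp (- l * card (bridges E 1 v)) - c * card (bridges E 1 v))"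
      by (intro sum_mono diff_right_mono exp_tangent)
    also have "\<dots> \<le> marked_mean p E k root_card"
      using mean_root_card_ge[of k \<eta>] k \<eta> unfolding mm l_def c_def by simp
    finally show "n * exp (- l * L) * (1 + l * L) - (exp (- l * L) * l + c) * ?D E \<le> marked_mean p E k (root_size E)" .
  qed
  finally show ?thesis unfolding mean_def .
qed

lemma decay_bounds: "0 < decay n k" "decay n k \<le> 1"
  using L_pos by (auto simp: decay_def)

lemma exp_diff_le: "0 \<le> a \<Longrightarrow> a \<le> b \<Longrightarrow> exp (- a) - exp (- b) \<le> b - a" for a b :: real
proof -
  assume a: "0 \<le> a" "a \<le> b"
  have "1 - exp (- (b - a)) \<le> b - a" using exp_ge_add_one_self[of "- (b - a)"] by linarith
  then have "exp (- a) * (1 - exp (- (b - a))) \<le> 1 * (b - a)"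
    using a by (intro mult_mono) auto
  moreover have "exp (- a) * exp (- (b - a)) = exp (- b)" by (simp add: exp_add[symmetric])
  ultimately show ?thesis by (simp add: right_diff_distrib)
qed

end

text \<open>The condition \<open>4 * K < ln n\<close> confines the early steps to
  \<open>k <= n / 4\<close> and keeps \<open>k / (n - 1)\<close> below \<open>1 / 2\<close>, as
  \<open>pair_moment_le\<close> requires.\<close>

locale fire_early = mean_field +
  fixes K :: real
  assumes K: "0 < K" "4 * K < ln n"
begin

definition early :: "nat \<Rightarrow> bool" where
  "early k \<longleftrightarrow> real k \<le> K * n / L"

lemma Kn_le: "K * n / L \<le> real n / 4"
proof -
  have "4 * K * n \<le> L * n" using K by (intro mult_right_mono) auto
  then show ?thesis using L_pos by (simp add: field_simps)
qed

lemma Kn_nonneg: "0 \<le> K * n / L"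
  using K L_pos by simp

lemma gap_pos: "real n - 1 - K * n / L > 0"
proof -
  have "real n \<ge> 2" using n2 by simp
  then show ?thesis using Kn_le by linarith
qed

lemma early_bounds:
  assumes "early k"
  shows "k < n - 1" "real (n - 1 - k) \<ge> real n - 1 - K * n / L" "real k / (n - 1) \<le> 2 * K / L"
proof -
  have k: "real k \<le> K * n / L" using assms by (simp add: early_def)
  then have "real k < real n - 1" using gap_pos by linarith
  then show kn: "k < n - 1" using n2 by linarith
  then show "real (n - 1 - k) \<ge> real n - 1 - K * n / L" using k by (simp add: of_nat_diff)
  have "real k / (n - 1) \<le> K * n / L / (n - 1)" using k n2 by (intro divide_right_mono) auto
  also have "\<dots> = K / L * (n / (n - 1))" by simp
  also have "\<dots> \<le> K / L * 2" using K L_pos n2 by (intro mult_left_mono) (auto simp: field_simps)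
  finally show "real k / (n - 1) \<le> 2 * K / L" by (simp add: mult.commute)
qed

lemma root_loss_nonneg: "root_loss K n \<ge> 0"
proof -
  have "L / n \<le> (L + 1) / (real n - 1 - K * n / L)"
    using gap_pos L_pos Kn_nonneg by (intro frac_le) auto
  then show ?thesis unfolding root_loss_def using gap_pos L_pos K by auto
qed

lemma pair_gain_pos: "pair_gain K n > 0"
proof -
  have "0 < 1 - 4 * K / L" "1 - 4 * K / L \<le> 1" using K L_pos by (auto simp: field_simps)
  moreover have "1 \<le> exp (8 * K / L)" using K L_pos by simp
  moreover have "1 * 1 < (1 + 1 / real n) * exp (8 * K / L)" using calculation n2 by (intro mult_less_le_imp_less) auto
  ultimately have "1 < (1 + 1 / real n) * exp (8 * K / L) / (1 - 4 * K / L)"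
    by (simp add: less_divide_eq)
  then show ?thesis by (simp add: pair_gain_def)
qed

lemma var_bound_pos: "var_bound K n > 0"
  using root_loss_nonneg pair_gain_pos by (simp add: var_bound_def)

lemma mean_pairs_early:
  assumes k: "early k"
  shows "mean n p k (pairs n) \<le> n\<^sup>2 * ((decay n k)\<^sup>2 + pair_gain K n)"
proof -
  define z where "z = real k / (n - 1)"
  define x where "x = 2 * K / L"
  note e = early_bounds[OF k]
  have x: "x < 1 / 2" using K L_pos by (simp add: x_def field_simps)
  have z: "0 \<le> z" "z \<le> x" using e n2 by (auto simp: z_def x_def)
  have zn: "real k / n \<le> z" unfolding z_def using n2 by (intro divide_left_mono) auto
  have "mean n p k (pairs n) \<le> pair_moment n (1 - z)"
    using mean_pairs_le[of k] e(1) by (simp add: z_def)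
  also have "\<dots> \<le> (1 - z) / (2 * (1 - z) - 1) * (real n * (real n + 1)) * exp (4 * z) * exp (- 2 * z * L)"
    using pair_moment_le[of "1 - z" n] z x n1 by simp
  also have "\<dots> \<le> 1 / (1 - 2 * x) * (real n * (real n + 1)) * exp (4 * x) * (decay n k)\<^sup>2"
  proof (intro mult_mono)
    show "(1 - z) / (2 * (1 - z) - 1) \<le> 1 / (1 - 2 * x)" using z x by (intro frac_le) auto
    have "real k / n * L \<le> z * L" using zn L_pos by (intro mult_right_mono) auto
    then have "exp (- 2 * z * L) \<le> exp (2 * (- real k * L / n))" by simp
    also have "\<dots> = (decay n k)\<^sup>2" by (simp only: decay_def exp_double)
    finally show "exp (- 2 * z * L) \<le> (decay n k)\<^sup>2" .
  qed (use z x in auto)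
  also have "\<dots> = n\<^sup>2 * ((1 + pair_gain K n) * (decay n k)\<^sup>2)"
  proof -
    have "1 + pair_gain K n = (1 + 1 / n) * (exp (4 * x) / (1 - 2 * x))" by (simp add: pair_gain_def x_def)
    moreover have "real n * (real n + 1) = n\<^sup>2 * (1 + 1 / n)" using n2 by (simp add: power2_eq_square field_simps)
    ultimately show ?thesis by simp
  qed
  also have "\<dots> \<le> n\<^sup>2 * ((decay n k)\<^sup>2 + pair_gain K n)"
  proof (rule mult_left_mono)
    have "pair_gain K n * (decay n k)\<^sup>2 \<le> pair_gain K n * 1"
      using pair_gain_pos decay_bounds[of k] by (intro mult_left_mono power_le_one) auto
    then show "(1 + pair_gain K n) * (decay n k)\<^sup>2 \<le> (decay n k)\<^sup>2 + pair_gain K n"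
      by (simp add: algebra_simps)
  qed simp
  finally show ?thesis .
qed

lemma mean_root_size_early:
  assumes k: "early k"
  shows "mean n p k root_size \<ge> n * (decay n k - root_loss K n)"
proof -
  note e = early_bounds[OF k]
  define g where "g = real n - 1 - K * n / L"
  have g: "g > 0" "real (n - 1 - k) \<ge> g" using gap_pos e by (auto simp: g_def)
  define l where "l = (1 + 1 / L) * k / real (n - 1 - k)"
  define c where "c = (1 + 1 / L) / (1 / L * real (n - 1 - k))"
  \<comment> \<open>With \<open>\<eta> = 1 / L\<close> both errors vanish: the exponent grows by a
    quantity of order \<open>1 / L\<close>, and the correction per vertex is of order
    \<open>L^2 / n\<close>.\<close>
  have *: "mean n p k root_size \<ge> n * exp (- l * L) - c * (n * L)"
    using mean_root_size_ge[OF e(1), of "1 / L"] L_pos unfolding l_def c_def by simp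
  have gn: "g \<le> n" using Kn_nonneg by (simp add: g_def)
  have L1: "(1 + 1 / L) * L = L + 1" using L_pos by (simp add: field_simps)
  have "l * L = k * (((1 + 1 / L) * L) / real (n - 1 - k))" unfolding l_def by (simp add: mult_ac)
  then have lL: "l * L = k * ((L + 1) / real (n - 1 - k))" unfolding L1 .
  have nk: "real (n - 1 - k) > 0" using g by linarith
  have "l * L - k * L / n = k * ((L + 1) / real (n - 1 - k) - L / n)" unfolding lL by (simp add: algebra_simps)
  also have "\<dots> \<le> K * n / L * ((L + 1) / g - L / n)"
  proof (rule mult_mono)
    show "real k \<le> K * n / L" using k by (simp add: early_def)
    show "(L + 1) / real (n - 1 - k) - L / n \<le> (L + 1) / g - L / n"
      using g L_pos by (intro diff_right_mono divide_left_mono) auto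
    show "0 \<le> K * n / L" using K L_pos by simp
    have "L / n \<le> (L + 1) / real (n - 1 - k)" using L_pos nk n2 by (intro frac_le) auto
    then show "0 \<le> (L + 1) / real (n - 1 - k) - L / n" by simp
  qed
  finally have 1: "l * L - k * L / n \<le> K * n / L * ((L + 1) / g - L / n)" .
  have "k * L / n \<le> l * L"
  proof -
    have "L / n \<le> (L + 1) / real (n - 1 - k)" using L_pos nk n2 by (intro frac_le) auto
    from mult_left_mono[OF this, of "real k"] show ?thesis unfolding lL by simp
  qed
  then have "exp (- (k * L / n)) - exp (- (l * L)) \<le> l * L - k * L / n"
    using L_pos by (intro exp_diff_le) auto
  then have 2: "decay n k - exp (- l * L) \<le> l * L - k * L / n" by (simp add: decay_def)
  have "c * L = L * ((1 + 1 / L) * L) / real (n - 1 - k)" using L_pos unfolding c_def by (simp add: mult_ac)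
  then have "c * L = L * (L + 1) / real (n - 1 - k)" unfolding L1 .
  also have "\<dots> \<le> L * (L + 1) / g" using g L_pos by (intro divide_left_mono) auto
  finally have 3: "c * L \<le> L * (L + 1) / g" .
  have "decay n k - root_loss K n \<le> exp (- l * L) - c * L"
    using 1 2 3 unfolding root_loss_def g_def[symmetric] by linarith
  then have "n * (decay n k - root_loss K n) \<le> n * (exp (- l * L) - c * L)" by (intro mult_left_mono) auto
  then show ?thesis using * by (simp add: algebra_simps)
qed

text \<open>The expression is linear in the pairs and in the root component, so first moments
  control its mean. It is also the sum of \<open>(pairs - root_size^2) / n^2\<close> and the squared
  deviation of the root component; both are nonnegative, so each inherits the bound.\<close>

theorem mean_quadratic:
  assumes k: "early k"
  shows "mean n p k (\<lambda>E xs. pairs n E xs / n\<^sup>2 - 2 * decay n k * (root_size E xs / n) + (decay n k)\<^sup>2)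
    \<le> var_bound K n"
proof -
  have kn: "k \<le> n - 1" using early_bounds(1)[OF k] by simp
  let ?y = "decay n k"
  have n0: "real n > 0" using n2 by simp
  have eq: "mean n p k (\<lambda>E xs. pairs n E xs / n\<^sup>2 - 2 * ?y * (root_size E xs / n) + ?y\<^sup>2)
    = mean n p k (pairs n) / n\<^sup>2 - 2 * ?y * (mean n p k root_size / n) + ?y\<^sup>2"
    using mean_mult[of k "1 / n\<^sup>2" "pairs n"] mean_mult[of k "2 * ?y / n" root_size]
    by (simp add: mean_add[OF kn] mean_diff[OF kn] mean_const)
  have "mean n p k (pairs n) / n\<^sup>2 \<le> ?y\<^sup>2 + pair_gain K n"
    using mean_pairs_early[OF k] n0 by (simp add: divide_le_eq mult.commute)
  moreover have "?y - root_loss K n \<le> mean n p k root_size / n"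
    using mean_root_size_early[OF k] n0 by (simp add: le_divide_eq mult.commute)
  then have "2 * ?y * (?y - root_loss K n) \<le> 2 * ?y * (mean n p k root_size / n)"
    using decay_bounds[of k] by (intro mult_left_mono) auto
  moreover have "?y * root_loss K n \<le> root_loss K n"
    using decay_bounds[of k] root_loss_nonneg by (simp add: mult_left_le_one_le)
  ultimately show ?thesis unfolding eq var_bound_def by (simp add: algebra_simps power2_eq_square)
qed

lemma mean_square_root_size:
  assumes k: "early k"
  shows "mean n p k (\<lambda>E xs. (root_size E xs / n - decay n k)\<^sup>2) \<le> var_bound K n"
proof (rule order_trans[OF mean_mono mean_quadratic[OF k]])
  show "k \<le> n - 1" using early_bounds(1)[OF k] by simp
  fix E xs assume "E \<in> recursive_trees n"
  then have "(root_size E xs)\<^sup>2 / n\<^sup>2 \<le> pairs n E xs / n\<^sup>2"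
    using pairs_ge_root_size by (intro divide_right_mono) auto
  then show "(root_size E xs / n - decay n k)\<^sup>2
     \<le> pairs n E xs / n\<^sup>2 - 2 * decay n k * (root_size E xs / n) + (decay n k)\<^sup>2"
    by (simp add: power2_diff power_divide mult_ac)
qed

lemma mean_nonroot_pairs:
  assumes k: "early k"
  shows "mean n p k (\<lambda>E xs. pairs n E xs - (root_size E xs)\<^sup>2) \<le> n\<^sup>2 * var_bound K n"
proof -
  have "mean n p k (\<lambda>E xs. pairs n E xs - (root_size E xs)\<^sup>2)
    \<le> mean n p k (\<lambda>E xs. n\<^sup>2 * (pairs n E xs / n\<^sup>2 - 2 * decay n k * (root_size E xs / n) + (decay n k)\<^sup>2))"
  proof (rule mean_mono)
    show "k \<le> n - 1" using early_bounds(1)[OF k] by simp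
    fix E xs
    have "0 \<le> n\<^sup>2 * (root_size E xs / n - decay n k)\<^sup>2" by simp
    then show "pairs n E xs - (root_size E xs)\<^sup>2 
      \<le> n\<^sup>2 * (pairs n E xs / n\<^sup>2 - 2 * decay n k * (root_size E xs / n) + (decay n k)\<^sup>2)"
      using n2 by (simp add: power2_diff power_divide algebra_simps power2_eq_square)
  qed
  also have "\<dots> \<le> n\<^sup>2 * var_bound K n"
    unfolding mean_mult by (intro mult_left_mono mean_quadratic[OF k]) simp
  finally show ?thesis .
qed

lemma mean_abs_root_size:
  assumes k: "early k"
  shows "mean n p k (\<lambda>E xs. \<bar>root_size E xs / n - decay n k\<bar>) \<le> 2 * sqrt (var_bound K n)"
proof -
  define s where "s = sqrt (var_bound K n)"
  have s: "s > 0" "s * s = var_bound K n" using var_bound_pos by (auto simp: s_def)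
  have kn: "k \<le> n - 1" using early_bounds(1)[OF k] by simp
  \<comment> \<open>An elementary substitute for the Cauchy-Schwarz inequality; with
    \<open>s\<close> the root of the variance bound it costs a factor \<open>2\<close>.\<close>
  have "\<bar>t\<bar> \<le> s + 1 / s * t\<^sup>2" for t
  proof -
    have "0 \<le> (\<bar>t\<bar> - s)\<^sup>2 + s * \<bar>t\<bar>" using s by simp
    then have "s * \<bar>t\<bar> \<le> s * s + t\<^sup>2" by (simp add: power2_eq_square algebra_simps)
    then show ?thesis using s by (simp add: field_simps)
  qed
  then have "mean n p k (\<lambda>E xs. \<bar>root_size E xs / n - decay n k\<bar>)
    \<le> mean n p k (\<lambda>E xs. s + 1 / s * (root_size E xs / n - decay n k)\<^sup>2)"
    by (intro mean_mono[OF kn])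
  also have "\<dots> = s + 1 / s * mean n p k (\<lambda>E xs. (root_size E xs / n - decay n k)\<^sup>2)"
    unfolding mean_add[OF kn] mean_mult mean_const ..
  also have "\<dots> \<le> s + 1 / s * var_bound K n"
    using mean_square_root_size[OF k] s by (intro add_left_mono mult_left_mono) auto
  also have "\<dots> = 2 * s" unfolding s(2)[symmetric] using s(1) by simp
  finally show ?thesis by (simp add: s_def)
qed

lemma mean_prob_root_size:
  assumes k: "early k" and d: "d > 0"
  shows "mean n p k (\<lambda>E xs. of_bool (\<bar>root_size E xs / n - decay n k\<bar> \<ge> d)) \<le> var_bound K n / d\<^sup>2"
proof -
  have kn: "k \<le> n - 1" using early_bounds(1)[OF k] by simp
  have "of_bool (\<bar>t\<bar> \<ge> d) \<le> 1 / d\<^sup>2 * t\<^sup>2" for t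
  proof (cases "\<bar>t\<bar> \<ge> d")
    case True
    then have "d\<^sup>2 \<le> t\<^sup>2" using d by (metis abs_of_pos abs_le_square_iff)
    then show ?thesis using d True by (simp add: field_simps)
  qed simp
  then have "mean n p k (\<lambda>E xs. of_bool (\<bar>root_size E xs / n - decay n k\<bar> \<ge> d))
    \<le> mean n p k (\<lambda>E xs. 1 / d\<^sup>2 * (root_size E xs / n - decay n k)\<^sup>2)"
    by (intro mean_mono[OF kn])
  also have "\<dots> \<le> 1 / d\<^sup>2 * var_bound K n"
    unfolding mean_mult using mean_square_root_size[OF k] by (intro mult_left_mono) auto
  finally show ?thesis by simp
qed

definition alive :: "nat \<Rightarrow> real" where
  "alive k = mean n p k (\<lambda>E xs. of_bool (no_root_fire E xs))"

lemma alive_0: "alive 0 = 1"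
  unfolding alive_def mean_def using rt_avg_const[OF n1] by (simp add: no_root_fire_def)

text \<open>Survival and the size of the root component are dependent. However, the survival
  indicator times the deviation of the hazard from \<open>decay n k\<close> is bounded by that
  deviation, whose mean is small without conditioning.\<close>

lemma alive_Suc:
  assumes k: "early k"
  shows "\<bar>alive (Suc k) - alive k * (1 - p * decay n k)\<bar> \<le> p * hazard_error K n"
proof -
  note e = early_bounds[OF k]
  have kn: "k \<le> n - 1" using e(1) by simp
  define g where "g = real n - 1 - K * n / L"
  have g: "g > 0" "real (n - 1 - k) \<ge> g" using gap_pos e by (auto simp: g_def)
  let ?I = "\<lambda>E xs. of_bool (no_root_fire E xs) :: real"
  let ?H = "\<lambda>E xs. (root_size E xs - 1) / real (n - 1 - k)"
  have "alive (Suc k) = rt_avg n (\<lambda>E. marked_mean p E k (?I E) - p * marked_mean p E k (\<lambda>xs. ?I E xs * ?H E xs))"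
    unfolding alive_def mean_def
  proof (rule rt_avg_cong)
    fix E assume E: "E \<in> recursive_trees n"
    interpret fire_tree n E p by (rule tree[OF E])
    show "marked_mean p E (Suc k) (?I E) = marked_mean p E k (?I E) - p * marked_mean p E k (\<lambda>xs. ?I E xs * ?H E xs)"
      using survive_Suc[of k] e(1) m_tree[OF E] by (simp add: survive_def)
  qed
  also have "\<dots> = alive k - p * mean n p k (\<lambda>E xs. ?I E xs * ?H E xs)"
    unfolding rt_avg_diff rt_avg_mult alive_def mean_def ..
  finally have eq: "alive (Suc k) - alive k * (1 - p * decay n k)
     = - p * (mean n p k (\<lambda>E xs. ?I E xs * ?H E xs) - decay n k * alive k)"
    by (simp add: algebra_simps)
  have "mean n p k (\<lambda>E xs. ?I E xs * ?H E xs) - decay n k * alive k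
      = mean n p k (\<lambda>E xs. ?I E xs * (?H E xs - decay n k))"
    unfolding alive_def mean_mult[symmetric] mean_diff[OF kn, symmetric]
    by (rule mean_cong) (simp add: algebra_simps)
  moreover have "\<bar>mean n p k (\<lambda>E xs. ?I E xs * (?H E xs - decay n k))\<bar> \<le> hazard_error K n"
  proof -
    define r where "r = (real n + 1) / g - 1"
    have tri: "\<bar>x - z\<bar> \<le> \<bar>y - z\<bar> + r" if "\<bar>x - y\<bar> \<le> r" for x y z :: real
      using that by linarith
    have neg: "- 1 * b \<le> x" if "\<bar>x\<bar> \<le> b" for x b :: real using that by linarith
    have ineq: "\<bar>?I E xs * (?H E xs - decay n k)\<bar> \<le> \<bar>root_size E xs / n - decay n k\<bar> + r"
      if E: "E \<in> recursive_trees n" for E xs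
    proof -
      let ?r = "root_size E xs"
      define a where "a = real (n - 1 - k)"
      have rb: "1 \<le> ?r" "?r \<le> n" using root_size_bounds[OF E] by auto
      have a: "a > 0" "a \<le> n" "g \<le> a" using g e by (auto simp: a_def)
      have "?r / n \<le> ?r / a" using a rb n2 by (intro divide_left_mono) auto
      moreover have "?r / a - ?r / n \<le> n / a - 1"
      proof -
        have "1 / n \<le> 1 / a" using a by (intro divide_left_mono) auto
        then have "?r * (1 / a - 1 / n) \<le> n * (1 / a - 1 / n)"
          using rb by (intro mult_right_mono) auto
        then show ?thesis using n2 by (simp add: right_diff_distrib)
      qed
      moreover have "1 \<le> n / a" "0 \<le> 1 / a" using a by auto
      moreover have "n / a + 1 / a \<le> (real n + 1) / g"
        unfolding add_divide_distrib[symmetric] using g(1) a by (intro divide_left_mono) auto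
      ultimately have "\<bar>?H E xs - ?r / n\<bar> \<le> r"
        unfolding r_def diff_divide_distrib a_def[symmetric] by linarith
      from tri[OF this, of "decay n k"] show ?thesis
        by (rule order_trans[rotated]) simp
    qed
    have up: "mean n p k (\<lambda>E xs. \<bar>root_size E xs / n - decay n k\<bar> + r) \<le> hazard_error K n"
      unfolding mean_add[OF kn] mean_const hazard_error_def r_def g_def
      using mean_abs_root_size[OF k] by simp
    have "mean n p k (\<lambda>E xs. ?I E xs * (?H E xs - decay n k))
      \<le> mean n p k (\<lambda>E xs. \<bar>root_size E xs / n - decay n k\<bar> + r)"
      by (rule mean_mono[OF kn]) (use ineq abs_le_D1 in blast)
    moreover have "mean n p k (\<lambda>E xs. - 1 * (\<bar>root_size E xs / n - decay n k\<bar> + r))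
      \<le> mean n p k (\<lambda>E xs. ?I E xs * (?H E xs - decay n k))"
    proof (rule mean_mono[OF kn])
      fix E xs assume "E \<in> recursive_trees n"
      then show "- 1 * (\<bar>root_size E xs / n - decay n k\<bar> + r) \<le> ?I E xs * (?H E xs - decay n k)"
        by (rule neg[OF ineq])
    qed
    ultimately show ?thesis using up unfolding mean_mult by linarith
  qed
  ultimately show ?thesis unfolding eq abs_mult using p by (simp add: mult_left_mono)
qed

end

section \<open>Small fires and the first fire at the root\<close>

text \<open>The root component decreases, so it is larger at a fire before step \<open>k\<close> and
  smaller at a later one. This translates a bound on the burnt mass into survival up to the step
  where the component has about that size.\<close>

lemma (in recursive_tree) root_fire_mass_bounds:
  assumes k: "k \<le> length xs"
  shows "no_root_fire E (take k xs) \<Longrightarrow> root_fire_mass E xs \<le> card (component (pending E (take k xs)) 1)"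
    and "\<not> no_root_fire E (take k xs) \<Longrightarrow> card (component (pending E (take k xs)) 1) \<le> root_fire_mass E xs"
proof -
  have mono: "card (component (pending E (take j xs)) 1) \<le> card (component (pending E (take i xs)) 1)" if "i \<le> j" for i j
    by (intro card_mono component_mono pending_take_antimono that finite_component pending_subset) (use n in auto)
  show "root_fire_mass E xs \<le> card (component (pending E (take k xs)) 1)" if nr: "no_root_fire E (take k xs)"
  proof (cases "no_root_fire E xs")
    case False
    note f = first_root_fire[OF False]
    have "k \<le> (LEAST k. k < length xs \<and> root_fire E xs k)"
      using nr f(2) k by (auto simp: no_root_fire_take not_less[symmetric])
    then show ?thesis unfolding f(5) by (rule mono)
  qed (simp add: root_fire_mass_def)
  show "card (component (pending E (take k xs)) 1) \<le> root_fire_mass E xs" if nr: "\<not> no_root_fire E (take k xs)"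
  proof -
    obtain j where j: "j < k" "root_fire E xs j" using nr k by (auto simp: no_root_fire_take)
    then have "\<not> no_root_fire E xs" using k less_le_trans unfolding no_root_fire_def by blast
    note f = first_root_fire[OF this]
    have "(LEAST k. k < length xs \<and> root_fire E xs k) \<le> k" using f(4)[of j] j k by simp
    then show ?thesis unfolding f(5) by (rule mono)
  qed
qed

text \<open>\<open>fire_tail n p d\<close> bounds the expected number of vertices burnt from step \<open>k\<close> on, where \<open>d\<close> stands
  for \<open>exp(- 2 k ln n / (n - 1))\<close>; the summand \<open>exp(- ln n / 2)\<close> accounts for the steps with
  \<open>q < 3 / 4\<close>, to which \<open>pair_moment_le\<close> is applied with \<open>q = 3 / 4\<close>.\<close>

definition fire_tail :: "nat \<Rightarrow> real \<Rightarrow> real \<Rightarrow> real" where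
  "fire_tail n p d = 12 * p * (real n)\<^sup>2 * (d * (1 / (real n - 1) + 1 / (2 * ln n)) + exp (- ln n / 2))"

text \<open>At most \<open>K n / ln n + 1\<close> early steps, each charged through the connected
  pairs outside the root component, plus the tail of all later fires.\<close>

definition small_bound :: "real \<Rightarrow> nat \<Rightarrow> real \<Rightarrow> real" where
  "small_bound K n p = (K * n / ln n + 1) * (p * ((real n)\<^sup>2 * var_bound K n) / (real n - 1 - K * n / ln n))
     + fire_tail n p (exp (- 2 * K))"

context mean_field
begin

lemma real_m: "real (n - 1) = real n - 1"
  using n1 by simp

lemma mean_fire_at_le:
  assumes k: "k < n - 1"
  shows "mean n p (n - 1) (\<lambda>E xs. real (card (fire_tree.fire_at E xs k)))
    \<le> 12 * p * (real n)\<^sup>2 / (n - 1) * (exp (- 2 * real k * L / (n - 1)) + exp (- L / 2))"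
proof -
  define z where "z = min (real k / (n - 1)) (1 / 4)"
  define q where "q = 1 - z"
  have z: "0 \<le> z" "z \<le> 1 / 4" "z \<le> real k / (n - 1)"
    unfolding z_def by (simp, rule min.cobounded2, rule min.cobounded1)
  have q: "3 / 4 \<le> q" "q \<le> 1" "1 - real k / (n - 1) \<le> q" using z by (auto simp: q_def)
  have n0: "real n > 0" "real (n - 1) > 0" using n2 by auto
  have "mean n p (n - 1) (\<lambda>E xs. real (card (fire_tree.fire_at E xs k)))
    \<le> rt_avg n (\<lambda>E. p / (n - 1) * (1 / q) * (\<Sum>u\<in>{1..n}. \<Sum>v\<in>{1..n}. q ^ card (bridges E u v)))"
    unfolding mean_def
  proof (rule rt_avg_mono)
    fix E assume E: "E \<in> recursive_trees n"
    interpret fire_tree n E p by (rule tree[OF E])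
    have mm: "m = n - 1" using m_tree[OF E] .
    have km: "k < m" using k mm by simp
    let ?S = "\<Sum>u\<in>{1..n}. \<Sum>v\<in>{1..n}. q ^ card (bridges E u v)"
    have "marked_mean p E (n - 1) (\<lambda>xs. real (card (fire_at xs k))) \<le> p * (1 / real (m - k) * (marked_mean p E k num_pairs - n))"
      using marked_mean_fire_at[OF km] by (simp add: mm)
    also have "\<dots> \<le> p * (1 / real m * (1 / q * ?S))"
      using q p by (intro mult_left_mono mean_num_pairs_off_diagonal_le km) (auto simp: mm)
    finally show "marked_mean p E (n - 1) (\<lambda>xs. real (card (fire_at xs k))) \<le> p / (n - 1) * (1 / q) * ?S"
      by (simp add: mm)
  qed
  also have "\<dots> = p / (n - 1) * (1 / q * pair_moment n q)"
    unfolding rt_avg_mult pair_moment_def by simp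
  also have "\<dots> \<le> p / (n - 1) * (12 * (real n)\<^sup>2 * exp (- 2 * z * L))"
  proof (rule mult_left_mono)
    have "1 / q * pair_moment n q \<le> 1 / q * (q / (2 * q - 1) * (real n * (real n + 1)) * exp (4 * z) * exp (- 2 * z * L))"
      using pair_moment_le[of q n] q n1 by (intro mult_left_mono) (auto simp: q_def)
    also have "\<dots> = 1 / (2 * q - 1) * (real n * (real n + 1)) * exp (4 * z) * exp (- 2 * z * L)"
      using q by simp
    \<comment> \<open>Origin of the constant \<open>12\<close>: the three factors are at most
      \<open>2\<close>, \<open>2 n^2\<close> and \<open>exp 1 <= 3\<close>.\<close>
    also have "\<dots> \<le> 2 * (2 * (real n)\<^sup>2) * 3 * exp (- 2 * z * L)"
    proof (rule mult_right_mono[OF mult_mono[OF mult_mono]])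
      show "1 / (2 * q - 1) \<le> 2" using q by (simp add: field_simps)
      show "real n * (real n + 1) \<le> 2 * (real n)\<^sup>2" using n1 by (simp add: power2_eq_square algebra_simps)
      have "exp (4 * z) \<le> exp 1" using z by simp
      also have "exp 1 \<le> (3 :: real)" by (rule exp_le)
      finally show "exp (4 * z) \<le> 3" .
    qed (use q in auto)
    finally show "1 / q * pair_moment n q \<le> 12 * (real n)\<^sup>2 * exp (- 2 * z * L)" by simp
  qed (use p in simp)
  also have "\<dots> \<le> p / (n - 1) * (12 * (real n)\<^sup>2 * (exp (- 2 * real k * L / (n - 1)) + exp (- L / 2)))"
  proof (intro mult_left_mono)
    show "exp (- 2 * z * L) \<le> exp (- 2 * real k * L / (n - 1)) + exp (- L / 2)"
    proof (cases "real k / (n - 1) \<le> 1 / 4")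
      case True
      then have "- 2 * z * L = - 2 * real k * L / (n - 1)" by (simp add: z_def)
      then show ?thesis by simp
    next
      case False
      then have "z = 1 / 4" unfolding z_def by (simp add: min_def)
      show ?thesis unfolding \<open>z = 1 / 4\<close> by simp
    qed
  qed (use p in auto)
  finally show ?thesis by (simp add: mult_ac)
qed

lemma sum_mean_fire_at_le:
  assumes "k0 \<le> n - 1" and d: "exp (- 2 * real k0 * L / (n - 1)) \<le> d"
  shows "(\<Sum>k\<in>{k0..<n-1}. mean n p (n - 1) (\<lambda>E xs. real (card (fire_tree.fire_at E xs k)))) \<le> fire_tail n p d"
proof -
  define a where "a = real (n - 1)"
  define r where "r = exp (- 2 * L / a)"
  have a: "a > 0" "a = real n - 1" using n2 by (auto simp: a_def)
  have r: "0 < r" "r < 1" using a L_pos by (auto simp: r_def)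
  have pow: "exp (- 2 * real k * L / a) = r ^ k" for k :: nat
    unfolding r_def exp_of_nat_mult[symmetric] by (simp add: mult_ac)
  have geo: "(\<Sum>k\<in>{k0..<n-1}. r ^ k) \<le> r ^ k0 * (1 + a / (2 * L))"
  proof -
    have "(\<Sum>k\<in>{k0..<n-1}. r ^ k) = (\<Sum>k<n-1-k0. r ^ (k0 + k))"
    proof -
      define j where "j = n - 1 - k0"
      have "n - 1 = j + k0" using assms(1) by (simp add: j_def)
      then show ?thesis using sum.shift_bounds_nat_ivl[of "\<lambda>k. r ^ k" 0 k0 j]
        unfolding j_def[symmetric] by (simp add: atLeast0LessThan add.commute)
    qed
    also have "\<dots> = r ^ k0 * (\<Sum>k<n-1-k0. r ^ k)" by (simp add: power_add sum_distrib_left)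
    also have "(\<Sum>k<n-1-k0. r ^ k) \<le> 1 / (1 - r)"
      using r by (auto simp: sum_gp_strict intro!: divide_right_mono)
    \<comment> \<open>This is \<open>1 / (1 - exp (- t)) <= 1 + 1 / t\<close> at
      \<open>t = 2 L / a\<close>.\<close>
    also have "1 / (1 - r) \<le> 1 + a / (2 * L)"
    proof -
      define t where "t = 2 * L / a"
      have t: "t > 0" using a L_pos by (simp add: t_def)
      have "1 + t \<le> exp t" by (rule exp_ge_add_one_self)
      then have "exp (- t) \<le> 1 / (1 + t)" using t by (simp add: exp_minus divide_simps)
      then have "r \<le> 1 / (1 + t)" by (simp add: r_def t_def)
      then have "r * (1 + t) \<le> 1" using t by (simp add: pos_le_divide_eq)
      then have "1 / (1 - r) \<le> 1 + 1 / t" using r t by (simp add: field_simps)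
      then show ?thesis using a L_pos by (simp add: t_def)
    qed
    finally show ?thesis using r by simp
  qed
  have "(\<Sum>k\<in>{k0..<n-1}. mean n p (n - 1) (\<lambda>E xs. real (card (fire_tree.fire_at E xs k))))
    \<le> (\<Sum>k\<in>{k0..<n-1}. 12 * p * (real n)\<^sup>2 / a * (r ^ k + exp (- L / 2)))"
    by (intro sum_mono order_trans[OF mean_fire_at_le]) (auto simp: pow[symmetric] a_def)
  also have "\<dots> = 12 * p * (real n)\<^sup>2 / a * ((\<Sum>k\<in>{k0..<n-1}. r ^ k) + real (n - 1 - k0) * exp (- L / 2))"
    unfolding sum_distrib_left[symmetric] sum.distrib by simp
  also have "\<dots> \<le> 12 * p * (real n)\<^sup>2 / a * (d * (1 + a / (2 * L)) + a * exp (- L / 2))"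
  proof (intro mult_left_mono add_mono mult_right_mono)
    have "r ^ k0 * (1 + a / (2 * L)) \<le> d * (1 + a / (2 * L))"
      using d a L_pos unfolding pow[symmetric] a_def[symmetric] by (intro mult_right_mono) auto
    then show "(\<Sum>k\<in>{k0..<n-1}. r ^ k) \<le> d * (1 + a / (2 * L))" using geo by simp
  qed (use p a in \<open>auto simp: a_def\<close>)
  also have "\<dots> = fire_tail n p d"
    using a(1) L_pos unfolding fire_tail_def a(2)[symmetric] by (simp add: field_simps)
  finally show ?thesis .
qed

lemma mean_all_fires_le: "mean n p (n - 1) (\<lambda>E xs. real (card (all_fires E xs))) \<le> fire_tail n p 1"
proof -
  have "mean n p (n - 1) (\<lambda>E xs. real (card (all_fires E xs)))
    \<le> rt_avg n (\<lambda>E. \<Sum>k<n-1. marked_mean p E (n - 1) (\<lambda>xs. real (card (fire_tree.fire_at E xs k))))"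
    unfolding mean_def
  proof (rule rt_avg_mono)
    fix E assume E: "E \<in> recursive_trees n"
    show "marked_mean p E (n - 1) (\<lambda>xs. real (card (all_fires E xs)))
      \<le> (\<Sum>k<n-1. marked_mean p E (n - 1) (\<lambda>xs. real (card (fire_tree.fire_at E xs k))))"
      using fire_tree.marked_mean_all_fires_le[OF tree[OF E]] m_tree[OF E] by simp
  qed
  also have "\<dots> = (\<Sum>k\<in>{0..<n-1}. mean n p (n - 1) (\<lambda>E xs. real (card (fire_tree.fire_at E xs k))))"
    unfolding rt_avg_sum mean_def by (simp add: atLeast0LessThan)
  also have "\<dots> \<le> fire_tail n p 1" by (rule sum_mean_fire_at_le) auto
  finally show ?thesis .
qed

end

context fire_early
begin

text \<open>Early fires are small by concentration. For late ones the crude bound on all fires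
  suffices, as it has decayed to the order \<open>exp (- 2 * K)\<close> by then.\<close>

lemma mean_small_fires_le: "mean n p (n - 1) (\<lambda>E xs. real (card (small_fires E xs))) \<le> small_bound K n p"
proof -
  let ?f = "\<lambda>k. mean n p (n - 1) (\<lambda>E xs. real (card (small_fire E xs k)))"
  define g where "g = real n - 1 - K * n / L"
  have g: "g > 0" using gap_pos by (simp add: g_def)
  have "mean n p (n - 1) (\<lambda>E xs. real (card (small_fires E xs)))
    \<le> rt_avg n (\<lambda>E. \<Sum>k<n-1. marked_mean p E (n - 1) (\<lambda>xs. real (card (small_fire E xs k))))"
    unfolding mean_def
  proof (rule rt_avg_mono)
    fix E assume E: "E \<in> recursive_trees n"
    show "marked_mean p E (n - 1) (\<lambda>xs. real (card (small_fires E xs)))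
      \<le> (\<Sum>k<n-1. marked_mean p E (n - 1) (\<lambda>xs. real (card (small_fire E xs k))))"
      using fire_tree.marked_mean_small_fires_le[OF tree[OF E]] m_tree[OF E] by simp
  qed
  also have "\<dots> = (\<Sum>k<n-1. ?f k)"
    unfolding rt_avg_sum mean_def ..
  also have "\<dots> = (\<Sum>k | k < n - 1 \<and> early k. ?f k) + (\<Sum>k | k < n - 1 \<and> \<not> early k. ?f k)"
    by (subst sum.union_disjoint[symmetric]) (auto intro!: sum.cong)
  also have "(\<Sum>k | k < n - 1 \<and> early k. ?f k) \<le> (K * n / L + 1) * (p * ((real n)\<^sup>2 * var_bound K n) / g)"
  proof -
    have each: "?f k \<le> p * ((real n)\<^sup>2 * var_bound K n) / g" if k: "early k" for k
    proof -
      note e = early_bounds[OF k]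
      have "?f k \<le> rt_avg n (\<lambda>E. p / real (n - 1 - k) * marked_mean p E k (\<lambda>xs. pairs n E xs - (root_size E xs)\<^sup>2))"
        unfolding mean_def
      proof (rule rt_avg_mono)
        fix E assume E: "E \<in> recursive_trees n"
        show "marked_mean p E (n - 1) (\<lambda>xs. real (card (small_fire E xs k)))
          \<le> p / real (n - 1 - k) * marked_mean p E k (\<lambda>xs. pairs n E xs - (root_size E xs)\<^sup>2)"
          using fire_tree.marked_mean_small_fire[OF tree[OF E], of k] e(1) m_tree[OF E] by simp
      qed
      also have "\<dots> = p / real (n - 1 - k) * mean n p k (\<lambda>E xs. pairs n E xs - (root_size E xs)\<^sup>2)"
        unfolding rt_avg_mult mean_def ..
      also have "\<dots> \<le> p / g * ((real n)\<^sup>2 * var_bound K n)"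
      proof (rule mult_mono)
        show "p / real (n - 1 - k) \<le> p / g" using e(2) g p unfolding g_def[symmetric] by (intro divide_left_mono) auto
        show "mean n p k (\<lambda>E xs. pairs n E xs - (root_size E xs)\<^sup>2) \<le> (real n)\<^sup>2 * var_bound K n"
          using mean_nonroot_pairs[OF k] by simp
        have "mean n p k (\<lambda>E xs. 0) \<le> mean n p k (\<lambda>E xs. pairs n E xs - (root_size E xs)\<^sup>2)"
          using e(1) pairs_ge_root_size by (intro mean_mono) auto
        then show "0 \<le> mean n p k (\<lambda>E xs. pairs n E xs - (root_size E xs)\<^sup>2)" by (simp add: mean_const)
      qed (use p g in auto)
      finally show ?thesis by simp
    qed
    have "{k. k < n - 1 \<and> early k} \<subseteq> {..nat \<lfloor>K * n / L\<rfloor>}"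
      by (auto simp: early_def le_nat_iff le_floor_iff)
    then have "card {k. k < n - 1 \<and> early k} \<le> card {..nat \<lfloor>K * n / L\<rfloor>}" by (intro card_mono) auto
    then have "real (card {k. k < n - 1 \<and> early k}) \<le> real (Suc (nat \<lfloor>K * n / L\<rfloor>))" by simp
    also have "\<dots> \<le> K * n / L + 1" using Kn_nonneg by simp
    finally have c: "real (card {k. k < n - 1 \<and> early k}) \<le> K * n / L + 1" .
    have "(\<Sum>k | k < n - 1 \<and> early k. ?f k)
      \<le> real (card {k. k < n - 1 \<and> early k}) * (p * ((real n)\<^sup>2 * var_bound K n) / g)"
      by (rule sum_bounded_above) (use each in auto)
    also have "\<dots> \<le> (K * n / L + 1) * (p * ((real n)\<^sup>2 * var_bound K n) / g)"
      using c p g var_bound_pos by (intro mult_right_mono) auto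
    finally show ?thesis .
  qed
  also have "(\<Sum>k | k < n - 1 \<and> \<not> early k. ?f k) \<le> fire_tail n p (exp (- 2 * K))"
  proof -
    define k0 where "k0 = min (n - 1) (Suc (nat \<lfloor>K * n / L\<rfloor>))"
    have nn: "0 \<le> mean n p (n - 1) (\<lambda>E xs. real (card (fire_tree.fire_at E xs k)))" for k
      using mean_mono[of "n - 1" "\<lambda>_ _. 0" "\<lambda>E xs. real (card (fire_tree.fire_at E xs k))"] by (simp add: mean_const)
    have "(\<Sum>k | k < n - 1 \<and> \<not> early k. ?f k)
      \<le> (\<Sum>k | k < n - 1 \<and> \<not> early k. mean n p (n - 1) (\<lambda>E xs. real (card (fire_tree.fire_at E xs k))))"
    proof (rule sum_mono)
      fix k assume "k \<in> {k. k < n - 1 \<and> \<not> early k}"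
      then have k: "k < n - 1" by simp
      show "?f k \<le> mean n p (n - 1) (\<lambda>E xs. real (card (fire_tree.fire_at E xs k)))"
        unfolding mean_def
      proof (rule rt_avg_mono)
        fix E assume E: "E \<in> recursive_trees n"
        show "marked_mean p E (n - 1) (\<lambda>xs. real (card (small_fire E xs k)))
          \<le> marked_mean p E (n - 1) (\<lambda>xs. real (card (fire_tree.fire_at E xs k)))"
          using fire_tree.small_fire_le_fire_at[OF tree[OF E], of k] k m_tree[OF E] by simp
      qed
    qed
    also have "\<dots> \<le> (\<Sum>k\<in>{k0..<n-1}. mean n p (n - 1) (\<lambda>E xs. real (card (fire_tree.fire_at E xs k))))"
    proof (rule sum_mono2)
      show "{k. k < n - 1 \<and> \<not> early k} \<subseteq> {k0..<n-1}"
      proof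
        fix k assume "k \<in> {k. k < n - 1 \<and> \<not> early k}"
        then have "k < n - 1" "K * n / L < real k" by (auto simp: early_def)
        then have "\<lfloor>K * n / L\<rfloor> < int k" by (simp add: floor_less_iff)
        moreover have "0 \<le> \<lfloor>K * n / L\<rfloor>" using Kn_nonneg by simp
        ultimately have "nat \<lfloor>K * n / L\<rfloor> < k" by (simp add: nat_less_iff)
        then show "k \<in> {k0..<n-1}" using \<open>k < n - 1\<close> by (auto simp: k0_def min_def)
      qed
    qed (simp, rule nn)
    also have "\<dots> \<le> fire_tail n p (exp (- 2 * K))"
    proof (rule sum_mean_fire_at_le)
      show "k0 \<le> n - 1" by (simp add: k0_def)
      have "K * n / L \<le> real k0"
      proof -
        have "K * n / L \<le> real (n - 1)" using gap_pos real_m by linarith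
        moreover have "K * n / L \<le> real (Suc (nat \<lfloor>K * n / L\<rfloor>))" using Kn_nonneg by linarith
        ultimately show ?thesis by (simp add: k0_def min_def)
      qed
      then have "K * n \<le> k0 * L" using L_pos by (simp add: pos_divide_le_eq)
      moreover have "K * real (n - 1) \<le> K * n" using K by simp
      ultimately have "K * real (n - 1) \<le> k0 * L" by linarith
      then have "K \<le> k0 * L / real (n - 1)" using n2 by (simp add: pos_le_divide_eq)
      then show "exp (- 2 * real k0 * L / real (n - 1)) \<le> exp (- 2 * K)" by simp
    qed
    finally show ?thesis .
  qed
  finally show ?thesis unfolding small_bound_def g_def by simp
qed

section \<open>Survival of the root component during the early steps\<close>

lemma alive_nonneg: "k \<le> n - 1 \<Longrightarrow> 0 \<le> alive k"
  using mean_mono[of k "\<lambda>_ _. 0" "\<lambda>E xs. of_bool (no_root_fire E xs)"]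
  by (simp add: mean_const alive_def)

lemma early_mono: "early k \<Longrightarrow> j \<le> k \<Longrightarrow> early j"
  by (auto simp: early_def)

lemma decay_early: "early k \<Longrightarrow> exp (- K) \<le> decay n k"
  using L_pos n2 by (simp add: early_def decay_def pos_le_divide_eq pos_divide_le_eq)

lemma hazard_error_nonneg: "0 \<le> hazard_error K n"
proof -
  have "1 \<le> (real n + 1) / (real n - 1 - K * n / L)" using gap_pos Kn_nonneg by simp
  then show ?thesis using var_bound_pos unfolding hazard_error_def by (simp add: less_imp_le)
qed

text \<open>During the early steps \<open>decay\<close> stays above \<open>exp (- K)\<close>. The
  errors \<open>p * hazard_error\<close> are damped by the factors \<open>1 - p * exp (- K)\<close>
  and sum to a bound free of \<open>p\<close>; adding them over \<open>k\<close> undamped steps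
  would give no control in the supercritical regime, where \<open>p k\<close> is unbounded.\<close>

lemma alive_le_geometric:
  assumes "early k"
  shows "alive k \<le> (1 - p * exp (- K)) ^ k + hazard_error K n / exp (- K)"
  using assms
proof (induction k)
  case 0
  then show ?case using hazard_error_nonneg by (simp add: alive_0)
next
  case (Suc k)
  let ?t = "exp (- K)" and ?h = "hazard_error K n"
  have e: "early k" using Suc.prems early_mono by (metis le_Suc_eq order_refl)
  have t: "p * ?t \<le> 1" using p K by (simp add: mult_le_one)
  have "alive (Suc k) \<le> alive k * (1 - p * decay n k) + p * ?h" using alive_Suc[OF e] by linarith
  also have "\<dots> \<le> alive k * (1 - p * ?t) + p * ?h"
    using decay_early[OF e] p alive_nonneg early_bounds(1)[OF e] by (intro add_right_mono mult_left_mono diff_left_mono) auto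
  also have "\<dots> \<le> ((1 - p * ?t) ^ k + ?h / ?t) * (1 - p * ?t) + p * ?h"
    using Suc.IH[OF e] t by (intro add_right_mono mult_right_mono) auto
  also have "(a + h / t) * (1 - p * t) + p * h = a * (1 - p * t) + h / t" if "t > 0" for a h t :: real
    using that by (simp add: field_simps)
  then have "((1 - p * ?t) ^ k + ?h / ?t) * (1 - p * ?t) + p * ?h = (1 - p * ?t) ^ Suc k + ?h / ?t"
    by simp
  finally show ?case .
qed

lemma exp_minus_quadratic: "0 \<le> t \<Longrightarrow> \<bar>(1 - t) - exp (- t)\<bar> \<le> t\<^sup>2" for t :: real
proof -
  assume t: "0 \<le> t"
  have "1 + t \<le> exp t" by (rule exp_ge_add_one_self)
  then have "exp (- t) \<le> 1 / (1 + t)" using t by (simp add: exp_minus divide_simps)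
  also have "\<dots> \<le> 1 - t + t\<^sup>2"
  proof -
    have "(1 - t + t\<^sup>2) * (1 + t) = 1 + t ^ 3" by (simp add: power2_eq_square power3_eq_cube algebra_simps)
    then have "1 \<le> (1 - t + t\<^sup>2) * (1 + t)" using t by simp
    then show ?thesis using t by (simp add: pos_divide_le_eq)
  qed
  moreover have "1 - t \<le> exp (- t)" using exp_ge_add_one_self[of "- t"] by simp
  ultimately show ?thesis by linarith
qed

text \<open>\<open>C\<close> is chosen so that
  \<open>C * (decay n k - decay n (Suc k)) = p * decay n k\<close> holds exactly. The comparison
  function is then multiplied by \<open>exp (- p * decay n k)\<close> in each step, and a step loses
  only the hazard error and a term of order \<open>p^2\<close>.\<close>

lemma alive_approx:
  fixes C :: real
  assumes C: "C = p / (1 - exp (- L / n))"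
  shows "early k \<Longrightarrow> \<bar>alive k - exp (- C * (1 - decay n k))\<bar> \<le> k * (p * (hazard_error K n + p))"
proof (induction k)
  case 0
  then show ?case by (simp add: alive_0 decay_def)
next
  case (Suc k)
  let ?b = "\<lambda>k. exp (- C * (1 - decay n k))" and ?t = "p * decay n k"
  have e: "early k" using Suc.prems early_mono by (metis le_Suc_eq order_refl)
  have Ln: "exp (- L / n) < 1" using L_pos n2 by simp
  have C0: "C \<ge> 0" using p Ln by (simp add: C)
  have dS: "decay n (Suc k) = decay n k * exp (- L / n)"
    by (simp add: decay_def exp_add[symmetric] add_divide_distrib[symmetric] algebra_simps)
  have "C * (1 - decay n (Suc k)) = C * (1 - decay n k) + C * (1 - exp (- L / n)) * decay n k"
    unfolding dS by (simp add: algebra_simps)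
  also have "C * (1 - exp (- L / n)) = p"
  proof -
    have "a / b * b = a" if "b \<noteq> 0" for a b :: real using that by simp
    moreover have "1 - exp (- L / n) \<noteq> 0" using Ln by linarith
    ultimately show ?thesis unfolding C by blast
  qed
  finally have bS: "?b (Suc k) = ?b k * exp (- ?t)"
    by (simp add: exp_add[symmetric])
  have t: "0 \<le> ?t" "?t \<le> p" "?t \<le> 1" using p decay_bounds[of k] by (auto simp: mult_left_le mult_le_one)
  have b: "0 \<le> ?b k" "?b k \<le> 1" using C0 decay_bounds[of k] by (auto simp: mult_nonneg_nonneg)
  have "\<bar>(alive k - ?b k) * (1 - ?t)\<bar> \<le> \<bar>alive k - ?b k\<bar>"
    using t by (simp add: abs_mult mult_left_le)
  moreover have "\<bar>?b k * ((1 - ?t) - exp (- ?t))\<bar> \<le> p * p"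
  proof -
    have "\<bar>?b k * ((1 - ?t) - exp (- ?t))\<bar> \<le> 1 * ?t\<^sup>2"
      unfolding abs_mult using b exp_minus_quadratic[OF t(1)] by (intro mult_mono) auto
    also have "\<dots> \<le> p * p" unfolding power2_eq_square using t p by (auto intro: mult_mono)
    finally show ?thesis .
  qed
  moreover have "\<bar>alive (Suc k) - alive k * (1 - ?t)\<bar> \<le> p * hazard_error K n" by (rule alive_Suc[OF e])
  moreover have "alive (Suc k) - ?b (Suc k) = (alive (Suc k) - alive k * (1 - ?t)) + (alive k - ?b k) * (1 - ?t)
      + ?b k * ((1 - ?t) - exp (- ?t))"
    unfolding bS by (simp add: algebra_simps)
  ultimately have "\<bar>alive (Suc k) - ?b (Suc k)\<bar> \<le> p * hazard_error K n + \<bar>alive k - ?b k\<bar> + p * p"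
    by linarith
  also have "\<dots> \<le> real (Suc k) * (p * (hazard_error K n + p))"
    using Suc.IH[OF e] by (simp add: algebra_simps)
  finally show ?case .
qed

definition mass_cdf :: "real \<Rightarrow> real" where
  "mass_cdf x = mean n p (n - 1) (\<lambda>E xs. of_bool (real (root_fire_mass E xs) / n \<le> x))"

text \<open>By \<open>root_fire_mass_bounds\<close>, each inclusion between \<open>mass <= x\<close>
  and survival up to \<open>k\<close> fails only if the root component is off its prediction by at
  least \<open>d\<close>, the gap left between \<open>x\<close> and \<open>decay n k\<close>;
  Chebyshev's inequality bounds that event.\<close>

lemma mass_cdf_bounds:
  assumes k: "early k" and d: "d > 0"
  shows "x + d \<le> decay n k \<Longrightarrow> mass_cdf x \<le> alive k + var_bound K n / d\<^sup>2"
    and "decay n k \<le> x - d \<Longrightarrow> alive k - var_bound K n / d\<^sup>2 \<le> mass_cdf x"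
proof -
  have kn: "k \<le> n - 1" using early_bounds(1)[OF k] by simp
  let ?D = "\<lambda>E xs. of_bool (\<bar>root_size E xs / n - decay n k\<bar> \<ge> d) :: real"
  let ?A = "\<lambda>E xs. of_bool (no_root_fire E xs) :: real"
  have al: "alive k = mean n p (n - 1) (\<lambda>E xs. ?A E (take k xs))"
    unfolding alive_def using mean_take[OF kn order_refl, of ?A] by simp
  have D: "mean n p (n - 1) (\<lambda>E xs. ?D E (take k xs)) \<le> var_bound K n / d\<^sup>2"
    using mean_take[OF kn order_refl, of ?D] mean_prob_root_size[OF k d] by simp
  have n0: "real n > 0" using n2 by simp
  have b: "no_root_fire E (take k xs) \<Longrightarrow> real (root_fire_mass E xs) / n \<le> root_size E (take k xs) / n"
    "\<not> no_root_fire E (take k xs) \<Longrightarrow> root_size E (take k xs) / n \<le> real (root_fire_mass E xs) / n"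
    if E: "E \<in> recursive_trees n" and xs: "xs \<in> set_pmf (order_pmf p E (n - 1))" for E xs
  proof -
    interpret fire_tree n E p by (rule tree[OF E])
    have "length xs = n - 1" using valid_marked_order[of "n - 1" xs] xs m_tree[OF E] by simp
    then have "k \<le> length xs" using kn by simp
    from root_fire_mass_bounds[OF this]
    show "no_root_fire E (take k xs) \<Longrightarrow> real (root_fire_mass E xs) / n \<le> root_size E (take k xs) / n"
      "\<not> no_root_fire E (take k xs) \<Longrightarrow> root_size E (take k xs) / n \<le> real (root_fire_mass E xs) / n"
      unfolding root_card_def using n0 by (auto intro!: divide_right_mono)
  qed
  show "mass_cdf x \<le> alive k + var_bound K n / d\<^sup>2" if x: "x + d \<le> decay n k"
  proof -
    have "mass_cdf x \<le> mean n p (n - 1) (\<lambda>E xs. ?A E (take k xs) + ?D E (take k xs))"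
      unfolding mass_cdf_def
    proof (rule mean_mono)
      fix E xs assume h: "E \<in> recursive_trees n" "xs \<in> set_pmf (order_pmf p E (n - 1))"
      show "of_bool (real (root_fire_mass E xs) / n \<le> x) \<le> ?A E (take k xs) + ?D E (take k xs)"
      proof (cases "no_root_fire E (take k xs)")
        case False
        from b(2)[OF h this] x show ?thesis by (auto simp: of_bool_def)
      qed auto
    qed simp
    then show ?thesis unfolding mean_add[OF order_refl] using al D by simp
  qed
  show "alive k - var_bound K n / d\<^sup>2 \<le> mass_cdf x" if x: "decay n k \<le> x - d"
  proof -
    have "mean n p (n - 1) (\<lambda>E xs. ?A E (take k xs) - ?D E (take k xs)) \<le> mass_cdf x"
      unfolding mass_cdf_def
    proof (rule mean_mono)
      fix E xs assume h: "E \<in> recursive_trees n" "xs \<in> set_pmf (order_pmf p E (n - 1))"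
      show "?A E (take k xs) - ?D E (take k xs) \<le> of_bool (real (root_fire_mass E xs) / n \<le> x)"
      proof (cases "no_root_fire E (take k xs)")
        case True
        from b(1)[OF h this] x show ?thesis by (auto simp: of_bool_def)
      qed auto
    qed simp
    then show ?thesis unfolding mean_diff[OF order_refl] using al D by simp
  qed
qed

end

text \<open>\<open>root_fire_mass\<close> and \<open>small_fires\<close> are functions of the tree
  and its marked order, while the final state in \<open>fire_rrt\<close> has forgotten the
  order.\<close>

definition fire_space :: "nat \<Rightarrow> real \<Rightarrow> (nat set set \<times> (nat set \<times> bool) list) pmf" where
  "fire_space n p = bind_pmf (pmf_of_set (recursive_trees n)) (\<lambda>E. map_pmf (Pair E) (order_pmf p E (n - 1)))"

lemma fire_rrt_eq:
  assumes "n \<ge> 1"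
  shows "fire_rrt n p = map_pmf (\<lambda>(E, xs). run E xs) (fire_space n p)"
  unfolding fire_rrt_def fire_space_def map_bind_pmf pmf.map_comp
proof (rule bind_pmf_cong[OF refl])
  fix E assume "E \<in> set_pmf (pmf_of_set (recursive_trees n))"
  then have E: "E \<in> recursive_trees n"
    using recursive_trees_nonempty[OF assms] finite_recursive_trees by simp
  show "pmf_of_set (permutations_of_set E) \<bind> (\<lambda>es. fire_dynamics p E es ({}, {}))
    = map_pmf ((\<lambda>(E, xs). run E xs) \<circ> Pair E) (order_pmf p E (n - 1))"
    unfolding fire_dynamics_marked_order[OF recursive_trees_finite[OF E]] card_recursive_tree[OF E assms]
    by (rule map_pmf_cong) (simp_all add: run_def)
qed

lemma expectation_fire_space:
  assumes "n \<ge> 1"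
  shows "measure_pmf.expectation (fire_space n p) (\<lambda>(E, xs). h E xs) = mean n p (n - 1) h"
proof -
  have "measure_pmf.expectation (fire_space n p) (\<lambda>(E, xs). h E xs)
    = measure_pmf.expectation (pmf_of_set (recursive_trees n)) (\<lambda>E.
        measure_pmf.expectation (map_pmf (Pair E) (order_pmf p E (n - 1))) (\<lambda>(E, xs). h E xs))"
    unfolding fire_space_def
    using recursive_trees_nonempty[OF assms] finite_recursive_trees
      finite_set_order_pmf[OF recursive_trees_finite, of _ n] card_recursive_tree[OF _ assms]
    by (intro expectation_bind_finite) auto
  then show ?thesis
    using recursive_trees_nonempty[OF assms] finite_recursive_trees
    by (simp add: integral_pmf_of_set mean_def rt_avg_def)
qed

section \<open>Limits\<close>

lemma pair_gain_tendsto: "K > 0 \<Longrightarrow> pair_gain K \<longlonglongrightarrow> 0"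
  unfolding pair_gain_def[abs_def] by real_asymp

lemma root_loss_tendsto: "K > 0 \<Longrightarrow> root_loss K \<longlonglongrightarrow> 0"
  unfolding root_loss_def[abs_def] by real_asymp

lemma var_bound_tendsto: "K > 0 \<Longrightarrow> var_bound K \<longlonglongrightarrow> 0"
  unfolding var_bound_def[abs_def]
  using tendsto_add[OF pair_gain_tendsto tendsto_mult_left[OF root_loss_tendsto, of K 2], of K] by simp

lemma hazard_error_tendsto: "K > 0 \<Longrightarrow> hazard_error K \<longlonglongrightarrow> 0"
proof -
  assume K: "K > 0"
  have 1: "(\<lambda>n. (real n + 1) / (real n - 1 - K * n / ln n) - 1) \<longlonglongrightarrow> 0" using K by real_asymp
  have 2: "(\<lambda>n. 2 * sqrt (var_bound K n)) \<longlonglongrightarrow> 2 * sqrt 0"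
    by (intro tendsto_intros var_bound_tendsto K)
  show ?thesis unfolding hazard_error_def[abs_def] using tendsto_add[OF 2 1] by simp
qed

lemma eventually_ln_gt: "eventually (\<lambda>n. 4 * K < ln (real n)) sequentially"
  by real_asymp

lemma prob_eq_expectation:
  "measure (measure_pmf M) {x \<in> space (measure_pmf M). Q x} = measure_pmf.expectation M (\<lambda>x. of_bool (Q x))"
proof -
  have "(\<lambda>x. of_bool (Q x) :: real) = indicator {x. Q x}" by (auto simp: indicator_def)
  then show ?thesis by simp
qed

lemma expectation_fire_rrt:
  assumes "n \<ge> 1"
  shows "measure_pmf.expectation (fire_rrt n p) F = mean n p (n - 1) (\<lambda>E xs. F (run E xs))"
  unfolding fire_rrt_eq[OF assms] using expectation_fire_space[OF assms, of p "\<lambda>E xs. F (run E xs)"]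
  by (simp add: split_def)

section \<open>The regimes along a sequence of parameters\<close>

locale fire_sequence =
  fixes p :: "nat \<Rightarrow> real"
  assumes p_bounds: "\<And>n. n \<ge> 1 \<Longrightarrow> 0 \<le> p n \<and> p n \<le> 1"
begin

definition ratio :: "nat \<Rightarrow> real" where
  "ratio n = real n * p n / ln (real n)"

lemma mean_field: "n \<ge> 2 \<Longrightarrow> mean_field n (p n)"
  using p_bounds[of n] by unfold_locales auto

lemma eventually_fire_early: "K > 0 \<Longrightarrow> eventually (\<lambda>n. fire_early n (p n) K) sequentially"
  using eventually_ln_gt[of K] eventually_ge_at_top[of 2]
proof eventually_elim
  case (elim n)
  then show ?case using mean_field[of n] by (simp add: fire_early_def fire_early_axioms_def)
qed

lemma full_run:
  assumes n: "n \<ge> 2" and E: "E \<in> recursive_trees n" and xs: "xs \<in> set_pmf (order_pmf (p n) E (n - 1))"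
  shows "recursive_tree n E" "recursive_tree.valid E xs" "fst ` set xs = E"
proof -
  interpret mean_field n "p n" by (rule mean_field[OF n])
  interpret T: fire_tree n E "p n" by (rule tree[OF E])
  show "recursive_tree n E" by unfold_locales
  show "T.valid xs" using T.valid_marked_order[of "n - 1" xs] xs m_tree[OF E] by simp
  show "fst ` set xs = E" using T.full_marked_order[of xs] xs m_tree[OF E] by simp
qed

lemma fire_tail_eq:
  assumes "n \<ge> 2"
  shows "fire_tail n (p n) d = n * (12 * ratio n * (d * (ln n / (real n - 1) + 1 / 2) + ln n * exp (- ln n / 2)))"
proof -
  have "ln (real n) > 0" "real n - 1 > 0" using assms by auto
  then show ?thesis unfolding fire_tail_def ratio_def
    by (simp add: power2_eq_square field_simps)
qed

lemma ln_exp_tendsto: "(\<lambda>n. d * (ln (real n) / (real n - 1) + 1 / 2) + ln (real n) * exp (- ln (real n) / 2)) \<longlonglongrightarrow> d / 2"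
proof -
  have "(\<lambda>n. ln (real n) / (real n - 1) + 1 / 2) \<longlonglongrightarrow> 1 / 2" by real_asymp
  moreover have "(\<lambda>n. ln (real n) * exp (- ln (real n) / 2)) \<longlonglongrightarrow> 0" by real_asymp
  ultimately have "(\<lambda>n. d * (ln (real n) / (real n - 1) + 1 / 2) + ln (real n) * exp (- ln (real n) / 2))
    \<longlonglongrightarrow> d * (1 / 2) + 0" by (intro tendsto_add tendsto_mult_left)
  then show ?thesis by simp
qed

text \<open>Markov's inequality: the mean number of vertices touched by any fire is of order
  \<open>n * ratio n\<close>.\<close>

theorem subcritical:
  assumes r: "ratio \<longlonglongrightarrow> 0"
  shows "converges_in_probability (\<lambda>n. measure_pmf (fire_rrt n (p n)))
          (\<lambda>n S. real (num_fireproof n S) / real n) 1"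
  unfolding converges_in_probability_def
proof (intro conjI allI impI)
  fix \<delta> :: real assume \<delta>: "\<delta> > 0"
  let ?P = "\<lambda>n. measure (measure_pmf (fire_rrt n (p n)))
    {S \<in> space (measure_pmf (fire_rrt n (p n))). \<delta> < \<bar>real (num_fireproof n S) / real n - 1\<bar>}"
  let ?B = "\<lambda>n. 1 / \<delta> * (12 * ratio n * (1 * (ln (real n) / (real n - 1) + 1 / 2) + ln (real n) * exp (- ln (real n) / 2)))"
  show "?P \<longlonglongrightarrow> 0"
  proof (rule tendsto_sandwich[of "\<lambda>_. 0" _ _ ?B])
    show "?B \<longlonglongrightarrow> 0"
      using tendsto_mult_left[OF tendsto_mult[OF tendsto_mult_left[OF r] ln_exp_tendsto], of "1 / \<delta>" 12 1] by simp
    show "eventually (\<lambda>n. ?P n \<le> ?B n) sequentially"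
      using eventually_ge_at_top[of 2]
    proof eventually_elim
      case (elim n)
      interpret mean_field n "p n" by (rule mean_field[OF elim])
      have n0: "real n > 0" using elim by simp
      have "?P n = mean n (p n) (n - 1) (\<lambda>E xs. of_bool (\<delta> < \<bar>real (num_fireproof n (run E xs)) / n - 1\<bar>))"
        unfolding prob_eq_expectation expectation_fire_rrt[OF n1] ..
      also have "\<dots> \<le> mean n (p n) (n - 1) (\<lambda>E xs. 1 / (\<delta> * n) * real (card (all_fires E xs)))"
      proof (rule mean_mono)
        fix E xs assume h: "E \<in> recursive_trees n" "xs \<in> set_pmf (order_pmf (p n) E (n - 1))"
        interpret T: recursive_tree n E by (rule full_run[OF elim h])
        note b = T.num_fireproof_le[OF full_run(2,3)[OF elim h]]
        have "\<bar>real (num_fireproof n (run E xs)) / n - 1\<bar> = (n - real (num_fireproof n (run E xs))) / n"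
          using b(3) n0 by (simp add: diff_divide_distrib)
        also have "\<dots> \<le> real (card (all_fires E xs)) / n" using b(2) by (intro divide_right_mono) auto
        finally have "\<bar>real (num_fireproof n (run E xs)) / n - 1\<bar> \<le> real (card (all_fires E xs)) / n" .
        then show "of_bool (\<delta> < \<bar>real (num_fireproof n (run E xs)) / n - 1\<bar>)
          \<le> 1 / (\<delta> * n) * real (card (all_fires E xs))"
          using \<delta> n0 by (auto simp: of_bool_def field_simps)
      qed simp
      also have "\<dots> \<le> 1 / (\<delta> * n) * fire_tail n (p n) 1"
        unfolding mean_mult using mean_all_fires_le \<delta> by (intro mult_left_mono) auto
      also have "\<dots> = ?B n" unfolding fire_tail_eq[OF elim] using n0 \<delta> by simp
      finally show ?case .
    qed
  qed simp_all
qed simp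

lemma steps_early: "fire_early n (p n) K \<Longrightarrow> fire_early.early n K (nat \<lfloor>K * n / ln n\<rfloor>)"
proof -
  assume a: "fire_early n (p n) K"
  then have "real (nat \<lfloor>K * n / ln n\<rfloor>) \<le> K * n / ln n" using fire_early.Kn_nonneg[OF a] by simp
  then show ?thesis by (simp add: fire_early.early_def[OF a])
qed

text \<open>More than \<open>\<delta> n\<close> fireproof vertices mean that the first root fire, if
  any, has mass at most \<open>1 - \<delta>\<close>. With \<open>K = \<delta> / 2\<close> the
  predicted proportion at the last early step is at least
  \<open>exp (- K) >= 1 - \<delta> + K\<close>, so, deviations aside, the root component has
  survived up to that step; the probability of this tends to \<open>0\<close>.\<close>

theorem supercritical:
  assumes r: "filterlim ratio at_top sequentially"
  shows "converges_in_probability (\<lambda>n. measure_pmf (fire_rrt n (p n)))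
          (\<lambda>n S. real (num_fireproof n S) / real n) 0"
  unfolding converges_in_probability_def
proof (intro conjI allI impI)
  fix \<delta> :: real assume \<delta>: "\<delta> > 0"
  let ?P = "\<lambda>n. measure (measure_pmf (fire_rrt n (p n)))
    {S \<in> space (measure_pmf (fire_rrt n (p n))). \<delta> < \<bar>real (num_fireproof n S) / real n - 0\<bar>}"
  define K where "K = \<delta> / 2"
  have K: "K > 0" using \<delta> by (simp add: K_def)
  let ?B = "\<lambda>n. exp (exp (- K) * (1 - K * ratio n)) + hazard_error K n / exp (- K) + var_bound K n / K\<^sup>2"
  show "?P \<longlonglongrightarrow> 0"
  proof (rule tendsto_sandwich[of "\<lambda>_. 0" _ _ ?B])
    have "filterlim (\<lambda>n. exp (- K) * (1 - K * ratio n)) at_bot sequentially"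
    proof -
      have "filterlim (\<lambda>x. exp (- K) * (1 - K * x)) at_bot at_top" using K by real_asymp
      from filterlim_compose[OF this r] show ?thesis .
    qed
    then have 1: "(\<lambda>n. exp (exp (- K) * (1 - K * ratio n))) \<longlonglongrightarrow> 0"
      by (rule filterlim_compose[OF exp_at_bot])
    have "?B \<longlonglongrightarrow> 0 + 0 / exp (- K) + 0 / K\<^sup>2"
      using K by (intro tendsto_add tendsto_divide 1 hazard_error_tendsto var_bound_tendsto tendsto_const) auto
    then show "?B \<longlonglongrightarrow> 0" by simp
    show "eventually (\<lambda>n. ?P n \<le> ?B n) sequentially"
      using eventually_fire_early[OF K] eventually_ge_at_top[of 2]
    proof eventually_elim
      case (elim n)
      interpret fire_early n "p n" K by (rule elim)
      define k where "k = nat \<lfloor>K * n / ln n\<rfloor>"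
      have ek: "early k" unfolding k_def by (rule steps_early[OF elim(1)])
      have "?P n = mean n (p n) (n - 1) (\<lambda>E xs. of_bool (\<delta> < \<bar>real (num_fireproof n (run E xs)) / n - 0\<bar>))"
        unfolding prob_eq_expectation expectation_fire_rrt[OF n1] ..
      also have "\<dots> \<le> mass_cdf (1 - \<delta>)"
        unfolding mass_cdf_def
      proof (rule mean_mono)
        fix E xs assume h: "E \<in> recursive_trees n" "xs \<in> set_pmf (order_pmf (p n) E (n - 1))"
        interpret T: recursive_tree n E by (rule full_run[OF elim(2) h])
        have "real (num_fireproof n (run E xs)) / n \<le> (n - real (root_fire_mass E xs)) / n"
          using T.num_fireproof_le(1)[OF full_run(2,3)[OF elim(2) h]] by (intro divide_right_mono) auto
        then have "real (num_fireproof n (run E xs)) / n \<le> 1 - real (root_fire_mass E xs) / n"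
          using n2 by (simp add: diff_divide_distrib)
        then show "(of_bool (\<delta> < \<bar>real (num_fireproof n (run E xs)) / n - 0\<bar>) :: real)
          \<le> of_bool (real (root_fire_mass E xs) / n \<le> 1 - \<delta>)" by (auto simp: of_bool_def)
      qed simp
      also have "\<dots> \<le> alive k + var_bound K n / K\<^sup>2"
      proof (rule mass_cdf_bounds(1)[OF ek K(1)])
        have "1 - K \<le> exp (- K)" using exp_ge_add_one_self[of "- K"] by simp
        then show "1 - \<delta> + K \<le> decay n k" using decay_early[OF ek] by (simp add: K_def)
      qed
      also have "alive k \<le> (1 - p n * exp (- K)) ^ k + hazard_error K n / exp (- K)"
        by (rule alive_le_geometric[OF ek])
      also have "(1 - p n * exp (- K)) ^ k \<le> exp (exp (- K) * (1 - K * ratio n))"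
      proof -
        have pe: "p n * exp (- K) \<le> 1" using p K by (simp add: mult_le_one)
        have "1 - p n * exp (- K) \<le> exp (- (p n * exp (- K)))"
          using exp_ge_add_one_self[of "- (p n * exp (- K))"] by simp
        then have "(1 - p n * exp (- K)) ^ k \<le> exp (- (p n * exp (- K))) ^ k"
          using pe by (intro power_mono) auto
        also have "\<dots> = exp (exp (- K) * (- (p n * k)))" by (simp add: exp_of_nat_mult[symmetric] mult_ac)
        also have "\<dots> \<le> exp (exp (- K) * (1 - K * ratio n))"
        proof -
          \<comment> \<open>Rounding \<open>k\<close> down loses at most one step, hence at most
            \<open>p n <= 1\<close> before the factor \<open>exp (- K)\<close>; this is the
            \<open>1\<close> in the bound.\<close>
          have "K * n / L - 1 \<le> k" unfolding k_def using Kn_nonneg by linarith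
          then have "p n * (K * n / L - 1) \<le> p n * k" using p by (intro mult_left_mono) auto
          moreover have "p n * (K * n / L) = K * ratio n" by (simp add: ratio_def)
          ultimately have "- (p n * k) \<le> 1 - K * ratio n" using p by (simp add: right_diff_distrib)
          then show ?thesis unfolding exp_le_cancel_iff by (intro mult_left_mono) auto
        qed
        finally show ?thesis .
      qed
      finally show ?case by simp
    qed
  qed simp_all
qed simp

lemma eventually_small:
  fixes c e :: real
  assumes r: "ratio \<longlonglongrightarrow> c" and c: "c > 0" and e: "e > 0"
  shows "eventually (\<lambda>n. mean n (p n) (n - 1) (\<lambda>E xs. real (card (small_fires E xs))) \<le> e * real n) sequentially"
proof -
  \<comment> \<open>In the limit the late fires contribute \<open>6 * c * exp (- 2 * K)\<close>,
    which is at most \<open>e / 2\<close> for this \<open>K\<close>; the early part vanishes with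
    \<open>var_bound\<close>. The maximum with \<open>1\<close> keeps \<open>K\<close>
    positive.\<close>
  define K where "K = max 1 (- ln (e / (12 * c)) / 2)"
  have K: "K > 0" by (simp add: K_def)
  have "- 2 * K \<le> ln (e / (12 * c))" by (simp add: K_def)
  then have "exp (- 2 * K) \<le> exp (ln (e / (12 * c)))" by simp
  also have "\<dots> = e / (12 * c)" using e c by simp
  finally have "exp (- 2 * K) \<le> e / (12 * c)" .
  then have cK: "12 * c * (exp (- 2 * K) / 2) < e" using c e by (simp add: field_simps)
  let ?B = "\<lambda>n. ((K + ln (real n) / n) * ((real n) / (real n - 1 - K * n / ln n))) * ratio n * var_bound K n
    + 12 * ratio n * (exp (- 2 * K) * (ln (real n) / (real n - 1) + 1 / 2) + ln (real n) * exp (- ln (real n) / 2))"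
  have "(\<lambda>n. (K + ln (real n) / n) * ((real n) / (real n - 1 - K * n / ln n))) \<longlonglongrightarrow> K"
    using K by real_asymp
  then have "?B \<longlonglongrightarrow> K * c * 0 + 12 * c * (exp (- 2 * K) / 2)"
    by (intro tendsto_add tendsto_mult r var_bound_tendsto K ln_exp_tendsto tendsto_const)
  then have "eventually (\<lambda>n. ?B n < e) sequentially" using cK by (intro order_tendstoD(2)) auto
  then show ?thesis using eventually_fire_early[OF K] eventually_ge_at_top[of 2]
  proof eventually_elim
    case (elim n)
    interpret fire_early n "p n" K by (rule elim)
    have "mean n (p n) (n - 1) (\<lambda>E xs. real (card (small_fires E xs))) \<le> small_bound K n (p n)"
      by (rule mean_small_fires_le)
    also have "\<dots> = n * ?B n"
    proof -
      define g where "g = real n - 1 - K * n / L"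
      have g: "g > 0" using gap_pos by (simp add: g_def)
      have "(K * n / L + 1) * (p n * ((real n)\<^sup>2 * var_bound K n) / g)
        = n * ((K + L / n) * (n / g) * ratio n * var_bound K n)"
        unfolding ratio_def using L_pos g n2 by (simp add: power2_eq_square field_simps)
      then show ?thesis unfolding small_bound_def fire_tail_eq[OF elim(3)] g_def by (simp add: distrib_left)
    qed
    also have "\<dots> \<le> n * e" using elim(1) by (intro mult_left_mono) auto
    also have "n * e = e * n" by (rule mult.commute)
    finally show ?case .
  qed
qed

text \<open>At this step \<open>decay\<close> equals \<open>y\<close> up to a factor at most
  \<open>exp (ln n / n)\<close> from rounding. The constant of \<open>alive_approx\<close> is
  \<open>p / (1 - exp (- s))\<close> with \<open>s = ln n / n\<close>, hence asymptotically
  \<open>ratio\<close>.\<close>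

lemma alive_tendsto:
  assumes r: "ratio \<longlonglongrightarrow> c" and y: "0 < y" "y < 1"
  defines "k \<equiv> \<lambda>n. nat \<lfloor>- ln y * real n / ln (real n)\<rfloor>"
  shows "(\<lambda>n. decay n (k n)) \<longlonglongrightarrow> y"
    and "(\<lambda>n. fire_early.alive n (p n) (k n)) \<longlonglongrightarrow> exp (- c * (1 - y))"
proof -
  define K where "K = - ln y"
  have K: "K > 0" using y by (simp add: K_def)
  have yK: "y = exp (- K)" using y by (simp add: K_def)
  note ev = eventually_fire_early[OF K]
  show d: "(\<lambda>n. decay n (k n)) \<longlonglongrightarrow> y"
  proof (rule tendsto_sandwich[of "\<lambda>_. y" _ _ "\<lambda>n. y * exp (ln (real n) / n)"])
    show "eventually (\<lambda>n. y \<le> decay n (k n)) sequentially" using ev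
    proof eventually_elim
      case (elim n)
      interpret fire_early n "p n" K by (rule elim)
      show ?case using decay_early[OF steps_early[OF elim]] by (simp add: k_def K_def[symmetric] yK)
    qed
    show "eventually (\<lambda>n. decay n (k n) \<le> y * exp (ln (real n) / n)) sequentially" using ev
    proof eventually_elim
      case (elim n)
      interpret fire_early n "p n" K by (rule elim)
      have "K * n / L - 1 \<le> k n" unfolding k_def K_def[symmetric] using Kn_nonneg by linarith
      then have "(K * n / L - 1) * (L / n) \<le> k n * (L / n)" using L_pos by (intro mult_right_mono) auto
      moreover have "(K * n / L - 1) * (L / n) = K - L / n" using L_pos n2 by (simp add: field_simps)
      ultimately have "K - L / n \<le> k n * L / n" by simp
      then show ?case by (simp add: decay_def yK exp_add[symmetric])
    qed
    have "(\<lambda>n. exp (ln (real n) / n)) \<longlonglongrightarrow> 1" by real_asymp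
    then show "(\<lambda>n. y * exp (ln (real n) / n)) \<longlonglongrightarrow> y" using tendsto_mult_left[of _ 1 _ y] by force
  qed simp
  define C where "C n = p n / (1 - exp (- ln (real n) / n))" for n
  have Cc: "C \<longlonglongrightarrow> c"
  proof -
    have "(\<lambda>n. (ln (real n) / n) / (1 - exp (- ln (real n) / n))) \<longlonglongrightarrow> 1" by real_asymp
    from tendsto_mult[OF r this] have "(\<lambda>n. ratio n * ((ln (real n) / n) / (1 - exp (- ln (real n) / n)))) \<longlonglongrightarrow> c" by simp
    moreover have "eventually (\<lambda>n. ratio n * ((ln (real n) / n) / (1 - exp (- ln (real n) / n))) = C n) sequentially"
      using eventually_ge_at_top[of 2]
    proof eventually_elim
      case (elim n)
      then have "ln (real n) > 0" by simp
      then show ?case using elim by (simp add: ratio_def C_def)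
    qed
    ultimately show ?thesis by (rule Lim_transform_eventually)
  qed
  have p0: "p \<longlonglongrightarrow> 0"
  proof -
    have "(\<lambda>n. ln (real n) / n) \<longlonglongrightarrow> 0" by real_asymp
    from tendsto_mult[OF r this] have "(\<lambda>n. ratio n * (ln (real n) / n)) \<longlonglongrightarrow> 0" by simp
    moreover have "eventually (\<lambda>n. ratio n * (ln (real n) / n) = p n) sequentially"
      using eventually_ge_at_top[of 2] by eventually_elim (simp add: ratio_def)
    ultimately show ?thesis by (rule Lim_transform_eventually)
  qed
  have lim: "(\<lambda>n. exp (- C n * (1 - decay n (k n)))) \<longlonglongrightarrow> exp (- c * (1 - y))"
    by (intro tendsto_intros Cc d)
  have "(\<lambda>n. fire_early.alive n (p n) (k n) - exp (- C n * (1 - decay n (k n)))) \<longlonglongrightarrow> 0"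
  proof (rule Lim_null_comparison)
    show "eventually (\<lambda>n. norm (fire_early.alive n (p n) (k n) - exp (- C n * (1 - decay n (k n))))
       \<le> K * ratio n * (hazard_error K n + p n)) sequentially" using ev
    proof eventually_elim
      case (elim n)
      interpret fire_early n "p n" K by (rule elim)
      have "early (k n)" using steps_early[OF elim] by (simp add: k_def K_def[symmetric])
      then have kK: "real (k n) \<le> K * n / L" by (simp add: early_def)
      have "norm (alive (k n) - exp (- C n * (1 - decay n (k n)))) \<le> k n * (p n * (hazard_error K n + p n))"
        using alive_approx[OF C_def \<open>early (k n)\<close>] by simp
      also have "\<dots> \<le> K * n / L * (p n * (hazard_error K n + p n))"
        using kK p hazard_error_nonneg by (intro mult_right_mono) auto
      also have "\<dots> = K * ratio n * (hazard_error K n + p n)" by (simp add: ratio_def)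
      finally show ?case .
    qed
    have "(\<lambda>n. K * ratio n * (hazard_error K n + p n)) \<longlonglongrightarrow> K * c * (0 + 0)"
      by (intro tendsto_intros r p0 hazard_error_tendsto K)
    then show "(\<lambda>n. K * ratio n * (hazard_error K n + p n)) \<longlonglongrightarrow> 0" by simp
  qed
  from tendsto_add[OF this lim] show "(\<lambda>n. fire_early.alive n (p n) (k n)) \<longlonglongrightarrow> exp (- c * (1 - y))" by simp
qed

text \<open>\<open>mass_cdf_bounds\<close> asks for a gap between \<open>x\<close> and
  \<open>decay n k\<close>, so the step is tuned to some \<open>y\<close> slightly above
  \<open>x\<close> for the upper bound and slightly below for the lower one; continuity of the limit
  closes the gap.\<close>

lemma mass_cdf_tendsto:
  assumes r: "ratio \<longlonglongrightarrow> c" and c: "c > 0" and x: "0 < x" "x < 1"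
  shows "(\<lambda>n. fire_early.mass_cdf n (p n) x) \<longlonglongrightarrow> exp (- c * (1 - x))"
proof -
  let ?f = "\<lambda>y. exp (- c * (1 - y))"
  have cont: "(?f \<longlongrightarrow> ?f x) (at x)" by (intro tendsto_intros)
  have step: "eventually (\<lambda>n. fire_early n (p n) (- ln y) \<and>
      \<bar>decay n (nat \<lfloor>- ln y * real n / ln (real n)\<rfloor>) - y\<bar> < d \<and>
      \<bar>fire_early.alive n (p n) (nat \<lfloor>- ln y * real n / ln (real n)\<rfloor>) - ?f y\<bar> < d \<and>
      var_bound (- ln y) n / e\<^sup>2 < d) sequentially" if "0 < y" "y < 1" "d > 0" "e > 0" for y d e
  proof -
    have K: "- ln y > 0" using that by simp
    have "(\<lambda>n. var_bound (- ln y) n / e\<^sup>2) \<longlonglongrightarrow> 0 / e\<^sup>2"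
      by (intro tendsto_intros var_bound_tendsto K) (use that in simp)
    then have "eventually (\<lambda>n. var_bound (- ln y) n / e\<^sup>2 < d) sequentially"
      using that by (intro order_tendstoD(2)) auto
    then show ?thesis
      using eventually_fire_early[OF K] tendstoD[OF alive_tendsto(1)[OF r that(1,2)] that(3)]
        tendstoD[OF alive_tendsto(2)[OF r that(1,2)] that(3)]
      by eventually_elim (simp add: dist_real_def)
  qed
  show ?thesis
  proof (rule order_tendstoI)
    fix a assume a: "?f x < a"
    have "eventually (\<lambda>y. ?f y < a) (at_right x)"
      using order_tendstoD(2)[OF cont a] by (simp add: eventually_at_split)
    moreover have "eventually (\<lambda>y. y \<in> {x<..<1}) (at_right x)" using x(2) by (rule eventually_at_right_real)
    ultimately have "eventually (\<lambda>y. ?f y < a \<and> x < y \<and> y < 1) (at_right x)"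
      by eventually_elim simp
    then obtain y where y: "?f y < a" "x < y" "y < 1"
      using eventually_happens'[OF trivial_limit_at_right_real] by blast
    \<comment> \<open>Survival and deviation probability each receive half of the margin below
      \<open>a\<close>. Half of the gap between \<open>x\<close> and \<open>y\<close> is granted to
      \<open>decay\<close>, the other half to the deviation of the root component.\<close>
    define d where "d = min ((a - ?f y) / 2) ((y - x) / 2)"
    have d: "d > 0" using y by (simp add: d_def)
    have d2: "d \<le> (a - ?f y) / 2" "d \<le> (y - x) / 2"
      unfolding d_def by (rule min.cobounded1, rule min.cobounded2)
    have near: "x + (y - x) / 2 \<le> D" if "\<bar>D - y\<bar> < d" for D
      using that d2 by argo
    have less: "A + V < a" if "\<bar>A - ?f y\<bar> < d" "V < d" for A V
      using that d2 by argo
    have "eventually (\<lambda>n. fire_early n (p n) (- ln y) \<and>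
      \<bar>decay n (nat \<lfloor>- ln y * real n / ln (real n)\<rfloor>) - y\<bar> < d \<and>
      \<bar>fire_early.alive n (p n) (nat \<lfloor>- ln y * real n / ln (real n)\<rfloor>) - ?f y\<bar> < d \<and>
      var_bound (- ln y) n / ((y - x) / 2)\<^sup>2 < d) sequentially"
      using x y d by (intro step) auto
    then show "eventually (\<lambda>n. fire_early.mass_cdf n (p n) x < a) sequentially"
    proof eventually_elim
      case (elim n)
      then interpret fire_early n "p n" "- ln y" by simp
      let ?k = "nat \<lfloor>- ln y * real n / ln (real n)\<rfloor>"
      have "early ?k" using steps_early elim by blast
      moreover have "x + (y - x) / 2 \<le> decay n ?k" using elim by (intro near) blast
      ultimately have "mass_cdf x \<le> alive ?k + var_bound (- ln y) n / ((y - x) / 2)\<^sup>2"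
        using y by (intro mass_cdf_bounds(1)) auto
      also have "\<dots> < a" using elim by (intro less) blast+
      finally show ?case .
    qed
  next
    fix a assume a: "a < ?f x"
    have "eventually (\<lambda>y. a < ?f y) (at_left x)"
      using order_tendstoD(1)[OF cont a] by (simp add: eventually_at_split)
    moreover have "eventually (\<lambda>y. y \<in> {0<..<x}) (at_left x)" using x(1) by (rule eventually_at_left_real)
    ultimately have "eventually (\<lambda>y. a < ?f y \<and> 0 < y \<and> y < x) (at_left x)"
      by eventually_elim simp
    then obtain y where y: "a < ?f y" "0 < y" "y < x"
      using eventually_happens'[OF trivial_limit_at_left_real] by blast
    define d where "d = min ((?f y - a) / 2) ((x - y) / 2)"
    have d: "d > 0" using y by (simp add: d_def)
    have d2: "d \<le> (?f y - a) / 2" "d \<le> (x - y) / 2"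
      unfolding d_def by (rule min.cobounded1, rule min.cobounded2)
    have near: "D \<le> x - (x - y) / 2" if "\<bar>D - y\<bar> < d" for D
      using that d2 by argo
    have less: "a < A - V" if "\<bar>A - ?f y\<bar> < d" "V < d" for A V
      using that d2 by argo
    have "eventually (\<lambda>n. fire_early n (p n) (- ln y) \<and>
      \<bar>decay n (nat \<lfloor>- ln y * real n / ln (real n)\<rfloor>) - y\<bar> < d \<and>
      \<bar>fire_early.alive n (p n) (nat \<lfloor>- ln y * real n / ln (real n)\<rfloor>) - ?f y\<bar> < d \<and>
      var_bound (- ln y) n / ((x - y) / 2)\<^sup>2 < d) sequentially"
      using x y d by (intro step) auto
    then show "eventually (\<lambda>n. a < fire_early.mass_cdf n (p n) x) sequentially"
    proof eventually_elim
      case (elim n)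
      then interpret fire_early n "p n" "- ln y" by simp
      let ?k = "nat \<lfloor>- ln y * real n / ln (real n)\<rfloor>"
      have "early ?k" using steps_early elim by blast
      moreover have "decay n ?k \<le> x - (x - y) / 2" using elim by (intro near) blast
      ultimately have "alive ?k - var_bound (- ln y) n / ((x - y) / 2)\<^sup>2 \<le> mass_cdf x"
        using y by (intro mass_cdf_bounds(2)) auto
      moreover have "a < alive ?k - var_bound (- ln y) n / ((x - y) / 2)\<^sup>2" using elim by (intro less) blast+
      ultimately show ?case by (rule less_le_trans[rotated])
    qed
  qed
qed

end

section \<open>Test functions near the limit curve and the limit law\<close>

lemma continuous_map_limit_vector: "continuous_map euclideanreal l1.mtopology limit_vector"
  unfolding l1.continuous_map_to_metric
proof (intro ballI allI impI)
  fix x \<epsilon> :: real assume e: "\<epsilon> > 0"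
  show "\<exists>U. openin euclideanreal U \<and> x \<in> U \<and> (\<forall>y\<in>U. limit_vector y \<in> l1.mball (limit_vector x) \<epsilon>)"
  proof (intro exI conjI ballI)
    show "openin euclideanreal (ball x (\<epsilon> / 2))" "x \<in> ball x (\<epsilon> / 2)" using e by auto
    fix y assume "y \<in> ball x (\<epsilon> / 2)"
    then show "limit_vector y \<in> l1.mball (limit_vector x) \<epsilon>"
      by (simp add: limit_vector_l1 l1_dist_limit_vector dist_real_def)
  qed
qed

text \<open>A continuous \<open>\<Phi>\<close> may be far from uniformly continuous on
  \<open>l1_space\<close>. The limit vectors form a compact curve, and a finite cover of it yields
  one radius that serves near the whole curve.\<close>

lemma uniform_near_limit_vectors:
  assumes \<Phi>: "continuous_map l1.mtopology euclideanreal \<Phi>" and e: "e > 0"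
  shows "\<exists>d>0. \<forall>t\<in>{0..1}. \<forall>x\<in>l1_space. l1_dist x (limit_vector t) < d \<longrightarrow> \<bar>\<Phi> x - \<Phi> (limit_vector t)\<bar> < e"
proof -
  have "\<exists>r>0. \<forall>x\<in>l1_space. l1_dist (limit_vector t) x < r \<longrightarrow> \<Phi> x \<in> ball (\<Phi> (limit_vector t)) (e / 2)" for t
    using \<Phi> e unfolding l1.continuous_map_from_metric
    by (auto simp: limit_vector_l1 dest!: bspec[of _ _ "limit_vector t"] spec[of _ "ball (\<Phi> (limit_vector t)) (e / 2)"])
  then obtain r where r: "\<And>t. r t > 0"
    "\<And>t x. x \<in> l1_space \<Longrightarrow> l1_dist (limit_vector t) x < r t \<Longrightarrow> \<Phi> x \<in> ball (\<Phi> (limit_vector t)) (e / 2)"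
    by metis
  \<comment> \<open>A quarter, because \<open>l1_dist\<close> doubles differences of the parameter:
    this uses up half of \<open>r t\<close> and leaves the other half for \<open>x\<close>.\<close>
  have cover: "{0..1} \<subseteq> (\<Union>t\<in>{0..1}. ball t (r t / 4))" using r(1) by force
  obtain T where T: "T \<subseteq> {0..1}" "finite T" "{0..1} \<subseteq> (\<Union>t\<in>T. ball t (r t / 4))"
    by (rule compactE_image[OF compact_Icc _ cover]) auto
  define d where "d = Min (insert 1 ((\<lambda>t. r t / 2) ` T))"
  have d: "d > 0" using T(2) r(1) by (simp add: d_def)
  have dr: "d \<le> r t / 2" if "t \<in> T" for t unfolding d_def using T(2) that by (intro Min_le) auto
  have "\<bar>\<Phi> x - \<Phi> (limit_vector s)\<bar> < e"
    if s: "s \<in> {0..1}" and x: "x \<in> l1_space" and xs: "l1_dist x (limit_vector s) < d" for s x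
  proof -
    obtain t where t: "t \<in> T" "s \<in> ball t (r t / 4)" using T(3) s by blast
    have ts: "l1_dist (limit_vector t) (limit_vector s) < r t / 2"
      using t(2) by (simp add: l1_dist_limit_vector dist_real_def)
    have "l1_dist (limit_vector t) x \<le> l1_dist (limit_vector t) (limit_vector s) + l1_dist (limit_vector s) x"
      using x limit_vector_l1 by (intro l1.triangle) auto
    also have "\<dots> < r t" using ts xs dr[OF t(1)] l1.commute[of x "limit_vector s"] by linarith
    finally have "\<Phi> x \<in> ball (\<Phi> (limit_vector t)) (e / 2)" using r(2) x by blast
    moreover have "\<Phi> (limit_vector s) \<in> ball (\<Phi> (limit_vector t)) (e / 2)"
      using r(2)[OF limit_vector_l1] ts r(1)[of t] by force
    ultimately show ?thesis unfolding mem_ball dist_real_def by argo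
  qed
  then show ?thesis using d by blast
qed

text \<open>For \<open>0 <= x < 1\<close> the event is that the exponential variable is at least
  \<open>1 - x\<close>. At \<open>x = 0\<close> it leaves an atom of mass \<open>exp (- c)\<close>,
  from the values that are at least \<open>1\<close>.\<close>

lemma limit_law:
  assumes P: "prob_space P" and c: "c > 0" and \<epsilon>: "distributed P lborel \<epsilon> (exponential_density c)"
  shows "real_distribution (distr P borel (\<lambda>\<omega>. 1 - min (\<epsilon> \<omega>) 1))"
    and "x < 0 \<Longrightarrow> cdf (distr P borel (\<lambda>\<omega>. 1 - min (\<epsilon> \<omega>) 1)) x = 0"
    and "0 \<le> x \<Longrightarrow> x < 1 \<Longrightarrow> cdf (distr P borel (\<lambda>\<omega>. 1 - min (\<epsilon> \<omega>) 1)) x = exp (- c * (1 - x))"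
    and "1 \<le> x \<Longrightarrow> cdf (distr P borel (\<lambda>\<omega>. 1 - min (\<epsilon> \<omega>) 1)) x = 1"
proof -
  interpret prob_space P by (rule P)
  have [measurable]: "\<epsilon> \<in> borel_measurable P" using distributed_measurable[OF \<epsilon>] by simp
  let ?g = "\<lambda>\<omega>. 1 - min (\<epsilon> \<omega>) 1"
  have [measurable]: "?g \<in> borel_measurable P" by measurable
  show "real_distribution (distr P borel ?g)" by simp
  have cdf: "cdf (distr P borel ?g) x = prob {\<omega> \<in> space P. ?g \<omega> \<le> x}" for x
    unfolding cdf_def by (subst measure_distr) (auto simp: vimage_def Int_def conj_commute)
  show "cdf (distr P borel ?g) x = 0" if "x < 0"
  proof -
    have "{\<omega> \<in> space P. ?g \<omega> \<le> x} = {}" using that by auto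
    then show ?thesis unfolding cdf by (simp only: measure_empty)
  qed
  have gt: "prob {\<omega> \<in> space P. a < \<epsilon> \<omega>} = exp (- a * c)" if "0 \<le> a" for a
    using exponential_distributedD_gt[OF \<epsilon> that c] .
  show "cdf (distr P borel ?g) x = exp (- c * (1 - x))" if x: "0 \<le> x" "x < 1"
  proof -
    \<comment> \<open>The event contains the boundary value \<open>1 - x\<close>, while the tail
      formula is for a strict inequality; the exponential law has no atoms.\<close>
    have "AE y in lborel. 0 < exponential_density c y \<longrightarrow> y \<noteq> 1 - x"
      using AE_lborel_singleton[of "1 - x"] by eventually_elim auto
    then have "AE \<omega> in P. \<epsilon> \<omega> \<noteq> 1 - x"
      by (subst distributed_AE2[OF \<epsilon>]) auto
    then have "prob {\<omega> \<in> space P. ?g \<omega> \<le> x} = prob {\<omega> \<in> space P. 1 - x < \<epsilon> \<omega>}"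
      using x by (intro measure_eq_AE) (auto simp: min_def)
    then show ?thesis unfolding cdf using gt[of "1 - x"] x by (simp add: algebra_simps)
  qed
  show "cdf (distr P borel ?g) x = 1" if x: "1 \<le> x"
  proof -
    have "1 = prob {\<omega> \<in> space P. 0 < \<epsilon> \<omega>}" using gt[of 0] by simp
    also have "\<dots> \<le> prob {\<omega> \<in> space P. ?g \<omega> \<le> x}" using x by (intro finite_measure_mono) (auto simp: min_def)
    finally show ?thesis unfolding cdf using prob_le_1 by (simp add: antisym)
  qed
qed

section \<open>Weak convergence of the root mass and the critical regime\<close>

context fire_sequence
begin

definition mass :: "nat \<Rightarrow> nat set set \<times> (nat set \<times> bool) list \<Rightarrow> real" where
  "mass n = (\<lambda>(E, xs). real (root_fire_mass E xs) / n)"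

lemma mass_bounds:
  assumes n: "n \<ge> 2" and h: "E \<in> recursive_trees n" "xs \<in> set_pmf (order_pmf (p n) E (n - 1))"
  shows "0 \<le> real (root_fire_mass E xs) / n" "real (root_fire_mass E xs) / n \<le> 1"
proof -
  interpret T: recursive_tree n E by (rule full_run[OF n h])
  have "0 \<le> n - real (root_fire_mass E xs)"
    using T.num_fireproof_le(1)[OF full_run(2,3)[OF n h]] by (rule order_trans[rotated]) simp
  then show "real (root_fire_mass E xs) / n \<le> 1" using n by simp
qed simp

lemma cdf_mass:
  assumes "n \<ge> 1"
  shows "cdf (distr (fire_space n (p n)) borel (mass n)) x
    = mean n (p n) (n - 1) (\<lambda>E xs. of_bool (real (root_fire_mass E xs) / n \<le> x))"
proof -
  have "cdf (distr (fire_space n (p n)) borel (mass n)) x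
    = measure (measure_pmf (fire_space n (p n))) {z \<in> space (measure_pmf (fire_space n (p n))). mass n z \<le> x}"
    unfolding cdf_def by (subst measure_distr) (auto simp: vimage_def)
  also have "\<dots> = measure_pmf.expectation (fire_space n (p n)) (\<lambda>(E, xs). of_bool (real (root_fire_mass E xs) / n \<le> x))"
    unfolding prob_eq_expectation mass_def by (simp add: split_def)
  finally show ?thesis unfolding expectation_fire_space[OF assms] .
qed

lemma mass_weak_conv:
  assumes r: "ratio \<longlonglongrightarrow> c" and c: "c > 0" and P: "prob_space P"
    and \<epsilon>: "distributed P lborel \<epsilon> (exponential_density c)"
  shows "weak_conv_m (\<lambda>n. distr (fire_space n (p n)) borel (mass n)) (distr P borel (\<lambda>\<omega>. 1 - min (\<epsilon> \<omega>) 1))"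
  unfolding weak_conv_m_def weak_conv_def
proof (intro allI impI)
  let ?M = "distr P borel (\<lambda>\<omega>. 1 - min (\<epsilon> \<omega>) 1)"
  let ?\<mu> = "\<lambda>n. distr (fire_space n (p n)) borel (mass n)"
  note lim = limit_law[OF P c \<epsilon>]
  fix x assume cont: "isCont (cdf ?M) x"
  consider "x < 0" | "x = 0" | "0 < x" "x < 1" | "1 \<le> x" by linarith
  then show "(\<lambda>n. cdf (?\<mu> n) x) \<longlonglongrightarrow> cdf ?M x"
  proof cases
    case 1
    have "eventually (\<lambda>n. cdf (?\<mu> n) x = 0) sequentially" using eventually_ge_at_top[of 2]
    proof eventually_elim
      case (elim n)
      interpret mean_field n "p n" by (rule mean_field[OF elim])
      have "mean n (p n) (n - 1) (\<lambda>E xs. of_bool (real (root_fire_mass E xs) / n \<le> x)) = mean n (p n) (n - 1) (\<lambda>_ _. 0)"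
      proof (rule mean_cong)
        fix E xs assume "E \<in> recursive_trees n" "xs \<in> set_pmf (order_pmf (p n) E (n - 1))"
        from mass_bounds(1)[OF elim this] 1 have "\<not> real (root_fire_mass E xs) / n \<le> x" by linarith
        then show "(of_bool (real (root_fire_mass E xs) / n \<le> x) :: real) = 0" by simp
      qed
      then show ?case unfolding cdf_mass[OF n1] mean_const .
    qed
    then show ?thesis using lim(2)[OF 1] by (simp add: tendsto_eventually)
  next
    \<comment> \<open>The limit law has an atom at \<open>0\<close>, so this is not a continuity point.\<close>
    case 2
    have "(cdf ?M \<longlongrightarrow> cdf ?M 0) (at_left 0)"
      using cont 2 unfolding isCont_def by (simp add: filterlim_at_split)
    moreover have "(cdf ?M \<longlongrightarrow> 0) (at_left 0)"
      by (rule tendsto_eventually) (auto simp: eventually_at_filter lim(2))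
    ultimately have "cdf ?M 0 = 0" by (intro tendsto_unique[of "at_left (0::real)"]) auto
    then show ?thesis using lim(3)[of 0] by simp
  next
    case 3
    \<comment> \<open>The value \<open>1\<close> for \<open>K\<close> is arbitrary:
      \<open>mass_cdf\<close> is the same for every \<open>K\<close>.\<close>
    have "eventually (\<lambda>n. fire_early.mass_cdf n (p n) x = cdf (?\<mu> n) x) sequentially"
      using eventually_fire_early[of 1, OF zero_less_one]
    proof eventually_elim
      case (elim n)
      interpret fire_early n "p n" 1 by (rule elim)
      show ?case unfolding cdf_mass[OF n1] mass_cdf_def ..
    qed
    with mass_cdf_tendsto[OF r c 3] show ?thesis using lim(3)[of x] 3 by (auto intro: Lim_transform_eventually)
  next
    case 4
    have "eventually (\<lambda>n. cdf (?\<mu> n) x = 1) sequentially" using eventually_ge_at_top[of 2]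
    proof eventually_elim
      case (elim n)
      interpret mean_field n "p n" by (rule mean_field[OF elim])
      have "mean n (p n) (n - 1) (\<lambda>E xs. of_bool (real (root_fire_mass E xs) / n \<le> x)) = mean n (p n) (n - 1) (\<lambda>_ _. 1)"
      proof (rule mean_cong)
        fix E xs assume "E \<in> recursive_trees n" "xs \<in> set_pmf (order_pmf (p n) E (n - 1))"
        from mass_bounds(2)[OF elim this] 4 have "real (root_fire_mass E xs) / n \<le> x" by linarith
        then show "(of_bool (real (root_fire_mass E xs) / n \<le> x) :: real) = 1" by simp
      qed
      then show ?case unfolding cdf_mass[OF n1] mean_const .
    qed
    then show ?thesis using lim(4)[OF 4] by (simp add: tendsto_eventually)
  qed
qed

text \<open>If the small fires cover few vertices, \<open>uniform_near_limit_vectors\<close>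
  applies. Otherwise the difference is at most \<open>2 * B\<close>, which is then bounded by a
  multiple of the number of vertices in small fires, and that has a small mean.\<close>

lemma expectation_near_limit_vector:
  assumes r: "ratio \<longlonglongrightarrow> c" and c: "c > 0"
    and \<Phi>: "continuous_map l1.mtopology euclideanreal \<Phi>" and B: "\<And>x. x \<in> l1_space \<Longrightarrow> \<bar>\<Phi> x\<bar> \<le> B"
  shows "(\<lambda>n. measure_pmf.expectation (fire_rrt n (p n)) (\<lambda>S. \<Phi> (rescaled_sizes n S))
    - measure_pmf.expectation (fire_space n (p n)) (\<lambda>z. \<Phi> (limit_vector (mass n z)))) \<longlonglongrightarrow> 0"
proof (rule LIMSEQ_I)
  fix e :: real assume e: "e > 0"
  have B0: "B \<ge> 0" using B[OF limit_vector_l1[of 0]] by linarith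
  obtain d where d: "d > 0" "\<And>t x. t \<in> {0..1} \<Longrightarrow> x \<in> l1_space \<Longrightarrow> l1_dist x (limit_vector t) < d
      \<Longrightarrow> \<bar>\<Phi> x - \<Phi> (limit_vector t)\<bar> < e / 2"
    using uniform_near_limit_vectors[OF \<Phi>, of "e / 2"] e by auto
  \<comment> \<open>Makes the mean of the second term of \<open>?U\<close> at most
    \<open>e / 4\<close>; the denominator \<open>B + 1\<close> covers \<open>B = 0\<close>.\<close>
  define s where "s = e * d / (16 * (B + 1))"
  have s: "s > 0" using e d(1) B0 by (simp add: s_def)
  have "eventually (\<lambda>n. norm (measure_pmf.expectation (fire_rrt n (p n)) (\<lambda>S. \<Phi> (rescaled_sizes n S))
    - measure_pmf.expectation (fire_space n (p n)) (\<lambda>z. \<Phi> (limit_vector (mass n z))) - 0) < e) sequentially"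
    using eventually_small[OF r c s] eventually_ge_at_top[of 2]
  proof eventually_elim
    case (elim n)
    interpret mean_field n "p n" by (rule mean_field[OF elim(2)])
    have n0: "real n > 0" using n2 by simp
    let ?X = "\<lambda>E xs. \<Phi> (rescaled_sizes n (run E xs))"
    let ?Y = "\<lambda>E xs. \<Phi> (limit_vector (real (root_fire_mass E xs) / n))"
    let ?U = "\<lambda>E xs. e / 2 + 4 * B / (d * n) * real (card (small_fires E xs))"
    have eq: "measure_pmf.expectation (fire_rrt n (p n)) (\<lambda>S. \<Phi> (rescaled_sizes n S))
      - measure_pmf.expectation (fire_space n (p n)) (\<lambda>z. \<Phi> (limit_vector (mass n z)))
      = mean n (p n) (n - 1) (\<lambda>E xs. ?X E xs - ?Y E xs)"
      unfolding expectation_fire_rrt[OF n1] mean_diff[OF order_refl] mass_def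
      using expectation_fire_space[OF n1, of "p n" ?Y] by (simp add: split_def)
    have bound: "\<bar>?X E xs - ?Y E xs\<bar> \<le> ?U E xs"
      if h: "E \<in> recursive_trees n" "xs \<in> set_pmf (order_pmf (p n) E (n - 1))" for E xs
    proof -
      interpret T: recursive_tree n E by (rule full_run[OF elim(2) h])
      let ?x = "rescaled_sizes n (run E xs)" and ?t = "real (root_fire_mass E xs) / n"
      let ?S = "real (card (small_fires E xs))"
      have t: "?t \<in> {0..1}" using mass_bounds[OF elim(2) h] by simp
      have dist: "l1_dist ?x (limit_vector ?t) \<le> 2 * ?S / n"
        using T.l1_dist_run[OF full_run(2,3)[OF elim(2) h]] by simp
      show ?thesis
      proof (cases "l1_dist ?x (limit_vector ?t) < d")
        case True
        have "\<bar>?X E xs - ?Y E xs\<bar> < e / 2" by (rule d(2)[OF t rescaled_sizes_l1 True])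
        moreover have "0 \<le> 4 * B / (d * n) * ?S" using B0 d(1) by simp
        ultimately show ?thesis by linarith
      next
        case False
        then have "d \<le> 2 * ?S / n" using dist by linarith
        then have "1 \<le> 2 * ?S / n / d" using d(1) by (subst pos_le_divide_eq) auto
        then have "2 * B * 1 \<le> 2 * B * (2 * ?S / n / d)" using B0 by (intro mult_left_mono) auto
        also have "2 * B * (2 * ?S / n / d) = 4 * B / (d * n) * ?S" by (simp add: mult_ac)
        finally have w: "2 * B \<le> 4 * B / (d * n) * ?S" by simp
        have "\<bar>x - y\<bar> \<le> e / 2 + w" if "\<bar>x\<bar> \<le> B" "\<bar>y\<bar> \<le> B" "2 * B \<le> w" for x y w :: real
          using that e by linarith
        from this[OF B[OF rescaled_sizes_l1] B[OF limit_vector_l1] w] show ?thesis .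
      qed
    qed
    have U: "mean n (p n) (n - 1) ?U < e"
    proof -
      have "mean n (p n) (n - 1) ?U = e / 2 + 4 * B / (d * n) * mean n (p n) (n - 1) (\<lambda>E xs. real (card (small_fires E xs)))"
        unfolding mean_add[OF order_refl] mean_mult mean_const ..
      also have "\<dots> \<le> e / 2 + 4 * B / (d * n) * (s * n)"
        using elim(1) B0 d(1) by (intro add_left_mono mult_left_mono) auto
      finally have "mean n (p n) (n - 1) ?U \<le> e / 2 + 4 * B / (d * n) * (s * n)" .
      moreover have "4 * B / (d * n) * (s * n) = e / 4 * (B / (B + 1))"
        using n0 d(1) B0 by (simp add: s_def field_simps)
      moreover have "e / 4 * (B / (B + 1)) \<le> e / 4 * 1" using e B0 by (intro mult_left_mono) auto
      ultimately show ?thesis using e by linarith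
    qed
    have "mean n (p n) (n - 1) (\<lambda>E xs. ?X E xs - ?Y E xs) \<le> mean n (p n) (n - 1) ?U"
      by (rule mean_mono) (use bound abs_le_D1 in blast)+
    moreover have "mean n (p n) (n - 1) (\<lambda>E xs. - 1 * ?U E xs) \<le> mean n (p n) (n - 1) (\<lambda>E xs. ?X E xs - ?Y E xs)"
    proof (rule mean_mono)
      have neg: "- 1 * b \<le> x" if "\<bar>x\<bar> \<le> b" for x b :: real using that by linarith
      fix E xs assume "E \<in> recursive_trees n" "xs \<in> set_pmf (order_pmf (p n) E (n - 1))"
      then show "- 1 * ?U E xs \<le> ?X E xs - ?Y E xs" by (rule neg[OF bound])
    qed simp
    ultimately show ?case unfolding eq using U unfolding mean_mult by (simp add: abs_less_iff)
  qed
  then show "\<exists>no. \<forall>n\<ge>no. norm (measure_pmf.expectation (fire_rrt n (p n)) (\<lambda>S. \<Phi> (rescaled_sizes n S))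
    - measure_pmf.expectation (fire_space n (p n)) (\<lambda>z. \<Phi> (limit_vector (mass n z))) - 0) < e"
    by (simp add: eventually_sequentially)
qed

lemma measurable_borel_of_topology:
  assumes "f \<in> space M \<rightarrow> topspace T" "\<And>U. openin T U \<Longrightarrow> f -` U \<inter> space M \<in> sets M"
  shows "f \<in> measurable M (borel_of_topology T)"
  unfolding borel_of_topology_def
  by (rule measurable_measure_of) (use assms in \<open>auto dest: openin_subset\<close>)

text \<open>Composed with \<open>limit_vector\<close>, a test function on sequences becomes a
  bounded continuous function of one real variable, to which the weak convergence of the root mass
  applies; \<open>expectation_near_limit_vector\<close> supplies the difference.\<close>

theorem critical:
  assumes r: "ratio \<longlonglongrightarrow> c" and c: "c > 0" and P: "prob_space P"
    and \<epsilon>: "distributed P lborel \<epsilon> (exponential_density c)"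
  shows "converges_in_distribution l1.mtopology (\<lambda>n. measure_pmf (fire_rrt n (p n))) rescaled_sizes
          P (\<lambda>\<omega>. limit_vector (1 - min (\<epsilon> \<omega>) 1))"
  unfolding converges_in_distribution_def
proof (intro conjI allI impI)
  fix n
  show "rescaled_sizes n \<in> measure_pmf (fire_rrt n (p n)) \<rightarrow>\<^sub>M borel_of_topology l1.mtopology"
    by (rule measurable_borel_of_topology) (auto simp: rescaled_sizes_l1)
next
  let ?g = "\<lambda>\<omega>. 1 - min (\<epsilon> \<omega>) 1"
  have [measurable]: "\<epsilon> \<in> borel_measurable P" using distributed_measurable[OF \<epsilon>] by simp
  have g: "?g \<in> borel_measurable P" by measurable
  show "(\<lambda>\<omega>. limit_vector (?g \<omega>)) \<in> P \<rightarrow>\<^sub>M borel_of_topology l1.mtopology"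
  proof (rule measurable_borel_of_topology)
    fix U assume "openin l1.mtopology U"
    then have "open (limit_vector -` U)"
      using openin_continuous_map_preimage[OF continuous_map_limit_vector, of U] by (simp add: vimage_def)
    then have "?g -` (limit_vector -` U) \<inter> space P \<in> sets P" by (intro measurable_sets[OF g]) simp
    then show "(\<lambda>\<omega>. limit_vector (?g \<omega>)) -` U \<inter> space P \<in> sets P" by (simp add: vimage_def)
  qed (simp add: limit_vector_l1)
next
  let ?g = "\<lambda>\<omega>. 1 - min (\<epsilon> \<omega>) 1"
  have [measurable]: "\<epsilon> \<in> borel_measurable P" using distributed_measurable[OF \<epsilon>] by simp
  have g: "?g \<in> borel_measurable P" by measurable
  fix \<Phi> :: "(nat \<Rightarrow> real) \<Rightarrow> real"
  assume "continuous_map l1.mtopology euclideanreal \<Phi> \<and> bounded (\<Phi> ` topspace l1.mtopology)"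
  then have \<Phi>: "continuous_map l1.mtopology euclideanreal \<Phi>" and bd: "bounded (\<Phi> ` l1_space)" by auto
  obtain B where B: "\<And>x. x \<in> l1_space \<Longrightarrow> \<bar>\<Phi> x\<bar> \<le> B" using bd unfolding bounded_iff by auto
  have cont: "continuous_on UNIV (\<lambda>t. \<Phi> (limit_vector t))"
    using continuous_map_compose[OF continuous_map_limit_vector \<Phi>] by (simp add: o_def)
  then have isc: "isCont (\<lambda>t. \<Phi> (limit_vector t)) t" for t by (simp add: continuous_on_eq_continuous_at)
  have bm: "(\<lambda>t. \<Phi> (limit_vector t)) \<in> borel_measurable borel" using cont by (rule borel_measurable_continuous_onI)
  have "(\<lambda>n. integral\<^sup>L (distr (fire_space n (p n)) borel (mass n)) (\<lambda>t. \<Phi> (limit_vector t)))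
    \<longlonglongrightarrow> integral\<^sup>L (distr P borel ?g) (\<lambda>t. \<Phi> (limit_vector t))"
  proof (rule weak_conv_imp_integral_bdd_continuous_conv[where B = B])
    show "real_distribution (distr (fire_space n (p n)) borel (mass n))" for n
      by (rule prob_space.real_distribution_distr[OF measure_pmf.prob_space_axioms]) simp
    show "real_distribution (distr P borel ?g)" by (rule limit_law(1)[OF P c \<epsilon>])
    show "weak_conv_m (\<lambda>n. distr (fire_space n (p n)) borel (mass n)) (distr P borel ?g)"
      by (rule mass_weak_conv[OF r c P \<epsilon>])
    show "isCont (\<lambda>t. \<Phi> (limit_vector t)) t" for t by (rule isc)
    show "norm (\<Phi> (limit_vector t)) \<le> B" for t using B[OF limit_vector_l1] by simp
  qed
  then have "(\<lambda>n. measure_pmf.expectation (fire_space n (p n)) (\<lambda>z. \<Phi> (limit_vector (mass n z))))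
    \<longlonglongrightarrow> (\<integral>\<omega>. \<Phi> (limit_vector (?g \<omega>)) \<partial>P)"
    using bm g by (simp add: integral_distr)
  from tendsto_add[OF expectation_near_limit_vector[OF r c \<Phi> B] this]
  show "(\<lambda>n. measure_pmf.expectation (fire_rrt n (p n)) (\<lambda>S. \<Phi> (rescaled_sizes n S)))
    \<longlonglongrightarrow> (\<integral>\<omega>. \<Phi> (limit_vector (?g \<omega>)) \<partial>P)" by simp
qed

end

theorem theorem4:
  fixes p :: "nat \<Rightarrow> real"
    and P :: "'a measure"
  assumes "\<And>n. n \<ge> 1 \<Longrightarrow> 0 \<le> p n \<and> p n \<le> 1"
    and "prob_space P"
  shows
    "((\<lambda>n. real n * p n / ln (real n)) \<longlonglongrightarrow> 0 \<longrightarrow>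
        converges_in_probability (\<lambda>n. measure_pmf (fire_rrt n (p n)))
          (\<lambda>n S. real (num_fireproof n S) / real n) 1) \<and>
     (filterlim (\<lambda>n. real n * p n / ln (real n)) at_top sequentially \<longrightarrow>
        converges_in_probability (\<lambda>n. measure_pmf (fire_rrt n (p n)))
          (\<lambda>n S. real (num_fireproof n S) / real n) 0) \<and>
     (\<forall>c>0. \<forall>\<epsilon>. (\<lambda>n. real n * p n / ln (real n)) \<longlonglongrightarrow> c \<and>
        distributed P lborel \<epsilon> (exponential_density c) \<longrightarrow>
        converges_in_distribution l1.mtopology
          (\<lambda>n. measure_pmf (fire_rrt n (p n))) rescaled_sizes
          P (\<lambda>\<omega> k. if k = 0 then min (\<epsilon> \<omega>) 1
                   else if k = 1 then 1 - min (\<epsilon> \<omega>) 1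
                   else 0))"
proof -
  interpret fire_sequence p by unfold_locales (use assms(1) in auto)
  have ratio: "(\<lambda>n. real n * p n / ln (real n)) = ratio" by (simp add: ratio_def[abs_def])
  have vec: "(\<lambda>\<omega> k. if k = 0 then min (\<epsilon> \<omega>) 1 else if k = 1 then 1 - min (\<epsilon> \<omega>) 1 else 0)
    = (\<lambda>\<omega>. limit_vector (1 - min (\<epsilon> \<omega>) 1))" for \<epsilon> :: "'a \<Rightarrow> real"
    by (intro ext) (simp add: limit_vector_def)
  show ?thesis unfolding ratio vec
    using subcritical supercritical critical[OF _ _ assms(2)] by blast
qed

end
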